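(* Let $X$ be a compact Riemann surface and let $G$ be its conformal automorphism group. Suppose that $Z(G)=\{1\}$ and that either $\mathrm{Out}(G)$ has no involutions or $\mathrm{Inn}(G)$ has a group complement in $\mathrm{Aut}(G)$. Then $X$ is not pseudoreal.
   Context: The conformal automorphism group of $X$ is the group of holomorphic automorphisms of $X$. $Z(G)$ is the center of $G$, $\mathrm{Inn}(G)$ the group of inner automorphisms, and $\mathrm{Out}(G)=\mathrm{Aut}(G)/\mathrm{Inn}(G)$. An involution is an element of order $2$. A group complement of $\mathrm{Inn}(G)$ in $\mathrm{Aut}(G)$ is a subgroup $H\le \mathrm{Aut}(G)$ with $\mathrm{Aut}(G)=H\cdot \mathrm{Inn}(G)$ and $H\cap\mathrm{Inn}(G)=\{1\}$. A compact Riemann surface $X$, viewed as a smooth complex projective curve via any embedding in projective space, is pseudoreal if it is isomorphic to its conjugate $\overline{X}$ (the zero locus of the polynomials obtained by conjugating the coefficients of the defining polynomials of $X$) but is not isomorphic to a curve defined by polynomials with real coefficients. Equivalently, $X$ has anticonformal automorphisms but no anticonformal involutions. *)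

theory Defs
  imports
    "HOL-Complex_Analysis.Complex_Analysis"
    "HOL-Algebra.Bij"
    "HOL-Algebra.Multiplicative_Group"
    "HOL-Library.Poly_Mapping"
begin

section \<open>Group-theoretic notions\<close>

definition group_center :: "('a, 'b) monoid_scheme \<Rightarrow> 'a set" where
  "group_center G =
     {z \<in> carrier G. \<forall>g \<in> carrier G. z \<otimes>\<^bsub>G\<^esub> g = g \<otimes>\<^bsub>G\<^esub> z}"

text \<open>Elements of \<open>AutoGroup G\<close> are extensional functions on the carrier, hence the
  restricted abstraction.\<close>

definition inner_auts :: "('a, 'b) monoid_scheme \<Rightarrow> ('a \<Rightarrow> 'a) set" where
  "inner_auts G =
     (\<lambda>g. \<lambda>x \<in> carrier G. g \<otimes>\<^bsub>G\<^esub> x \<otimes>\<^bsub>G\<^esub> inv\<^bsub>G\<^esub> g) ` carrier G"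

definition outer_aut_group :: "('a, 'b) monoid_scheme \<Rightarrow> ('a \<Rightarrow> 'a) set monoid" where
  "outer_aut_group G = AutoGroup G Mod inner_auts G"

definition is_involution :: "('a, 'b) monoid_scheme \<Rightarrow> 'a \<Rightarrow> bool" where
  "is_involution G x \<longleftrightarrow> x \<in> carrier G \<and> group.ord G x = 2"

definition group_complement :: "('a, 'b) monoid_scheme \<Rightarrow> 'a set \<Rightarrow> 'a set \<Rightarrow> bool" where
  "group_complement G N H \<longleftrightarrow>
     subgroup H G \<and> carrier G = H <#>\<^bsub>G\<^esub> N \<and> H \<inter> N = {\<one>\<^bsub>G\<^esub>}"


section \<open>Compact Riemann surfaces\<close>

text \<open>A chart is a pair of a domain and a coordinate function; the values of the coordinate
  function outside the domain are irrelevant. Riemann surfaces are connected and nonempty.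
  Second countability is automatic for compact surfaces.\<close>

type_synonym 'a atlas = "('a set \<times> ('a \<Rightarrow> complex)) set"

definition compact_riemann_surface :: "'a topology \<Rightarrow> 'a atlas \<Rightarrow> bool" where
  "compact_riemann_surface X A \<longleftrightarrow>
     topspace X \<noteq> {} \<and> compact_space X \<and> connected_space X \<and> Hausdorff_space X \<and>
     (\<Union>(U, z) \<in> A. U) = topspace X \<and>
     (\<forall>(U, z) \<in> A. openin X U \<and> open (z ` U) \<and>
        homeomorphic_map (subtopology X U) (top_of_set (z ` U)) z) \<and>
     (\<forall>(U, z) \<in> A. \<forall>(V, w) \<in> A. (w \<circ> inv_into U z) holomorphic_on z ` (U \<inter> V))"

definition holomorphic_self_map :: "'a topology \<Rightarrow> 'a atlas \<Rightarrow> ('a \<Rightarrow> 'a) \<Rightarrow> bool" where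
  "holomorphic_self_map X A f \<longleftrightarrow>
     continuous_map X X f \<and>
     (\<forall>(U, z) \<in> A. \<forall>(V, w) \<in> A.
        (w \<circ> f \<circ> inv_into U z) holomorphic_on z ` {x \<in> U. f x \<in> V})"

definition conformal_aut_group :: "'a topology \<Rightarrow> 'a atlas \<Rightarrow> ('a \<Rightarrow> 'a) monoid" where
  "conformal_aut_group X A =
     BijGroup (topspace X)
       \<lparr>carrier := {f \<in> Bij (topspace X).
          holomorphic_self_map X A f \<and>
          holomorphic_self_map X A (inv_into (topspace X) f)}\<rparr>"


section \<open>Complex projective space and zero loci\<close>

text \<open>Homogeneous coordinate vectors of \<open>n\<close>-dimensional projective space are the nonzero functions
  supported on \<open>{..n}\<close>. A point is the set of all its coordinate vectors, that is, a line through
  the origin with the origin removed.\<close>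

definition hom_coords :: "nat \<Rightarrow> (nat \<Rightarrow> complex) set" where
  "hom_coords n = {v. (\<exists>i. v i \<noteq> 0) \<and> (\<forall>i>n. v i = 0)}"

definition proj_point :: "(nat \<Rightarrow> complex) \<Rightarrow> (nat \<Rightarrow> complex) set" where
  "proj_point v = {(\<lambda>i. c * v i) | c. c \<noteq> 0}"

definition proj_space :: "nat \<Rightarrow> (nat \<Rightarrow> complex) set set" where
  "proj_space n = proj_point ` hom_coords n"

text \<open>The standard affine charts: \<open>affine_part n i\<close> is the set of points whose \<open>i\<close>-th homogeneous
  coordinate is nonzero, and \<open>affine_coord i j\<close> is the function \<open>x\<^sub>j / x\<^sub>i\<close> on it.\<close>

definition affine_part :: "nat \<Rightarrow> nat \<Rightarrow> (nat \<Rightarrow> complex) set set" where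
  "affine_part n i = {P \<in> proj_space n. \<forall>v \<in> P. v i \<noteq> 0}"

definition affine_coord :: "nat \<Rightarrow> nat \<Rightarrow> (nat \<Rightarrow> complex) set \<Rightarrow> complex" where
  "affine_coord i j P = (let v = (SOME v. v \<in> P) in v j / v i)"

lemma affine_coord_proj_point [simp]: "affine_coord i j (proj_point v) = v j / v i"
proof -
  have "v \<in> proj_point v"
    unfolding proj_point_def by (auto intro!: exI[of _ 1])
  then have "(SOME u. u \<in> proj_point v) \<in> proj_point v"
    by (rule someI[where P = "\<lambda>u. u \<in> proj_point v"])
  then obtain c where "c \<noteq> 0" "(SOME u. u \<in> proj_point v) = (\<lambda>i. c * v i)"
    unfolding proj_point_def by blast
  then show ?thesis
    by (simp add: affine_coord_def)
qed

text \<open>Polynomials in the variables \<open>x\<^sub>0, x\<^sub>1, \<dots>\<close>: a monomial is its finitely supported exponent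
  function, a polynomial is a finitely supported coefficient function on monomials.\<close>

type_synonym cpoly = "(nat \<Rightarrow>\<^sub>0 nat) \<Rightarrow>\<^sub>0 complex"

definition poly_value :: "cpoly \<Rightarrow> (nat \<Rightarrow> complex) \<Rightarrow> complex" where
  "poly_value p v =
     (\<Sum>m \<in> Poly_Mapping.keys p. Poly_Mapping.lookup p m *
        (\<Prod>i \<in> Poly_Mapping.keys m. v i ^ Poly_Mapping.lookup m i))"

definition homogeneous_polys :: "nat \<Rightarrow> cpoly set" where
  "homogeneous_polys n =
     {p. \<exists>d. \<forall>m \<in> Poly_Mapping.keys p.
        Poly_Mapping.keys m \<subseteq> {..n} \<and>
        (\<Sum>i \<in> Poly_Mapping.keys m. Poly_Mapping.lookup m i) = d}"

definition real_poly :: "cpoly \<Rightarrow> bool" where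
  "real_poly p \<longleftrightarrow> (\<forall>m. Poly_Mapping.lookup p m \<in> \<real>)"

definition conj_poly :: "cpoly \<Rightarrow> cpoly" where
  "conj_poly p = Poly_Mapping.map cnj p"

text \<open>The family of equations may be infinite; by Hilbert's basis theorem this gives no further
  zero loci.\<close>

definition zero_locus :: "nat \<Rightarrow> cpoly set \<Rightarrow> (nat \<Rightarrow> complex) set set" where
  "zero_locus n S = {P \<in> proj_space n. \<forall>v \<in> P. \<forall>p \<in> S. poly_value p v = 0}"


section \<open>Projective models and pseudoreal surfaces\<close>

text \<open>An injective holomorphic immersion into projective space. Openness of \<open>T\<close>
  together with holomorphy of the affine coordinates on \<open>T\<close> includes continuity; the
  derivative condition is the immersion condition.\<close>

definition projective_embedding ::
    "'a topology \<Rightarrow> 'a atlas \<Rightarrow> nat \<Rightarrow> ('a \<Rightarrow> (nat \<Rightarrow> complex) set) \<Rightarrow> bool" where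
  "projective_embedding X A n f \<longleftrightarrow>
     f ` topspace X \<subseteq> proj_space n \<and> inj_on f (topspace X) \<and>
     (\<forall>(U, z) \<in> A. \<forall>i \<le> n.
        let T = {x \<in> U. f x \<in> affine_part n i} in
          openin X T \<and>
          (\<forall>j \<le> n. (affine_coord i j \<circ> f \<circ> inv_into U z) holomorphic_on z ` T) \<and>
          (\<forall>x \<in> T. \<exists>j \<le> n. deriv (affine_coord i j \<circ> f \<circ> inv_into U z) (z x) \<noteq> 0))"

text \<open>The surface is isomorphic to the smooth projective curve cut out by \<open>S\<close>: since the
  surface is compact, the image of an embedding is a closed submanifold of
  projective space and the embedding is biholomorphic onto it.\<close>

definition isomorphic_to_curve :: "'a topology \<Rightarrow> 'a atlas \<Rightarrow> nat \<Rightarrow> cpoly set \<Rightarrow> bool" where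
  "isomorphic_to_curve X A n S \<longleftrightarrow>
     S \<subseteq> homogeneous_polys n \<and>
     (\<exists>f. projective_embedding X A n f \<and> f ` topspace X = zero_locus n S)"

text \<open>View the surface as the curve cut out by \<open>S\<close>. The conjugate curve is then cut out by the
  conjugated polynomials; up to isomorphism it does not depend on the choice of \<open>S\<close>.\<close>

definition isomorphic_to_conjugate :: "'a topology \<Rightarrow> 'a atlas \<Rightarrow> bool" where
  "isomorphic_to_conjugate X A \<longleftrightarrow>
     (\<exists>n S. isomorphic_to_curve X A n S \<and> isomorphic_to_curve X A n (conj_poly ` S))"

definition isomorphic_to_real_curve :: "'a topology \<Rightarrow> 'a atlas \<Rightarrow> bool" where
  "isomorphic_to_real_curve X A \<longleftrightarrow>
     (\<exists>n S. (\<forall>p \<in> S. real_poly p) \<and> isomorphic_to_curve X A n S)"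

definition pseudoreal :: "'a topology \<Rightarrow> 'a atlas \<Rightarrow> bool" where
  "pseudoreal X A \<longleftrightarrow> isomorphic_to_conjugate X A \<and> \<not> isomorphic_to_real_curve X A"

end

theory Submission
  imports Defs
begin

text \<open>
  A surface isomorphic to its conjugate has two projective embeddings \<open>f\<close> and \<open>g\<close> whose images are
  the zero locus of \<open>S\<close> and that of the conjugated polynomials, hence complex conjugate sets. So
  \<open>t = f\<^sup>-\<^sup>1 \<circ> conj \<circ> g\<close> is an antiholomorphic bijection of the surface
  (\<open>antihol_conj_transport\<close>). It normalises the group \<open>G\<close> of conformal automorphisms, and \<open>t \<circ> t\<close>
  lies in \<open>G\<close>, so conjugation by \<open>t\<close> is an automorphism of \<open>G\<close> whose square is inner. Under either
  hypothesis on \<open>Out(G)\<close> and \<open>Inn(G)\<close> some \<open>s = t \<circ> b\<close> with \<open>b\<close> in \<open>G\<close> acts on \<open>G\<close> with trivial square: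
  without involutions in \<open>Out(G)\<close> conjugation by \<open>t\<close> is itself inner, and with a complement \<open>H\<close> one
  takes the representative in \<open>H\<close>, whose square lies in \<open>H \<inter> Inn(G)\<close>. Then \<open>s \<circ> s\<close> is a central element
  of \<open>G\<close>, hence the identity, and \<open>s\<close> is an antiholomorphic involution
  (\<open>involution_in_coset\<close>, \<open>antiholomorphic_involution\<close>).

  An antiholomorphic involution \<open>s\<close> yields a real model. If \<open>v\<close> is a coordinate vector of \<open>f x\<close> and
  \<open>w\<close> the conjugate of one of \<open>f (s x)\<close>, the matrix with entries \<open>v\<^sub>i w\<^sub>j\<close> depends holomorphically on \<open>x\<close>
  up to scaling, determines \<open>f x\<close>, and passes to its adjoint when \<open>x\<close> is replaced by \<open>s x\<close>. In suitable
  linear coordinates on the space of matrices taking adjoints is entrywise conjugation, so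
  the surface is embedded with an image that is stable under conjugation (locale
  \<open>conjugated_embedding\<close>).

  It remains to see that this image is the zero locus of real polynomials. This needs Chow's theorem
  for curves: a point \<open>P\<close> outside the image is separated from it by a homogeneous polynomial \<open>Q\<close>
  (\<open>chow_separating_form\<close>); since the image is stable under conjugation, the real and the imaginary
  part of \<open>Q\<close> vanish on it as well, and one of them does not vanish at \<open>P\<close>. To find \<open>Q\<close>, project from \<open>P\<close>:
  two linear forms \<open>\<phi>\<close> and \<open>\<psi>\<close> that vanish at \<open>P\<close> and have no common zero on the image give a meromorphic
  function \<open>t = \<phi> / \<psi>\<close>, proper over the complex plane. For a third linear form \<open>\<xi>\<close> with \<open>\<xi>(P) \<noteq> 0\<close>
  the function \<open>u = \<xi> / \<psi>\<close> is a root of its norm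
  \<open>\<Prod>y\<in>t\<^sup>-\<^sup>1(\<tau>). (T - u y)\<close> over \<open>\<tau> = t x\<close>. The coefficients of this
  monic polynomial in \<open>T\<close> are holomorphic in \<open>\<tau>\<close> away from the finitely many critical values and grow
  polynomially, so they are polynomials by Liouville's theorem (\<open>algebraic_relation\<close>). Clearing
  denominators gives a form that vanishes on the image and equals \<open>\<xi>\<close> to the power of its degree at \<open>P\<close>.
\<close>

section \<open>Involutions in a coset of a centreless subgroup\<close>

definition conj_aut :: "('a, 'b) monoid_scheme \<Rightarrow> 'a set \<Rightarrow> 'a \<Rightarrow> 'a \<Rightarrow> 'a" where
  "conj_aut P C s = (\<lambda>x\<in>C. s \<otimes>\<^bsub>P\<^esub> x \<otimes>\<^bsub>P\<^esub> inv\<^bsub>P\<^esub> s)"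

text \<open>Both inclusions are required: for infinite \<open>C\<close> conjugation by \<open>s\<close> could map \<open>C\<close> properly into
  itself, and would then not be an automorphism of \<open>C\<close>.\<close>

definition conj_stabilizer :: "('a, 'b) monoid_scheme \<Rightarrow> 'a set \<Rightarrow> 'a set" where
  "conj_stabilizer P C = {s \<in> carrier P. \<forall>x\<in>C. s \<otimes>\<^bsub>P\<^esub> x \<otimes>\<^bsub>P\<^esub> inv\<^bsub>P\<^esub> s \<in> C \<and> inv\<^bsub>P\<^esub> s \<otimes>\<^bsub>P\<^esub> x \<otimes>\<^bsub>P\<^esub> s \<in> C}"

lemma (in group) mult_inv_cancel_left:
  assumes "a \<in> carrier G" "b \<in> carrier G"
  shows "a \<otimes> (inv a \<otimes> b) = b" "inv a \<otimes> (a \<otimes> b) = b"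
  using assms by (simp_all flip: m_assoc)

lemma inner_auts_normal:
  assumes "group G"
  shows "inner_auts G \<lhd> AutoGroup G"
proof -
  interpret G: group G by fact
  interpret A: group "AutoGroup G" by (rule G.AutoGroup)
  let ?c = "\<lambda>g. \<lambda>x \<in> carrier G. g \<otimes>\<^bsub>G\<^esub> x \<otimes>\<^bsub>G\<^esub> inv\<^bsub>G\<^esub> g"
  have carA: "carrier (AutoGroup G) = auto G" by (simp add: AutoGroup_def)
  have multA: "f \<otimes>\<^bsub>AutoGroup G\<^esub> h = compose (carrier G) f h" if "f \<in> auto G" "h \<in> auto G" for f h
    using that by (simp add: AutoGroup_def BijGroup_def auto_def)
  have oneA: "\<one>\<^bsub>AutoGroup G\<^esub> = (\<lambda>x\<in>carrier G. x)" by (simp add: AutoGroup_def BijGroup_def)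
  have caut: "?c g \<in> auto G" if g: "g \<in> carrier G" for g
  proof -
    have "?c g \<in> hom G G"
      using g by (auto simp: hom_def G.m_assoc G.mult_inv_cancel_left)
    moreover have "bij_betw (?c g) (carrier G) (carrier G)"
      by (rule bij_betw_byWitness[where f' = "?c (inv\<^bsub>G\<^esub> g)"])
         (use g in \<open>auto simp: G.m_assoc G.mult_inv_cancel_left\<close>)
    ultimately show ?thesis by (simp add: auto_def Bij_def)
  qed
  have cmult: "?c g \<otimes>\<^bsub>AutoGroup G\<^esub> ?c h = ?c (g \<otimes>\<^bsub>G\<^esub> h)" if "g \<in> carrier G" "h \<in> carrier G" for g h
    using that by (auto simp: multA caut compose_def fun_eq_iff G.m_assoc G.inv_mult_group)
  have cone: "?c \<one>\<^bsub>G\<^esub> = \<one>\<^bsub>AutoGroup G\<^esub>" by (auto simp: oneA fun_eq_iff)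
  have cinv: "inv\<^bsub>AutoGroup G\<^esub> (?c g) = ?c (inv\<^bsub>G\<^esub> g)" if "g \<in> carrier G" for g
    by (rule A.inv_equality) (use that in \<open>simp_all only: cmult G.inv_closed G.l_inv cone carA caut\<close>)
  have sub: "subgroup (inner_auts G) (AutoGroup G)"
  proof (rule A.subgroupI)
    show "inner_auts G \<subseteq> carrier (AutoGroup G)" using caut by (auto simp: inner_auts_def carA)
    show "inner_auts G \<noteq> {}" unfolding inner_auts_def using G.one_closed by blast
  next
    fix a assume "a \<in> inner_auts G"
    then obtain g where "g \<in> carrier G" "a = ?c g" unfolding inner_auts_def by blast
    then show "inv\<^bsub>AutoGroup G\<^esub> a \<in> inner_auts G"
      unfolding inner_auts_def using cinv G.inv_closed by blast
  next
    fix a b assume "a \<in> inner_auts G" "b \<in> inner_auts G"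
    then obtain g h where "g \<in> carrier G" "a = ?c g" "h \<in> carrier G" "b = ?c h" unfolding inner_auts_def by blast
    then show "a \<otimes>\<^bsub>AutoGroup G\<^esub> b \<in> inner_auts G"
      unfolding inner_auts_def using cmult G.m_closed by blast
  qed
  show ?thesis
  proof (rule A.normal_invI[OF sub])
    fix f a assume f: "f \<in> carrier (AutoGroup G)" and "a \<in> inner_auts G"
    then obtain g where g: "g \<in> carrier G" "a = ?c g" unfolding inner_auts_def by blast
    have fh: "f \<in> hom G G" and fb: "f \<in> Bij (carrier G)" using f by (auto simp: carA auto_def)
    have fg: "f g \<in> carrier G" using fh g by (auto simp: hom_def)
    interpret fhom: group_hom G G f using fh by unfold_locales
    (* f conjugates the inner automorphism of g to that of f g. *)
    have "f \<otimes>\<^bsub>AutoGroup G\<^esub> a = ?c (f g) \<otimes>\<^bsub>AutoGroup G\<^esub> f"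
      unfolding g(2) using f g(1) fg caut[OF g(1)] caut[OF fg]
      by (intro ext) (auto simp: multA carA compose_def)
    then have "f \<otimes>\<^bsub>AutoGroup G\<^esub> a \<otimes>\<^bsub>AutoGroup G\<^esub> inv\<^bsub>AutoGroup G\<^esub> f = ?c (f g)"
      using f caut[OF fg] A.m_assoc[of "?c (f g)" f "inv\<^bsub>AutoGroup G\<^esub> f"]
        A.r_one[of "?c (f g)"] A.r_inv[of f] A.inv_closed[of f] by (simp only: carA)
    then show "f \<otimes>\<^bsub>AutoGroup G\<^esub> a \<otimes>\<^bsub>AutoGroup G\<^esub> inv\<^bsub>AutoGroup G\<^esub> f \<in> inner_auts G"
      unfolding inner_auts_def using fg by blast
  qed
qed

text \<open>Conjugation by \<open>t\<close> is an automorphism of \<open>C\<close> whose square, conjugation by \<open>t \<otimes> t\<close>, is inner. It can be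
  corrected by an inner automorphism to one with trivial square. The corrected automorphism is
  conjugation by some \<open>s\<close> in the coset \<open>t C\<close>, so that \<open>s \<otimes> s\<close> commutes with \<open>C\<close>; it also lies in \<open>C\<close>,
  whose centre is trivial.\<close>

lemma involution_in_coset:
  fixes P :: "('a, 'b) monoid_scheme"
  assumes P: "group P" and C: "subgroup C P"
    and G: "G = P\<lparr>carrier := C\<rparr>"
    and t: "t \<in> conj_stabilizer P C" and tt: "t \<otimes>\<^bsub>P\<^esub> t \<in> C"
    and centre: "group_center G = {\<one>\<^bsub>G\<^esub>}"
    and hyp: "(\<nexists>x. is_involution (outer_aut_group G) x) \<or>
         (\<exists>H. group_complement (AutoGroup G) (inner_auts G) H)"
  shows "\<exists>g\<in>C. (t \<otimes>\<^bsub>P\<^esub> g) \<otimes>\<^bsub>P\<^esub> (t \<otimes>\<^bsub>P\<^esub> g) = \<one>\<^bsub>P\<^esub>"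
proof -
  interpret P: group P by fact
  interpret C: subgroup C P by fact
  have grpG: "group G" unfolding G by (rule C.subgroup_is_group[OF P])
  interpret G: group G by fact
  interpret A: group "AutoGroup G" by (rule G.AutoGroup)
  interpret N: normal "inner_auts G" "AutoGroup G" by (rule inner_auts_normal[OF grpG])
  let ?N = "conj_stabilizer P C"
  let ?\<psi> = "conj_aut P C"
  have NP: "s \<in> carrier P" if "s \<in> ?N" for s using that by (simp add: conj_stabilizer_def)
  have stab_mult: "s \<otimes>\<^bsub>P\<^esub> r \<in> ?N" if "s \<in> ?N" "r \<in> ?N" for s r
    using that by (auto simp: conj_stabilizer_def P.m_assoc P.inv_mult_group) (metis C.mem_carrier P.inv_closed P.m_assoc P.m_closed)+
  have stabC: "c \<in> ?N" if "c \<in> C" for c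
    using that by (auto simp: conj_stabilizer_def)
  have carG: "carrier G = C" by (simp add: G)
  have multG: "x \<otimes>\<^bsub>G\<^esub> y = x \<otimes>\<^bsub>P\<^esub> y" for x y by (simp add: G)
  have invG: "inv\<^bsub>G\<^esub> x = inv\<^bsub>P\<^esub> x" if "x \<in> C" for x
    unfolding G by (rule P.m_inv_consistent[OF C that])
  have carA: "carrier (AutoGroup G) = auto G" by (simp add: AutoGroup_def)
  have multA: "f \<otimes>\<^bsub>AutoGroup G\<^esub> h = compose (carrier G) f h" if "f \<in> auto G" "h \<in> auto G" for f h
    using that by (simp add: AutoGroup_def BijGroup_def auto_def)
  have oneA: "\<one>\<^bsub>AutoGroup G\<^esub> = (\<lambda>x\<in>C. x)" by (simp add: AutoGroup_def BijGroup_def carG)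
  have aut: "?\<psi> s \<in> auto G" if s: "s \<in> ?N" for s
  proof -
    have sc: "s \<in> carrier P" and s1: "\<And>x. x \<in> C \<Longrightarrow> s \<otimes>\<^bsub>P\<^esub> x \<otimes>\<^bsub>P\<^esub> inv\<^bsub>P\<^esub> s \<in> C"
      and s2: "\<And>x. x \<in> C \<Longrightarrow> inv\<^bsub>P\<^esub> s \<otimes>\<^bsub>P\<^esub> x \<otimes>\<^bsub>P\<^esub> s \<in> C" using s by (auto simp: conj_stabilizer_def)
    have "?\<psi> s \<in> hom G G"
      using s1 sc by (auto simp: hom_def carG multG conj_aut_def P.m_assoc P.mult_inv_cancel_left)
    moreover have "bij_betw (?\<psi> s) C C"
      by (rule bij_betw_byWitness[where f' = "\<lambda>x. inv\<^bsub>P\<^esub> s \<otimes>\<^bsub>P\<^esub> x \<otimes>\<^bsub>P\<^esub> s"])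
         (use sc s1 s2 in \<open>auto simp: conj_aut_def P.m_assoc P.mult_inv_cancel_left\<close>)
    ultimately show ?thesis by (simp add: auto_def Bij_def carG conj_aut_def)
  qed
  have pmult: "?\<psi> s \<otimes>\<^bsub>AutoGroup G\<^esub> ?\<psi> r = ?\<psi> (s \<otimes>\<^bsub>P\<^esub> r)" if "s \<in> ?N" "r \<in> ?N" for s r
    using that NP[of s] NP[of r]
    by (auto simp: multA aut compose_def fun_eq_iff carG)
       (auto simp: conj_stabilizer_def conj_aut_def P.m_assoc P.inv_mult_group)
  have inn: "inner_auts G = ?\<psi> ` C"
    unfolding inner_auts_def carG multG conj_aut_def
    by (intro image_cong refl ext) (auto simp: invG multG)
  \<comment> \<open>If \<open>s \<otimes> s\<close> lies in \<open>C\<close> and acts trivially on \<open>C\<close>, it is central in \<open>C\<close>.\<close>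
  have key: "s \<otimes>\<^bsub>P\<^esub> s = \<one>\<^bsub>P\<^esub>" if s: "s \<otimes>\<^bsub>P\<^esub> s \<in> C" and triv: "?\<psi> (s \<otimes>\<^bsub>P\<^esub> s) = \<one>\<^bsub>AutoGroup G\<^esub>" for s
  proof -
    have "(s \<otimes>\<^bsub>P\<^esub> s) \<otimes>\<^bsub>P\<^esub> x = x \<otimes>\<^bsub>P\<^esub> (s \<otimes>\<^bsub>P\<^esub> s)" if x: "x \<in> C" for x
    proof -
      have "(s \<otimes>\<^bsub>P\<^esub> s) \<otimes>\<^bsub>P\<^esub> x \<otimes>\<^bsub>P\<^esub> inv\<^bsub>P\<^esub> (s \<otimes>\<^bsub>P\<^esub> s) = x"
        using fun_cong[OF triv, of x] x by (simp add: oneA conj_aut_def)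
      then show ?thesis using s x
        by (metis C.mem_carrier P.inv_solve_right' P.m_closed)
    qed
    then have "s \<otimes>\<^bsub>P\<^esub> s \<in> group_center G" using s by (simp add: group_center_def carG multG)
    then show ?thesis using centre by (simp add: G)
  qed
  have sq: "(t \<otimes>\<^bsub>P\<^esub> g) \<otimes>\<^bsub>P\<^esub> (t \<otimes>\<^bsub>P\<^esub> g) \<in> C" if g: "g \<in> C" for g
  proof -
    have "(t \<otimes>\<^bsub>P\<^esub> g) \<otimes>\<^bsub>P\<^esub> (t \<otimes>\<^bsub>P\<^esub> g) = (t \<otimes>\<^bsub>P\<^esub> g \<otimes>\<^bsub>P\<^esub> inv\<^bsub>P\<^esub> t) \<otimes>\<^bsub>P\<^esub> ((t \<otimes>\<^bsub>P\<^esub> t) \<otimes>\<^bsub>P\<^esub> g)"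
      using g NP[OF t] by (simp add: P.m_assoc P.mult_inv_cancel_left)
    also have "\<dots> \<in> C" using t tt g by (auto simp: conj_stabilizer_def)
    finally show ?thesis .
  qed
  have stabtg: "t \<otimes>\<^bsub>P\<^esub> g \<in> ?N" if "g \<in> C" for g using stab_mult[OF t stabC[OF that]] .
  have stabinv: "?\<psi> (t \<otimes>\<^bsub>P\<^esub> inv\<^bsub>P\<^esub> a) \<otimes>\<^bsub>AutoGroup G\<^esub> ?\<psi> a = ?\<psi> t" if "a \<in> C" for a
    using that NP[OF t] by (simp add: pmult stabtg stabC P.m_assoc)
  from hyp show ?thesis
  proof
    assume no: "\<nexists>x. is_involution (outer_aut_group G) x"
    (* The class of conjugation by t has square one, and it is not an involution. So it is trivial:
       conjugation by t agrees with conjugation by some a in C, and s = t a^-1 centralises C. *)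
    interpret O: group "outer_aut_group G"
      unfolding outer_aut_group_def by (rule N.factorgroup_is_group)
    let ?x = "inner_auts G #>\<^bsub>AutoGroup G\<^esub> ?\<psi> t"
    have pt: "?\<psi> t \<in> carrier (AutoGroup G)" using aut[OF t] by (simp add: carA)
    have x: "?x \<in> carrier (outer_aut_group G)"
      using pt by (auto simp: outer_aut_group_def FactGroup_def A.rcosetsI N.subset)
    have tt': "?\<psi> t \<otimes>\<^bsub>AutoGroup G\<^esub> ?\<psi> t \<in> inner_auts G"
      using tt by (auto simp: pmult[OF t t] inn)
    have "?x \<otimes>\<^bsub>outer_aut_group G\<^esub> ?x = \<one>\<^bsub>outer_aut_group G\<^esub>"
      using N.rcos_sum[OF pt pt] A.coset_join2[OF _ N.is_subgroup tt'] A.m_closed[OF pt pt]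
      by (simp add: outer_aut_group_def FactGroup_def)
    then have "?x [^]\<^bsub>outer_aut_group G\<^esub> (2::nat) = \<one>\<^bsub>outer_aut_group G\<^esub>"
      using x by (simp add: numeral_2_eq_2)
    then have "O.ord ?x dvd 2" using O.pow_eq_id[OF x] by simp
    moreover have "O.ord ?x \<noteq> 2" using no x unfolding is_involution_def by blast
    ultimately have "O.ord ?x = 1"
      using two_is_prime_nat prime_nat_iff by blast
    then have "?x = inner_auts G"
      using O.ord_eq_1[OF x] by (simp add: outer_aut_group_def FactGroup_def)
    then have "?\<psi> t \<in> inner_auts G" using A.coset_join1[OF _ pt N.is_subgroup] N.subset by blast
    then obtain a where a: "a \<in> C" "?\<psi> t = ?\<psi> a" using inn by blast
    let ?s = "t \<otimes>\<^bsub>P\<^esub> inv\<^bsub>P\<^esub> a"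
    have ia: "inv\<^bsub>P\<^esub> a \<in> C" using a by simp
    have c1: "?\<psi> ?s \<in> carrier (AutoGroup G)" "?\<psi> a \<in> carrier (AutoGroup G)"
      using aut[OF stabtg[OF ia]] aut[OF stabC[OF a(1)]] by (auto simp: carA)
    have one: "?\<psi> ?s = \<one>\<^bsub>AutoGroup G\<^esub>"
      using stabinv[OF a(1)] a(2) c1 A.r_cancel_one by simp
    have "?\<psi> (?s \<otimes>\<^bsub>P\<^esub> ?s) = \<one>\<^bsub>AutoGroup G\<^esub>"
      using pmult[OF stabtg[OF ia] stabtg[OF ia]] one by simp
    then show ?thesis using key[OF sq[OF ia]] ia by blast
  next
    (* The factor h in H of conjugation by t is conjugation by s = t a^-1 for some a in C. Its square
       lies in H and is inner. *)
    assume "\<exists>H. group_complement (AutoGroup G) (inner_auts G) H"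
    then obtain H where H: "subgroup H (AutoGroup G)"
      and HN: "carrier (AutoGroup G) = H <#>\<^bsub>AutoGroup G\<^esub> inner_auts G"
      and Hi: "H \<inter> inner_auts G = {\<one>\<^bsub>AutoGroup G\<^esub>}" by (auto simp: group_complement_def)
    have "?\<psi> t \<in> H <#>\<^bsub>AutoGroup G\<^esub> inner_auts G" using aut[OF t] HN carA by simp
    then obtain h a where h: "h \<in> H" and a: "a \<in> C" and ht: "?\<psi> t = h \<otimes>\<^bsub>AutoGroup G\<^esub> ?\<psi> a"
      unfolding set_mult_def inn by blast
    let ?s = "t \<otimes>\<^bsub>P\<^esub> inv\<^bsub>P\<^esub> a"
    have ia: "inv\<^bsub>P\<^esub> a \<in> C" using a by simp
    have c1: "?\<psi> ?s \<in> carrier (AutoGroup G)" "?\<psi> a \<in> carrier (AutoGroup G)" "h \<in> carrier (AutoGroup G)"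
      using aut[OF stabtg[OF ia]] aut[OF stabC[OF a(1)]] subgroup.mem_carrier[OF H h] by (auto simp: carA)
    have hs: "h = ?\<psi> ?s" using stabinv[OF a] ht c1 by simp
    have "?\<psi> (?s \<otimes>\<^bsub>P\<^esub> ?s) \<in> H"
      using pmult[OF stabtg[OF ia] stabtg[OF ia]] hs h subgroup.m_closed[OF H] by metis
    moreover have "?\<psi> (?s \<otimes>\<^bsub>P\<^esub> ?s) \<in> inner_auts G" using sq[OF ia] inn by blast
    ultimately have "?\<psi> (?s \<otimes>\<^bsub>P\<^esub> ?s) = \<one>\<^bsub>AutoGroup G\<^esub>" using Hi by blast
    then show ?thesis using key[OF sq[OF ia]] ia by blast
  qed
qed

section \<open>Homogeneous forms and projective points\<close>

definition monom_value :: "(nat \<Rightarrow>\<^sub>0 nat) \<Rightarrow> (nat \<Rightarrow> complex) \<Rightarrow> complex" where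
  "monom_value m v = (\<Prod>i \<in> Poly_Mapping.keys m. v i ^ Poly_Mapping.lookup m i)"

lemma poly_value_monom_value:
  "poly_value p v = (\<Sum>m \<in> Poly_Mapping.keys p. Poly_Mapping.lookup p m * monom_value m v)"
  by (simp add: poly_value_def monom_value_def)

lemma monom_value_superset:
  assumes "finite I" "Poly_Mapping.keys m \<subseteq> I"
  shows "monom_value m v = (\<Prod>i\<in>I. v i ^ Poly_Mapping.lookup m i)"
  unfolding monom_value_def
  by (rule prod.mono_neutral_left) (use assms in \<open>auto simp: in_keys_iff\<close>)

lemma monom_value_add: "monom_value (m + m') v = monom_value m v * monom_value m' v"
proof -
  let ?I = "Poly_Mapping.keys m \<union> Poly_Mapping.keys m'"
  have "monom_value (m + m') v = (\<Prod>i\<in>?I. v i ^ Poly_Mapping.lookup (m + m') i)"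
    by (rule monom_value_superset) (use Poly_Mapping.keys_add[of m m'] in auto)
  also have "\<dots> = (\<Prod>i\<in>?I. v i ^ Poly_Mapping.lookup m i) * (\<Prod>i\<in>?I. v i ^ Poly_Mapping.lookup m' i)"
    by (simp add: lookup_add power_add prod.distrib)
  also have "\<dots> = monom_value m v * monom_value m' v"
    by (simp add: monom_value_superset[of ?I])
  finally show ?thesis .
qed

lemma monom_value_scale:
  "monom_value m (\<lambda>i. c * v i) = c ^ (\<Sum>i\<in>Poly_Mapping.keys m. Poly_Mapping.lookup m i) * monom_value m v"
  by (simp add: monom_value_def power_mult_distrib prod.distrib power_sum)

lemma poly_value_superset:
  assumes "finite M" "Poly_Mapping.keys p \<subseteq> M"
  shows "poly_value p v = (\<Sum>m\<in>M. Poly_Mapping.lookup p m * monom_value m v)"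
  unfolding poly_value_monom_value
  by (rule sum.mono_neutral_left) (use assms in \<open>auto simp: in_keys_iff\<close>)

lemma poly_value_zero [simp]: "poly_value 0 v = 0"
  by (simp add: poly_value_def)

lemma poly_value_add: "poly_value (p + q) v = poly_value p v + poly_value q v"
proof -
  let ?M = "Poly_Mapping.keys p \<union> Poly_Mapping.keys q"
  have "poly_value (p + q) v = (\<Sum>m\<in>?M. Poly_Mapping.lookup (p + q) m * monom_value m v)"
    by (rule poly_value_superset) (use Poly_Mapping.keys_add[of p q] in auto)
  then show ?thesis
    by (simp add: lookup_add distrib_right sum.distrib poly_value_superset[of ?M])
qed

lemma poly_value_sum: "poly_value (\<Sum>a\<in>B. f a) v = (\<Sum>a\<in>B. poly_value (f a) v)"
  by (induction B rule: infinite_finite_induct) (simp_all add: poly_value_add)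

lemma poly_value_single [simp]: "poly_value (Poly_Mapping.single m c) v = c * monom_value m v"
  by (cases "c = 0") (simp_all add: poly_value_monom_value)

lemma poly_mapping_eq_sum_single:
  fixes p :: "'a \<Rightarrow>\<^sub>0 'b::comm_monoid_add"
  shows "p = (\<Sum>m\<in>Poly_Mapping.keys p. Poly_Mapping.single m (Poly_Mapping.lookup p m))"
proof (rule poly_mapping_eqI)
  fix k
  have "Poly_Mapping.lookup (\<Sum>m\<in>Poly_Mapping.keys p. Poly_Mapping.single m (Poly_Mapping.lookup p m)) k
      = (\<Sum>m\<in>Poly_Mapping.keys p. if m = k then Poly_Mapping.lookup p m else 0)"
    by (simp add: lookup_sum lookup_single when_def)
  also have "\<dots> = Poly_Mapping.lookup p k"
    by (simp add: sum.delta in_keys_iff)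
  finally show "Poly_Mapping.lookup p k = Poly_Mapping.lookup (\<Sum>m\<in>Poly_Mapping.keys p. Poly_Mapping.single m (Poly_Mapping.lookup p m)) k" ..
qed

text \<open>Multiplicativity holds on monomials, and every polynomial is the sum of its terms.\<close>

lemma poly_value_mult: "poly_value (p * q) v = poly_value p v * poly_value q v"
proof -
  have "p * q = (\<Sum>m\<in>Poly_Mapping.keys p. \<Sum>m'\<in>Poly_Mapping.keys q.
      Poly_Mapping.single (m + m') (Poly_Mapping.lookup p m * Poly_Mapping.lookup q m'))"
    by (subst poly_mapping_eq_sum_single[of p], subst poly_mapping_eq_sum_single[of q])
       (simp add: sum_product mult_single)
  then have "poly_value (p * q) v = (\<Sum>m\<in>Poly_Mapping.keys p. \<Sum>m'\<in>Poly_Mapping.keys q.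
      (Poly_Mapping.lookup p m * Poly_Mapping.lookup q m') * monom_value (m + m') v)"
    by (simp only: poly_value_sum poly_value_single)
  then show ?thesis
    by (simp add: monom_value_add poly_value_monom_value[of p] poly_value_monom_value[of q] sum_product mult_ac)
qed

definition homogeneous_of_degree :: "nat \<Rightarrow> nat \<Rightarrow> cpoly \<Rightarrow> bool" where
  "homogeneous_of_degree n d p \<longleftrightarrow> (\<forall>m \<in> Poly_Mapping.keys p. Poly_Mapping.keys m \<subseteq> {..n} \<and>
        (\<Sum>i \<in> Poly_Mapping.keys m. Poly_Mapping.lookup m i) = d)"

text \<open>Forms are polynomial functions rather than polynomials, so that they can be written as ordinary
  expressions in the coordinates.\<close>

definition forms :: "nat \<Rightarrow> nat \<Rightarrow> ((nat \<Rightarrow> complex) \<Rightarrow> complex) set" where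
  "forms n d = poly_value ` {p. homogeneous_of_degree n d p}"

lemma homogeneous_polys_degree: "p \<in> homogeneous_polys n \<longleftrightarrow> (\<exists>d. homogeneous_of_degree n d p)"
  by (simp add: homogeneous_polys_def homogeneous_of_degree_def)

lemma forms_scale_arg: "f \<in> forms n d \<Longrightarrow> f (\<lambda>i. c * v i) = c ^ d * f v"
  by (auto simp: forms_def homogeneous_of_degree_def poly_value_monom_value monom_value_scale sum_distrib_left
      intro!: sum.cong)

lemma forms_const: "(\<lambda>v. c) \<in> forms n 0"
  unfolding forms_def
  by (rule image_eqI[of _ _ "Poly_Mapping.single 0 c"])
     (auto simp: homogeneous_of_degree_def monom_value_def split: if_splits)

lemma forms_coord: "i \<le> n \<Longrightarrow> (\<lambda>v. v i) \<in> forms n 1"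
  unfolding forms_def
  by (rule image_eqI[of _ _ "Poly_Mapping.single (Poly_Mapping.single i 1) 1"])
     (auto simp: homogeneous_of_degree_def monom_value_def split: if_splits)

lemma forms_add:
  assumes "f \<in> forms n d" "g \<in> forms n d"
  shows "(\<lambda>v. f v + g v) \<in> forms n d"
proof -
  obtain p q where p: "f = poly_value p" "homogeneous_of_degree n d p"
    and q: "g = poly_value q" "homogeneous_of_degree n d q" using assms by (auto simp: forms_def)
  have "homogeneous_of_degree n d (p + q)"
    using p q Poly_Mapping.keys_add[of p q] unfolding homogeneous_of_degree_def by blast
  then show ?thesis
    unfolding forms_def by (auto simp: p q poly_value_add fun_eq_iff intro!: image_eqI[of _ _ "p + q"])
qed

lemma sum_lookup_superset:
  assumes "finite I" "Poly_Mapping.keys m \<subseteq> I"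
  shows "(\<Sum>i\<in>Poly_Mapping.keys m. Poly_Mapping.lookup m i) = (\<Sum>i\<in>I. Poly_Mapping.lookup m i)"
  by (rule sum.mono_neutral_left) (use assms in \<open>auto simp: in_keys_iff\<close>)

lemma forms_mult:
  assumes "f \<in> forms n d" "g \<in> forms n e"
  shows "(\<lambda>v. f v * g v) \<in> forms n (d + e)"
proof -
  obtain p q where p: "f = poly_value p" "homogeneous_of_degree n d p"
    and q: "g = poly_value q" "homogeneous_of_degree n e q" using assms by (auto simp: forms_def)
  have "Poly_Mapping.keys m \<subseteq> {..n} \<and> (\<Sum>i\<in>Poly_Mapping.keys m. Poly_Mapping.lookup m i) = d + e"
    if "m \<in> Poly_Mapping.keys (p * q)" for m
  proof -
    obtain a b where m: "m = a + b" and ab: "a \<in> Poly_Mapping.keys p" "b \<in> Poly_Mapping.keys q"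
      using \<open>m \<in> Poly_Mapping.keys (p * q)\<close> keys_mult[of p q] by blast
    have s: "Poly_Mapping.keys a \<subseteq> {..n}" "Poly_Mapping.keys b \<subseteq> {..n}"
      and e: "(\<Sum>i\<in>Poly_Mapping.keys a. Poly_Mapping.lookup a i) = d"
        "(\<Sum>i\<in>Poly_Mapping.keys b. Poly_Mapping.lookup b i) = e"
      using ab p q unfolding homogeneous_of_degree_def by auto
    have "Poly_Mapping.keys m \<subseteq> {..n}"
      using s Poly_Mapping.keys_add[of a b] unfolding m by blast
    moreover have "(\<Sum>i\<in>Poly_Mapping.keys m. Poly_Mapping.lookup m i) = (\<Sum>i\<le>n. Poly_Mapping.lookup (a + b) i)"
      unfolding m by (rule sum_lookup_superset) (use calculation m in auto)
    ultimately show ?thesis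
      using e sum_lookup_superset[OF finite_atMost s(1)] sum_lookup_superset[OF finite_atMost s(2)]
      by (simp add: lookup_add sum.distrib)
  qed
  then have "homogeneous_of_degree n (d + e) (p * q)"
    unfolding homogeneous_of_degree_def by blast
  then show ?thesis
    unfolding forms_def by (auto simp: p q poly_value_mult fun_eq_iff intro!: image_eqI[of _ _ "p * q"])
qed

lemma forms_cmult: "f \<in> forms n d \<Longrightarrow> (\<lambda>v. c * f v) \<in> forms n d"
  using forms_mult[OF forms_const] by force

lemma forms_zero: "(\<lambda>v. 0) \<in> forms n d"
  unfolding forms_def by (rule image_eqI[of _ _ 0]) (auto simp: homogeneous_of_degree_def fun_eq_iff)

lemma forms_sum: "(\<And>a. a \<in> B \<Longrightarrow> f a \<in> forms n d) \<Longrightarrow> (\<lambda>v. \<Sum>a\<in>B. f a v) \<in> forms n d"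
  by (induction B rule: infinite_finite_induct) (simp_all add: forms_zero forms_add)

lemma forms_power: "f \<in> forms n d \<Longrightarrow> (\<lambda>v. f v ^ k) \<in> forms n (k * d)"
  by (induction k) (simp_all add: forms_const forms_mult)

lemma poly_value_conj_poly: "poly_value (conj_poly p) (\<lambda>i. cnj (v i)) = cnj (poly_value p v)"
proof -
  have k: "Poly_Mapping.keys (conj_poly p) = Poly_Mapping.keys p"
    by (auto simp: conj_poly_def in_keys_iff Poly_Mapping.map.rep_eq when_def)
  have l: "Poly_Mapping.lookup (conj_poly p) m = cnj (Poly_Mapping.lookup p m)" for m
    by (simp add: conj_poly_def Poly_Mapping.map.rep_eq when_def)
  show ?thesis unfolding poly_value_def k l by simp
qed

lemma poly_value_cnj_of_real_poly:
  assumes "real_poly p"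
  shows "poly_value p (\<lambda>i. cnj (v i)) = cnj (poly_value p v)"
proof -
  have "cnj (Poly_Mapping.lookup p m) = Poly_Mapping.lookup p m" for m
    using assms by (simp add: real_poly_def Reals_cnj_iff)
  then show ?thesis unfolding poly_value_def by simp
qed

text \<open>The coefficientwise real and imaginary parts have no monomials beyond those of \<open>p\<close> and are
  therefore homogeneous of the same degree.\<close>

lemma homogeneous_poly_real_decomposition:
  assumes p: "homogeneous_of_degree n d p"
  obtains q r where "homogeneous_of_degree n d q" "homogeneous_of_degree n d r" "real_poly q" "real_poly r"
    "\<And>v. poly_value p v = poly_value q v + \<i> * poly_value r v"
proof -
  define q where "q = Poly_Mapping.map (\<lambda>c. of_real (Re c) :: complex) p"
  define r where "r = Poly_Mapping.map (\<lambda>c. of_real (Im c) :: complex) p"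
  have lq: "Poly_Mapping.lookup q m = of_real (Re (Poly_Mapping.lookup p m))" for m
    by (simp add: q_def Poly_Mapping.map.rep_eq when_def)
  have lr: "Poly_Mapping.lookup r m = of_real (Im (Poly_Mapping.lookup p m))" for m
    by (simp add: r_def Poly_Mapping.map.rep_eq when_def)
  have kq: "Poly_Mapping.keys q \<subseteq> Poly_Mapping.keys p" by (auto simp: in_keys_iff lq)
  have kr: "Poly_Mapping.keys r \<subseteq> Poly_Mapping.keys p" by (auto simp: in_keys_iff lr)
  show ?thesis
  proof
    show "homogeneous_of_degree n d q" "homogeneous_of_degree n d r"
      using p kq kr unfolding homogeneous_of_degree_def by blast+
    show "real_poly q" "real_poly r" by (simp_all add: real_poly_def lq lr)
    show "poly_value p v = poly_value q v + \<i> * poly_value r v" for v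
      unfolding poly_value_superset[OF finite_keys kq] poly_value_superset[OF finite_keys kr]
        poly_value_monom_value[of p] sum_distrib_left sum.distrib[symmetric]
    proof (rule sum.cong[OF refl])
      fix m
      have "Poly_Mapping.lookup p m = Poly_Mapping.lookup q m + \<i> * Poly_Mapping.lookup r m"
        unfolding lq lr by (rule complex_eq)
      then show "Poly_Mapping.lookup p m * monom_value m v =
         Poly_Mapping.lookup q m * monom_value m v + \<i> * (Poly_Mapping.lookup r m * monom_value m v)"
        by (simp add: distrib_right)
    qed
  qed
qed

lemma proj_point_refl [simp]: "v \<in> proj_point v"
  unfolding proj_point_def by (auto intro!: exI[of _ 1])

lemma proj_point_eqI: "w \<in> proj_point v \<Longrightarrow> proj_point w = proj_point v"
proof -
  assume "w \<in> proj_point v"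
  then obtain c where c: "c \<noteq> 0" "w = (\<lambda>i. c * v i)" by (auto simp: proj_point_def)
  have "(\<lambda>i. a * v i) \<in> proj_point w" if "a \<noteq> 0" for a
    unfolding proj_point_def using that c by (auto intro!: exI[of _ "a / c"])
  moreover have "(\<lambda>i. a * w i) \<in> proj_point v" if "a \<noteq> 0" for a
    unfolding proj_point_def using that c by (auto intro!: exI[of _ "a * c"])
  ultimately show ?thesis by (auto simp: proj_point_def)
qed

lemma hom_coords_proj_point: "v \<in> hom_coords n \<Longrightarrow> w \<in> proj_point v \<Longrightarrow> w \<in> hom_coords n"
  by (auto simp: proj_point_def hom_coords_def)

lemma proj_space_rep:
  assumes "P \<in> proj_space n" "v \<in> P"
  shows "v \<in> hom_coords n" "P = proj_point v"
  using assms hom_coords_proj_point proj_point_eqI by (auto simp: proj_space_def)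

lemma proj_point_in_proj_space: "v \<in> hom_coords n \<Longrightarrow> proj_point v \<in> proj_space n"
  by (simp add: proj_space_def)

lemma proj_point_in_affine_part:
  assumes "v \<in> hom_coords n"
  shows "proj_point v \<in> affine_part n i \<longleftrightarrow> v i \<noteq> 0"
  using proj_point_in_proj_space[OF assms] by (auto simp: affine_part_def) (auto simp: proj_point_def)

text \<open>Equality of projective points becomes the vanishing of polynomials in the coordinates, which is
  accessible to continuity arguments.\<close>

lemma proj_point_eq_iff:
  assumes v: "v \<in> hom_coords n" and w: "w \<in> hom_coords n"
  shows "proj_point v = proj_point w \<longleftrightarrow> (\<forall>i\<le>n. \<forall>j\<le>n. v i * w j = v j * w i)"
proof
  assume "proj_point v = proj_point w"
  then have "v \<in> proj_point w" using proj_point_refl by blast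
  then show "\<forall>i\<le>n. \<forall>j\<le>n. v i * w j = v j * w i" by (auto simp: proj_point_def)
next
  assume minors: "\<forall>i\<le>n. \<forall>j\<le>n. v i * w j = v j * w i"
  obtain i where i: "w i \<noteq> 0" using w by (auto simp: hom_coords_def)
  have i': "i \<le> n" by (rule ccontr) (use w i in \<open>auto simp: hom_coords_def\<close>)
  have eq: "v j = (v i / w i) * w j" for j
  proof (cases "j \<le> n")
    case True then show ?thesis using minors i i' by (auto simp: field_simps)
  next
    case False then show ?thesis using v w by (auto simp: hom_coords_def)
  qed
  have "v i \<noteq> 0"
  proof
    assume "v i = 0"
    then have "v j = 0" for j using eq[of j] by simp
    then show False using v by (auto simp: hom_coords_def)
  qed
  then have "v \<in> proj_point w"
    unfolding proj_point_def using i
    by (intro CollectI exI[of _ "v i / w i"] conjI ext) (rule eq, simp)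
  then show "proj_point v = proj_point w" by (rule proj_point_eqI)
qed

definition conj_point :: "(nat \<Rightarrow> complex) set \<Rightarrow> (nat \<Rightarrow> complex) set" where
  "conj_point P = (\<lambda>v i. cnj (v i)) ` P"

lemma conj_point_proj_point: "conj_point (proj_point v) = proj_point (\<lambda>i. cnj (v i))"
proof -
  have "(\<lambda>i. c * cnj (v i)) \<in> conj_point (proj_point v)" if "c \<noteq> 0" for c
    unfolding conj_point_def proj_point_def
    by (rule image_eqI[of _ _ "\<lambda>i. cnj c * v i"]) (use that in auto)
  moreover have "(\<lambda>i. cnj (c * v i)) \<in> proj_point (\<lambda>i. cnj (v i))" if "c \<noteq> 0" for c
    unfolding proj_point_def using that by (auto intro!: exI[of _ "cnj c"])
  ultimately show ?thesis by (auto simp: conj_point_def proj_point_def)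
qed

lemma conj_point_conj_point [simp]: "conj_point (conj_point P) = P"
  by (simp add: conj_point_def image_image)

lemma hom_coords_cnj: "v \<in> hom_coords n \<Longrightarrow> (\<lambda>i. cnj (v i)) \<in> hom_coords n"
  by (simp add: hom_coords_def)

lemma conj_point_in_proj_space: "P \<in> proj_space n \<Longrightarrow> conj_point P \<in> proj_space n"
  by (auto simp: proj_space_def conj_point_proj_point hom_coords_cnj)

lemma zero_locus_conj_poly: "zero_locus n (conj_poly ` S) = conj_point ` zero_locus n S"
proof -
  have "conj_point P \<in> zero_locus n (conj_poly ` S) \<longleftrightarrow> P \<in> zero_locus n S" if "P \<in> proj_space n" for P
    using that conj_point_in_proj_space[OF that]
    by (simp add: zero_locus_def conj_point_def poly_value_conj_poly)
  then have *: "P \<in> zero_locus n (conj_poly ` S) \<longleftrightarrow> conj_point P \<in> zero_locus n S" if "P \<in> proj_space n" for P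
    using conj_point_in_proj_space[OF that] that by (metis conj_point_conj_point)
  have sub: "zero_locus n S' \<subseteq> proj_space n" for S' by (auto simp: zero_locus_def)
  show ?thesis
  proof (intro equalityI subsetI)
    fix P assume "P \<in> zero_locus n (conj_poly ` S)"
    then have "conj_point P \<in> zero_locus n S" using * sub by blast
    then show "P \<in> conj_point ` zero_locus n S" by (metis conj_point_conj_point image_eqI)
  next
    fix P assume "P \<in> conj_point ` zero_locus n S"
    then obtain Q where Q: "Q \<in> zero_locus n S" "P = conj_point Q" by blast
    then have "P \<in> proj_space n" using sub conj_point_in_proj_space by blast
    then show "P \<in> zero_locus n (conj_poly ` S)" using * Q by simp
  qed
qed

section \<open>Entire functions of polynomial growth and coefficients of norms\<close>

text \<open>Riemann's removable singularity theorem, one point at a time.\<close>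

lemma holomorphic_extend_finite_bounded:
  fixes f :: "complex \<Rightarrow> complex"
  assumes "finite B" "f holomorphic_on - B"
    and "\<And>b. b \<in> B \<Longrightarrow> \<exists>K. eventually (\<lambda>z. norm (f z) \<le> K) (at b)"
  shows "\<exists>g. g holomorphic_on UNIV \<and> (\<forall>z. z \<notin> B \<longrightarrow> g z = f z)"
  using assms
proof (induction B arbitrary: f rule: finite_induct)
  case empty
  then show ?case by auto
next
  case (insert b B)
  have op: "open (- B)" using insert.hyps by (simp add: finite_imp_closed open_Compl)
  have "- insert b B = - B - {b}" by blast
  then have "f holomorphic_on (- B - {b})" using insert.prems(1) by (simp only:)
  moreover have "b \<in> interior (- B)" using insert.hyps op by (simp add: interior_open)
  moreover have "\<exists>K. eventually (\<lambda>z. norm (f z) \<le> K) (at b)" using insert.prems(2) by simp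
  ultimately obtain g where g: "g holomorphic_on - B" "\<forall>z\<in>- B - {b}. g z = f z"
    using holomorphic_on_extend_bounded[of f "- B" b] by blast
  have "\<exists>K. eventually (\<lambda>z. norm (g z) \<le> K) (at c)" if c: "c \<in> B" for c
  proof -
    obtain K where K: "eventually (\<lambda>z. norm (f z) \<le> K) (at c)" using insert.prems(2) c by auto
    have "open (- (insert b B - {c}))"
      by (intro open_Compl finite_imp_closed finite_Diff finite.insertI insert.hyps)
    then have "eventually (\<lambda>z. z \<in> - (insert b B - {c}) - {c}) (at c)"
      by (rule eventually_at_in_open) simp
    then have "eventually (\<lambda>z. norm (g z) \<le> K) (at c)"
      using K by eventually_elim (use g in auto)
    then show ?thesis by blast
  qed
  from insert.IH[OF g(1) this] obtain h where "h holomorphic_on UNIV" "\<forall>z. z \<notin> B \<longrightarrow> h z = g z" by blast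
  then show ?case using g(2) by (intro exI[of _ h]) auto
qed

text \<open>The growth bound is locally bounded, so the exceptional points are removable, and Liouville's
  theorem for functions of polynomial growth applies to the extension.\<close>

lemma holomorphic_poly_growth:
  fixes f :: "complex \<Rightarrow> complex"
  assumes B: "finite B" and f: "f holomorphic_on - B"
    and gr: "\<And>z. z \<notin> B \<Longrightarrow> norm (f z) \<le> C * (1 + norm z) ^ d"
  obtains a where "\<And>z. z \<notin> B \<Longrightarrow> f z = (\<Sum>j\<le>d. a j * z ^ j)"
proof -
  have "\<exists>K. eventually (\<lambda>z. norm (f z) \<le> K) (at b)" if "b \<in> B" for b
  proof -
    have "((\<lambda>z. C * (1 + norm z) ^ d) \<longlongrightarrow> C * (1 + norm b) ^ d) (at b)" by (intro tendsto_intros)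
    then have "eventually (\<lambda>z. C * (1 + norm z) ^ d < C * (1 + norm b) ^ d + 1) (at b)"
      by (rule order_tendstoD) simp
    moreover have "eventually (\<lambda>z. z \<in> - (B - {b}) - {b}) (at b)"
      by (rule eventually_at_in_open) (intro open_Compl finite_imp_closed finite_Diff B, simp)
    ultimately have "eventually (\<lambda>z. norm (f z) \<le> C * (1 + norm b) ^ d + 1) (at b)"
    proof eventually_elim
      case (elim z)
      then have "z \<notin> B" by auto
      from gr[OF this] elim show ?case by linarith
    qed
    then show ?thesis by blast
  qed
  from holomorphic_extend_finite_bounded[OF B f this]
  obtain g where g: "g holomorphic_on UNIV" "\<And>z. z \<notin> B \<Longrightarrow> g z = f z" by blast
  obtain R where R: "\<And>b. b \<in> B \<Longrightarrow> norm b \<le> R"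
    using finite_imp_bounded[OF B] by (auto simp: bounded_iff)
  have C: "0 \<le> C"
  proof -
    obtain z where z: "z \<notin> B" using B ex_new_if_finite infinite_UNIV_char_0 by blast
    have "0 \<le> C * (1 + norm z) ^ d" using gr[OF z] norm_ge_zero order_trans by blast
    moreover have "0 < (1 + norm z) ^ d" by (simp add: add_pos_nonneg)
    ultimately show ?thesis by (simp add: zero_le_mult_iff)
  qed
  (* For norm z >= 1 the factor 1 + norm z is at most 2 * norm z. *)
  have bound: "norm (g z) \<le> (C * 2 ^ d) * norm z ^ d" if z: "max 1 (R + 1) \<le> norm z" for z
  proof -
    have "z \<notin> B" using R[of z] z by auto
    then have "norm (g z) \<le> C * (1 + norm z) ^ d" using gr g(2) by simp
    also have "\<dots> \<le> C * (2 * norm z) ^ d" using z C by (intro mult_left_mono power_mono) auto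
    finally show ?thesis by (simp add: power_mult_distrib)
  qed
  have eq: "g z = (\<Sum>j\<le>d. (deriv^^j) g 0 / fact j * z ^ j)" for z
    by (rule Liouville_polynomial[OF g(1) bound])
  show ?thesis
  proof (rule that)
    fix z assume "z \<notin> B"
    then show "f z = (\<Sum>j\<le>d. (deriv^^j) g 0 / fact j * z ^ j)"
      using g(2)[of z] eq[of z] by simp
  qed
qed

lemma coeff_linear_mult:
  "Polynomial.coeff ([:- a, 1:] * q) k = (case k of 0 \<Rightarrow> 0 | Suc j \<Rightarrow> Polynomial.coeff q j) - a * Polynomial.coeff q k" for a :: complex
  by (simp add: coeff_pCons split: nat.split)

lemma holomorphic_on_coeff_prod_linear:
  assumes "finite I" "\<And>i. i \<in> I \<Longrightarrow> f i holomorphic_on S"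
  shows "(\<lambda>z. Polynomial.coeff (\<Prod>i\<in>I. [:- f i z, 1:]) k) holomorphic_on S"
  using assms
proof (induction I arbitrary: k rule: finite_induct)
  case (insert x F)
  have "(\<lambda>z. (case k of 0 \<Rightarrow> 0 | Suc j \<Rightarrow> Polynomial.coeff (\<Prod>i\<in>F. [:- f i z, 1:]) j) - f x z * Polynomial.coeff (\<Prod>i\<in>F. [:- f i z, 1:]) k)
      holomorphic_on S"
    using insert by (cases k) (auto intro!: holomorphic_intros)
  then show ?case
    unfolding prod.insert[OF insert.hyps] coeff_linear_mult .
qed simp

lemma prod_linear_monic:
  assumes "finite I"
  shows "Polynomial.degree (\<Prod>i\<in>I. [:- f i, 1:] :: complex poly) = card I" "Polynomial.coeff (\<Prod>i\<in>I. [:- f i, 1:] :: complex poly) (card I) = 1"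
proof -
  have "lead_coeff (\<Prod>i\<in>I. [:- f i, 1:] :: complex poly) = 1" by (simp add: lead_coeff_prod)
  moreover show d: "Polynomial.degree (\<Prod>i\<in>I. [:- f i, 1:] :: complex poly) = card I"
    by (subst degree_prod_eq_sum_degree) auto
  ultimately show "Polynomial.coeff (\<Prod>i\<in>I. [:- f i, 1:] :: complex poly) (card I) = 1" by simp
qed

text \<open>Up to sign the coefficient is an elementary symmetric function of degree \<open>card I - k\<close> in the roots.
  The exponent of \<open>b\<close> is what makes the norm homogeneous later on; the constant \<open>2 ^ card I\<close>
  is crude and comes from adding two terms in each step of the induction.\<close>

lemma coeff_prod_linear_bound:
  assumes "finite I" "\<And>i. i \<in> I \<Longrightarrow> norm (f i) \<le> b" "0 \<le> b" "k \<le> card I"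
  shows "norm (Polynomial.coeff (\<Prod>i\<in>I. [:- f i, 1:] :: complex poly) k) \<le> 2 ^ card I * b ^ (card I - k)"
  using assms(1,2,4)
proof (induction I arbitrary: k rule: finite_induct)
  case empty
  then show ?case by simp
next
  case (insert x F)
  let ?q = "\<Prod>i\<in>F. [:- f i, 1:]" and ?n = "card F"
  have IH: "norm (Polynomial.coeff ?q j) \<le> 2 ^ ?n * b ^ (?n - j)" if "j \<le> ?n" for j
    using insert that by simp
  have shift: "norm (case k of 0 \<Rightarrow> 0 | Suc j \<Rightarrow> Polynomial.coeff ?q j) \<le> 2 ^ ?n * b ^ (Suc ?n - k)"
    using IH insert.prems(2) insert.hyps \<open>0 \<le> b\<close> by (cases k) auto
  have scale: "norm (f x * Polynomial.coeff ?q k) \<le> 2 ^ ?n * b ^ (Suc ?n - k)"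
  proof (cases "k \<le> ?n")
    case True
    have "norm (f x * Polynomial.coeff ?q k) \<le> b * (2 ^ ?n * b ^ (?n - k))"
      unfolding norm_mult using IH[OF True] insert.prems(1)[of x] \<open>0 \<le> b\<close> by (intro mult_mono) auto
    also have "\<dots> = 2 ^ ?n * b ^ (Suc ?n - k)" using True by (simp add: Suc_diff_le)
    finally show ?thesis .
  next
    case False
    then have "Polynomial.coeff ?q k = 0" using prod_linear_monic(1)[OF insert.hyps(1), of f] by (intro coeff_eq_0) simp
    then show ?thesis using \<open>0 \<le> b\<close> by simp
  qed
  have "norm (Polynomial.coeff ([:- f x, 1:] * ?q) k) \<le> 2 ^ ?n * b ^ (Suc ?n - k) + 2 ^ ?n * b ^ (Suc ?n - k)"
    unfolding coeff_linear_mult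
    using norm_triangle_ineq4[of "case k of 0 \<Rightarrow> 0 | Suc j \<Rightarrow> Polynomial.coeff ?q j" "f x * Polynomial.coeff ?q k"] shift scale by linarith
  then show ?case
    unfolding prod.insert[OF insert.hyps] card_insert_disjoint[OF insert.hyps] power_Suc by linarith
qed

section \<open>Holomorphic functions on a compact Riemann surface\<close>

lemma field_differentiable_transform_open:
  assumes "open S" "x \<in> S" "\<And>y. y \<in> S \<Longrightarrow> f y = g y" "f field_differentiable (at x)"
  shows "g field_differentiable (at x)"
  using assms unfolding field_differentiable_def
  by (meson has_field_derivative_transform_within_open)

lemma eventually_nhdsinE:
  assumes "eventually P (nhdsin X x)" "x \<in> topspace X"
  obtains W where "openin X W" "x \<in> W" "\<And>y. y \<in> W \<Longrightarrow> P y"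
  using assms unfolding eventually_nhdsin by blast

lemma openin_eventually_nhdsin:
  assumes "\<And>x. x \<in> topspace X \<Longrightarrow> P x \<Longrightarrow> eventually P (nhdsin X x)"
  shows "openin X {x \<in> topspace X. P x}"
proof (subst openin_subopen, clarify)
  fix x assume x: "x \<in> topspace X" "P x"
  obtain W where "openin X W" "x \<in> W" "\<And>y. y \<in> W \<Longrightarrow> P y"
    using eventually_nhdsinE[OF assms[OF x] x(1)] by blast
  then show "\<exists>T. openin X T \<and> x \<in> T \<and> T \<subseteq> {x \<in> topspace X. P x}"
    by (intro exI[of _ W]) (auto dest: openin_subset)
qed

lemma continuous_map_nhdsinI:
  fixes f :: "'a \<Rightarrow> 'b::topological_space"
  assumes "\<And>x. x \<in> topspace X \<Longrightarrow> (f \<longlongrightarrow> f x) (nhdsin X x)"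
  shows "continuous_map X euclidean f"
  unfolding continuous_map_def
proof (intro conjI allI impI)
  fix S :: "'b set" assume "openin euclidean S"
  then show "openin X {x \<in> topspace X. f x \<in> S}"
    by (intro openin_eventually_nhdsin topological_tendstoD[OF assms]) auto
qed auto

text \<open>Complex differentiability at a single point, in all charts around it. On an open set this is
  holomorphy, and sums, products and compositions need no reference to domains.\<close>

definition hol_at :: "'a atlas \<Rightarrow> ('a \<Rightarrow> complex) \<Rightarrow> 'a \<Rightarrow> bool" where
  "hol_at A h x \<longleftrightarrow> (\<forall>(U, z) \<in> A. x \<in> U \<longrightarrow> (h \<circ> inv_into U z) field_differentiable (at (z x)))"

lemma hol_at_const [simp]: "hol_at A (\<lambda>x. c) x"
  by (auto simp: hol_at_def o_def)

lemma hol_at_add: "hol_at A f x \<Longrightarrow> hol_at A g x \<Longrightarrow> hol_at A (\<lambda>x. f x + g x) x"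
  by (auto simp: hol_at_def o_def intro!: field_differentiable_add)

lemma hol_at_diff: "hol_at A f x \<Longrightarrow> hol_at A g x \<Longrightarrow> hol_at A (\<lambda>x. f x - g x) x"
  by (auto simp: hol_at_def o_def intro!: field_differentiable_diff)

lemma hol_at_mult: "hol_at A f x \<Longrightarrow> hol_at A g x \<Longrightarrow> hol_at A (\<lambda>x. f x * g x) x"
  by (auto simp: hol_at_def o_def intro!: field_differentiable_mult)

lemma hol_at_sum: "(\<And>i. i \<in> I \<Longrightarrow> hol_at A (f i) x) \<Longrightarrow> hol_at A (\<lambda>x. \<Sum>i\<in>I. f i x) x"
  by (induction I rule: infinite_finite_induct) (simp_all add: hol_at_add)

lemma hol_at_prod: "(\<And>i. i \<in> I \<Longrightarrow> hol_at A (f i) x) \<Longrightarrow> hol_at A (\<lambda>x. \<Prod>i\<in>I. f i x) x"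
  by (induction I rule: infinite_finite_induct) (simp_all add: hol_at_mult)

lemma hol_at_power: "hol_at A f x \<Longrightarrow> hol_at A (\<lambda>x. f x ^ k) x"
  by (induction k) (simp_all add: hol_at_mult)

lemmas hol_at_intros = hol_at_const hol_at_add hol_at_diff hol_at_mult hol_at_sum hol_at_prod hol_at_power

locale riemann_surface =
  fixes X :: "'a topology" and A :: "'a atlas"
  assumes compact_riemann_surface: "compact_riemann_surface X A"
begin

lemma compact_X: "compact_space X" and connected_X: "connected_space X" and Hausdorff_X: "Hausdorff_space X"
  and nonempty_X: "topspace X \<noteq> {}" and charts_cover: "(\<Union>(U, z) \<in> A. U) = topspace X"
  using compact_riemann_surface by (simp_all add: compact_riemann_surface_def)

lemma chart_openin: "(U, z) \<in> A \<Longrightarrow> openin X U"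
  and chart_homeo: "(U, z) \<in> A \<Longrightarrow> homeomorphic_map (subtopology X U) (top_of_set (z ` U)) z"
  and chart_open_image: "(U, z) \<in> A \<Longrightarrow> open (z ` U)"
  using compact_riemann_surface by (auto simp: compact_riemann_surface_def)

lemma chart_transition: "(U, z) \<in> A \<Longrightarrow> (V, w) \<in> A \<Longrightarrow> (w \<circ> inv_into U z) holomorphic_on z ` (U \<inter> V)"
  using compact_riemann_surface by (fastforce simp: compact_riemann_surface_def)

lemma chart_at:
  assumes "x \<in> topspace X"
  obtains U z where "(U, z) \<in> A" "x \<in> U"
  using assms charts_cover by blast

lemma chart_subset: "(U, z) \<in> A \<Longrightarrow> U \<subseteq> topspace X"
  using chart_openin openin_subset by blast

lemma chart_inj: "(U, z) \<in> A \<Longrightarrow> inj_on z U"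
  using homeomorphic_imp_injective_map[OF chart_homeo] chart_subset by (simp add: inf_absorb2)

lemma chart_inv [simp]: "(U, z) \<in> A \<Longrightarrow> x \<in> U \<Longrightarrow> inv_into U z (z x) = x"
  using chart_inj by (simp add: inv_into_f_f)

lemma chart_image_open:
  assumes c: "(U, z) \<in> A" and W: "openin X W"
  shows "open (z ` (U \<inter> W))"
proof -
  have "openin (subtopology X U) (U \<inter> W)"
    using W by (auto simp: openin_subtopology)
  then have "openin (top_of_set (z ` U)) (z ` (U \<inter> W))"
    using homeomorphic_imp_open_map[OF chart_homeo[OF c]] by (simp add: open_map_def)
  then show ?thesis
    using chart_open_image[OF c] by (metis openin_open_trans)
qed

lemma chart_preimage_open:
  assumes c: "(U, z) \<in> A" and S: "open S"
  shows "openin X {x \<in> U. z x \<in> S}"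
proof -
  have "continuous_map (subtopology X U) (top_of_set (z ` U)) z"
    by (rule homeomorphic_imp_continuous_map[OF chart_homeo[OF c]])
  then have "continuous_map (subtopology X U) euclidean z"
    using continuous_map_into_fulltopology by blast
  then have "openin (subtopology X U) {x \<in> topspace (subtopology X U). z x \<in> S}"
    by (rule openin_continuous_map_preimage) (use S in simp)
  moreover have "topspace (subtopology X U) = U" using chart_subset[OF c] by auto
  ultimately have "openin (subtopology X U) {x \<in> U. z x \<in> S}" by (simp only:)
  then show ?thesis
    by (rule openin_trans_full[OF _ chart_openin[OF c]])
qed

lemma chart_disc:
  assumes c: "(U, z) \<in> A" and W: "openin X W" and x: "x \<in> U" "x \<in> W"
  obtains r where "r > 0" "ball (z x) r \<subseteq> z ` (U \<inter> W)"
  using chart_image_open[OF c W] x by (meson IntI image_eqI openE)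

lemma disc_preimage_subset:
  assumes c: "(U, z) \<in> A" and "S \<subseteq> z ` (U \<inter> W)" "y \<in> U" "z y \<in> S"
  shows "y \<in> W"
  using assms chart_inj[OF c] by (auto dest: inj_onD)

text \<open>One chart suffices because the transition maps are holomorphic.\<close>

lemma hol_at_chartI:
  assumes c: "(U, z) \<in> A" and x: "x \<in> U" and d: "(h \<circ> inv_into U z) field_differentiable (at (z x))"
  shows "hol_at A h x"
  unfolding hol_at_def
proof clarify
  fix V w assume c': "(V, w) \<in> A" and x': "x \<in> V"
  have op: "open (w ` (V \<inter> U))" by (rule chart_image_open[OF c' chart_openin[OF c]])
  have xin: "w x \<in> w ` (V \<inter> U)" using x x' by blast
  have "(z \<circ> inv_into V w) field_differentiable (at (w x))"
    using holomorphic_on_imp_differentiable_at[OF chart_transition[OF c' c] op xin] .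
  moreover have "(h \<circ> inv_into U z) field_differentiable (at ((z \<circ> inv_into V w) (w x)))"
    using d c' x' by simp
  ultimately have "((h \<circ> inv_into U z) \<circ> (z \<circ> inv_into V w)) field_differentiable (at (w x))"
    by (rule field_differentiable_compose)
  then show "(h \<circ> inv_into V w) field_differentiable (at (w x))"
    by (rule field_differentiable_transform_open[OF op xin, rotated]) (use c c' in auto)
qed

lemma hol_at_chartD:
  assumes "hol_at A h x" "(U, z) \<in> A" "x \<in> U"
  shows "(h \<circ> inv_into U z) field_differentiable (at (z x))"
  using assms by (auto simp: hol_at_def)

lemma hol_at_transform:
  assumes h: "hol_at A h x" and W: "openin X W" "x \<in> W" and eq: "\<And>y. y \<in> W \<Longrightarrow> h y = k y"
  shows "hol_at A k x"
proof -
  have "x \<in> topspace X" using W openin_subset by blast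
  then obtain U z where c: "(U, z) \<in> A" "x \<in> U" by (rule chart_at)
  have "(k \<circ> inv_into U z) field_differentiable (at (z x))"
    by (rule field_differentiable_transform_open[OF chart_image_open[OF c(1) W(1)] _ _ hol_at_chartD[OF h c]])
       (use c W eq in auto)
  then show ?thesis by (rule hol_at_chartI[OF c])
qed

lemma hol_at_divide:
  assumes f: "hol_at A f x" and g: "hol_at A g x" "g x \<noteq> 0"
  shows "hol_at A (\<lambda>x. f x / g x) x"
  unfolding hol_at_def
proof clarify
  fix U z assume c: "(U, z) \<in> A" "x \<in> U"
  show "((\<lambda>x. f x / g x) \<circ> inv_into U z) field_differentiable (at (z x))"
    using hol_at_chartD[OF f c] hol_at_chartD[OF g(1) c] g(2) c
    by (auto simp: o_def intro!: field_differentiable_divide)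
qed

lemma hol_at_compose:
  assumes h: "hol_at A h x" and g: "g field_differentiable (at (h x))"
  shows "hol_at A (\<lambda>x. g (h x)) x"
  unfolding hol_at_def
proof clarify
  fix U z assume c: "(U, z) \<in> A" "x \<in> U"
  have "(g \<circ> (h \<circ> inv_into U z)) field_differentiable (at (z x))"
    by (rule field_differentiable_compose[OF hol_at_chartD[OF h c]]) (use g c in simp)
  then show "((\<lambda>x. g (h x)) \<circ> inv_into U z) field_differentiable (at (z x))"
    by (simp add: o_def)
qed

lemma hol_at_chart: "(U, z) \<in> A \<Longrightarrow> x \<in> U \<Longrightarrow> hol_at A z x"
proof -
  assume c: "(U, z) \<in> A" "x \<in> U"
  have "(z \<circ> inv_into U z) field_differentiable (at (z x))"
    by (rule field_differentiable_transform_open[OF chart_open_image[OF c(1)] _ _ field_differentiable_ident])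
       (use c in \<open>auto simp: f_inv_into_f\<close>)
  then show ?thesis by (rule hol_at_chartI[OF c])
qed

lemma hol_at_tendsto:
  assumes h: "hol_at A h x" and x: "x \<in> topspace X"
  shows "(h \<longlongrightarrow> h x) (nhdsin X x)"
proof (rule topological_tendstoI)
  fix S assume S: "open S" "h x \<in> S"
  obtain U z where c: "(U, z) \<in> A" "x \<in> U" by (rule chart_at[OF x])
  let ?g = "h \<circ> inv_into U z"
  have "continuous (at (z x)) ?g"
    by (rule field_differentiable_imp_continuous_at[OF hol_at_chartD[OF h c]])
  moreover have "?g (z x) \<in> S" using S c by simp
  ultimately obtain T where T: "open T" "z x \<in> T" "\<forall>w\<in>T. ?g w \<in> S"
    using S(1) by (auto simp: continuous_at_open)
  show "eventually (\<lambda>y. h y \<in> S) (nhdsin X x)"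
    unfolding eventually_nhdsin
  proof (intro disjI2 exI conjI)
    show "openin X {y \<in> U. z y \<in> T}" by (rule chart_preimage_open[OF c(1) T(1)])
    show "x \<in> {y \<in> U. z y \<in> T}" using c T by simp
    show "\<forall>y\<in>{y \<in> U. z y \<in> T}. h y \<in> S" using T(3) c(1) by force
  qed
qed

lemma hol_on_chart:
  assumes "\<And>y. y \<in> W \<Longrightarrow> hol_at A h y" "openin X W" and c: "(U, z) \<in> A"
  shows "(h \<circ> inv_into U z) holomorphic_on z ` (U \<inter> W)"
  unfolding holomorphic_on_def
proof clarify
  fix y assume "y \<in> U" "y \<in> W"
  then have "(h \<circ> inv_into U z) field_differentiable (at (z y))" using assms(1) c by (intro hol_at_chartD)
  then show "(h \<circ> inv_into U z) field_differentiable (at (z y) within z ` (U \<inter> W))"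
    by (rule field_differentiable_at_within)
qed

lemma hol_at_of_chart_holomorphic:
  assumes c: "(U, z) \<in> A" and S: "open S" and h: "(h \<circ> inv_into U z) holomorphic_on S"
    and x: "x \<in> U" "z x \<in> S"
  shows "hol_at A h x"
  by (rule hol_at_chartI[OF c x(1) holomorphic_on_imp_differentiable_at[OF h S x(2)]])

lemma infinite_open:
  assumes W: "openin X W" "x \<in> W"
  shows "infinite W"
proof
  assume fin: "finite W"
  have "x \<in> topspace X" using W openin_subset by blast
  then obtain U z where c: "(U, z) \<in> A" "x \<in> U" by (rule chart_at)
  then obtain r where "r > 0" "ball (z x) r \<subseteq> z ` (U \<inter> W)" using chart_disc W by metis
  moreover have "finite (z ` (U \<inter> W))" using fin by simp
  ultimately have "finite (ball (z x) r)" using finite_subset by blast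
  then show False using \<open>r > 0\<close> uncountable_ball countable_finite by blast
qed

text \<open>The identity theorem in global form. Around each point the zeros of \<open>h\<close> either fill a neighbourhood
  or are isolated, by the identity theorem in a disc of a chart. The interior of \<open>Z\<close> is therefore open
  and closed. By connectedness it is everything or empty, and in the latter case \<open>Z\<close> is discrete
  and closed in a compact space, hence finite.\<close>

lemma analytic_subset_finite_or_all:
  assumes Z: "Z \<subseteq> topspace X"
    and loc: "\<And>x. x \<in> topspace X \<Longrightarrow> \<exists>W h. openin X W \<and> x \<in> W \<and> (\<forall>y\<in>W. hol_at A h y) \<and> (\<forall>y\<in>W. y \<in> Z \<longleftrightarrow> h y = 0)"
  shows "finite Z \<or> Z = topspace X"
proof -
  have key: "(\<exists>W. openin X W \<and> x \<in> W \<and> W \<subseteq> Z) \<or> (\<exists>W. openin X W \<and> x \<in> W \<and> W \<inter> Z \<subseteq> {x})"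
    if x: "x \<in> topspace X" for x
  proof -
    obtain W h where W: "openin X W" "x \<in> W" "\<forall>y\<in>W. hol_at A h y" "\<forall>y\<in>W. y \<in> Z \<longleftrightarrow> h y = 0"
      using loc[OF x] by blast
    obtain U z where c: "(U, z) \<in> A" "x \<in> U" by (rule chart_at[OF x])
    obtain r where r: "r > 0" "ball (z x) r \<subseteq> z ` (U \<inter> W)" using chart_disc[OF c(1) W(1) c(2) W(2)] .
    let ?g = "h \<circ> inv_into U z"
    have hol: "?g holomorphic_on ball (z x) r"
      using hol_on_chart[OF _ W(1) c(1)] W(3) r(2) holomorphic_on_subset by blast
    have inW: "y \<in> W" if "y \<in> U" "z y \<in> ball (z x) r" for y
      by (rule disc_preimage_subset[OF c(1) r(2) that])
    show ?thesis
    proof (cases "\<forall>w\<in>ball (z x) r. ?g w = 0")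
      case True
      have "{y \<in> U. z y \<in> ball (z x) r} \<subseteq> Z"
      proof clarify
        fix y assume y: "y \<in> U" "z y \<in> ball (z x) r"
        then have "h y = 0" using True c(1) by force
        then show "y \<in> Z" using W(4) inW[OF y] by blast
      qed
      moreover have "openin X {y \<in> U. z y \<in> ball (z x) r}" by (rule chart_preimage_open[OF c(1)]) simp
      moreover have "x \<in> {y \<in> U. z y \<in> ball (z x) r}" using c(2) r(1) by simp
      ultimately show ?thesis by blast
    next
      case False
      then obtain b where b: "b \<in> ball (z x) r" "?g b \<noteq> 0" by blast
      have "eventually (\<lambda>w. ?g w \<noteq> 0 \<and> w \<in> ball (z x) r) (at (z x))"
        by (rule non_zero_neighbour_alt[OF hol _ _ _ b]) (use r in auto)
      then obtain S where S: "open S" "z x \<in> S" "\<forall>w\<in>S. w \<noteq> z x \<longrightarrow> ?g w \<noteq> 0 \<and> w \<in> ball (z x) r"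
        unfolding eventually_at_topological by blast
      let ?N = "{y \<in> U. z y \<in> S}"
      have "openin X ?N" by (rule chart_preimage_open[OF c(1) S(1)])
      moreover have "?N \<inter> Z \<subseteq> {x}"
      proof clarify
        fix y assume y: "y \<in> U" "z y \<in> S" "y \<in> Z"
        show "y = x"
        proof (rule ccontr)
          assume "y \<noteq> x"
          then have "z y \<noteq> z x" using chart_inj[OF c(1)] y c(2) by (auto dest: inj_onD)
          then have "?g (z y) \<noteq> 0" "z y \<in> ball (z x) r" using S(3) y by auto
          then show False using inW[of y] y W(4) c(1) by auto
        qed
      qed
      ultimately show ?thesis using c(2) S(2) by blast
    qed
  qed
  define I where "I = {x. \<exists>W. openin X W \<and> x \<in> W \<and> W \<subseteq> Z}"
  have IZ: "I \<subseteq> Z" by (auto simp: I_def)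
  have "openin X I"
    by (subst openin_subopen) (auto simp: I_def)
  moreover have "openin X (topspace X - I)"
  proof (subst openin_subopen, intro ballI)
    fix x assume x: "x \<in> topspace X - I"
    then obtain W where W: "openin X W" "x \<in> W" "W \<inter> Z \<subseteq> {x}"
      using key[of x] by (auto simp: I_def)
    (* Nonempty open sets are infinite, so none of them lies in W \<inter> Z. *)
    have "y \<notin> I" if "y \<in> W" for y
    proof
      assume "y \<in> I"
      then obtain V where V: "openin X V" "y \<in> V" "V \<subseteq> Z" by (auto simp: I_def)
      then have "infinite (V \<inter> W)" using infinite_open[of "V \<inter> W" y] W that by auto
      moreover have "V \<inter> W \<subseteq> {x}" using W V by blast
      ultimately show False using finite_subset by blast
    qed
    then show "\<exists>T. openin X T \<and> x \<in> T \<and> T \<subseteq> topspace X - I"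
      using W openin_subset by blast
  qed
  ultimately have "I = {} \<or> I = topspace X"
    using connected_X IZ Z by (metis closedin_def connected_space_clopen_in order_trans)
  then show ?thesis
  proof
    assume "I = topspace X"
    then show ?thesis using IZ Z by blast
  next
    assume "I = {}"
    then have noI: "\<not> (\<exists>W. openin X W \<and> x \<in> W \<and> W \<subseteq> Z)" for x
      unfolding I_def by blast
    have "\<forall>x\<in>topspace X. \<exists>W. openin X W \<and> x \<in> W \<and> W \<inter> Z \<subseteq> {x}"
      using key noI by metis
    then obtain N where N: "\<And>x. x \<in> topspace X \<Longrightarrow> openin X (N x) \<and> x \<in> N x \<and> N x \<inter> Z \<subseteq> {x}"
      by metis
    have "\<forall>V\<in>N ` topspace X. openin X V" "topspace X \<subseteq> \<Union>(N ` topspace X)" using N by blast+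
    then obtain \<F> where \<F>: "finite \<F>" "\<F> \<subseteq> N ` topspace X" "topspace X \<subseteq> \<Union>\<F>"
      using compact_X unfolding compact_space_alt by (elim allE[of _ "N ` topspace X"]) blast
    then obtain D where "D \<subseteq> topspace X" "finite D" "\<F> = N ` D" using finite_subset_image by metis
    with \<F>(3) have D: "finite D" "D \<subseteq> topspace X" "topspace X \<subseteq> \<Union>(N ` D)" by simp_all
    have "Z \<subseteq> D"
    proof
      fix y assume "y \<in> Z"
      then obtain d where "d \<in> D" "y \<in> N d" using Z D by blast
      then show "y \<in> D" using N D \<open>y \<in> Z\<close> by blast
    qed
    then show ?thesis using D finite_subset by blast
  qed
qed

text \<open>By compactness the modulus of \<open>h\<close> has a maximum, attained at \<open>x\<close> say. The maximum modulus principle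
  makes \<open>h\<close> constant near \<open>x\<close>, and the identity theorem makes it constant.\<close>

lemma hol_on_X_constant:
  assumes h: "\<And>x. x \<in> topspace X \<Longrightarrow> hol_at A h x"
  obtains c where "\<And>x. x \<in> topspace X \<Longrightarrow> h x = c"
proof -
  have cont: "continuous_map X euclideanreal (\<lambda>x. norm (h x))"
    by (rule continuous_map_nhdsinI) (intro tendsto_intros hol_at_tendsto h)
  have "compact ((\<lambda>x. norm (h x)) ` topspace X)"
    using image_compactin[OF _ cont, of "topspace X"] compact_X by (simp add: compact_space_def)
  then obtain x where x: "x \<in> topspace X" "\<And>y. y \<in> topspace X \<Longrightarrow> norm (h y) \<le> norm (h x)"
    using compact_attains_sup[of "(\<lambda>x. norm (h x)) ` topspace X"] nonempty_X by auto
  let ?Z = "{y \<in> topspace X. h y = h x}"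
  have "finite ?Z \<or> ?Z = topspace X"
  proof (rule analytic_subset_finite_or_all)
    fix y assume y: "y \<in> topspace X"
    show "\<exists>W k. openin X W \<and> y \<in> W \<and> (\<forall>y\<in>W. hol_at A k y) \<and> (\<forall>y\<in>W. y \<in> ?Z \<longleftrightarrow> k y = 0)"
      by (intro exI[of _ "topspace X"] exI[of _ "\<lambda>y. h y - h x"])
         (use y h in \<open>auto intro!: hol_at_intros\<close>)
  qed auto
  moreover have "infinite ?Z"
  proof -
    obtain U z where c: "(U, z) \<in> A" "x \<in> U" by (rule chart_at[OF x(1)])
    obtain r where r: "r > 0" "ball (z x) r \<subseteq> z ` (U \<inter> topspace X)"
      using chart_disc[OF c(1) _ c(2)] x by (metis openin_topspace)
    let ?g = "h \<circ> inv_into U z" and ?B = "ball (z x) r"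
    have "?g holomorphic_on ?B"
      using hol_on_chart[OF h openin_topspace c(1)] r(2) holomorphic_on_subset by blast
    then have "?g constant_on ?B"
    proof (rule maximum_modulus_principle[of _ _ ?B "z x"])
      fix w assume "w \<in> ?B"
      then obtain y where "y \<in> U" "y \<in> topspace X" "w = z y" using r by blast
      then show "norm (?g w) \<le> norm (?g (z x))" using x c by simp
    qed (use r in auto)
    then have "\<forall>w\<in>?B. ?g w = ?g (z x)" using r by (auto simp: constant_on_def)
    then have "{y \<in> U. z y \<in> ?B} \<subseteq> ?Z"
      using c chart_subset by force
    moreover have "infinite {y \<in> U. z y \<in> ?B}"
      by (rule infinite_open[OF chart_preimage_open[OF c(1)], of _ x]) (use c r in auto)
    ultimately show ?thesis using finite_subset by blast
  qed
  ultimately have "?Z = topspace X" by blast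
  then show ?thesis using that[of "h x"] by blast
qed

text \<open>A holomorphic function with nonzero derivative is a local coordinate. The last conclusion says
  that every function differentiable at \<open>y\<close> is, near \<open>y\<close>, a differentiable function of \<open>t\<close>.\<close>

lemma local_inverse:
  assumes W: "openin X W" "x \<in> W" and t: "\<And>y. y \<in> W \<Longrightarrow> hol_at A t y"
    and c: "(U, z) \<in> A" "x \<in> U" and d: "deriv (t \<circ> inv_into U z) (z x) \<noteq> 0"
  obtains N where "openin X N" "x \<in> N" "N \<subseteq> W" "inj_on t N" "open (t ` N)"
    "\<And>h y. y \<in> N \<Longrightarrow> hol_at A h y \<Longrightarrow> (h \<circ> inv_into N t) field_differentiable (at (t y))"
proof -
  let ?g = "t \<circ> inv_into U z"
  have hol: "?g holomorphic_on z ` (U \<inter> W)" by (rule hol_on_chart[OF t W(1) c(1)])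
  have op: "open (z ` (U \<inter> W))" by (rule chart_image_open[OF c(1) W(1)])
  have zx: "z x \<in> z ` (U \<inter> W)" using c W by blast
  obtain r where r: "r > 0" "ball (z x) r \<subseteq> z ` (U \<inter> W)" "open (?g ` ball (z x) r)" "inj_on ?g (ball (z x) r)"
    using has_complex_derivative_locally_invertible[OF hol zx op d] .
  let ?B = "ball (z x) r"
  define N where "N = {y \<in> U. z y \<in> ?B}"
  have gt: "?g (z y) = t y" if "y \<in> N" for y using that c by (simp add: N_def)
  have BN: "?B = z ` N" using r(2) by (auto simp: N_def)
  have injN: "inj_on t N"
  proof (rule inj_onI)
    fix y y' assume *: "y \<in> N" "y' \<in> N" "t y = t y'"
    then have "z y = z y'" using r(4) gt by (metis BN image_eqI inj_onD)
    then show "y = y'" using * chart_inj[OF c(1)] by (auto simp: N_def dest: inj_onD)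
  qed
  have tN: "t ` N = ?g ` ?B" unfolding BN image_image using gt by (intro image_cong) auto
  have holB: "?g holomorphic_on ?B" using hol r(2) holomorphic_on_subset by blast
  obtain k where k: "k holomorphic_on (?g ` ?B)" "\<And>w. w \<in> ?B \<Longrightarrow> k (?g w) = w"
    using holomorphic_has_inverse[OF holB open_ball r(4)] by metis
  show ?thesis
  proof
    show "openin X N" unfolding N_def by (rule chart_preimage_open[OF c(1)]) simp
    show "x \<in> N" using c r by (simp add: N_def)
    show "N \<subseteq> W" using disc_preimage_subset[OF c(1) r(2)] by (auto simp: N_def)
    show "inj_on t N" by fact
    show "open (t ` N)" using r(3) tN by simp
    fix h y assume y: "y \<in> N" and h: "hol_at A h y"
    have kt: "k (t y') = z y'" if "y' \<in> N" for y' using k(2)[of "z y'"] gt[OF that] that by (simp add: N_def)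
    have ty: "t y \<in> t ` N" using y by blast
    have "k field_differentiable (at (t y))"
      using k(1) r(3) ty tN holomorphic_on_imp_differentiable_at by metis
    moreover have "(h \<circ> inv_into U z) field_differentiable (at (k (t y)))"
      using hol_at_chartD[OF h c(1)] y kt[OF y] by (simp add: N_def)
    ultimately have "((h \<circ> inv_into U z) \<circ> k) field_differentiable (at (t y))"
      by (rule field_differentiable_compose)
    then show "(h \<circ> inv_into N t) field_differentiable (at (t y))"
    proof (rule field_differentiable_transform_open[OF \<open>open (t ` N)\<close> ty, rotated])
      fix w assume "w \<in> t ` N"
      then obtain y' where y': "y' \<in> N" "w = t y'" by blast
      then show "((h \<circ> inv_into U z) \<circ> k) w = (h \<circ> inv_into N t) w"
        using kt[OF y'(1)] injN c(1) by (simp add: N_def)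
    qed
  qed
qed

text \<open>For holomorphic \<open>t\<close> a formulation of having nonzero derivative at \<open>x\<close> that mentions no chart.\<close>

definition locally_injective_at :: "('a \<Rightarrow> complex) \<Rightarrow> 'a \<Rightarrow> bool" where
  "locally_injective_at t x \<longleftrightarrow> (\<exists>N. openin X N \<and> x \<in> N \<and> inj_on t N)"

lemma locally_injective_at_iff:
  assumes W: "openin X W" "x \<in> W" and t: "\<And>y. y \<in> W \<Longrightarrow> hol_at A t y"
    and c: "(U, z) \<in> A" "x \<in> U"
  shows "locally_injective_at t x \<longleftrightarrow> deriv (t \<circ> inv_into U z) (z x) \<noteq> 0"
proof
  assume "locally_injective_at t x"
  then obtain N where N: "openin X N" "x \<in> N" "inj_on t N" by (auto simp: locally_injective_at_def)
  have hol: "(t \<circ> inv_into U z) holomorphic_on z ` (U \<inter> (W \<inter> N))"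
    by (rule hol_on_chart) (use W N c t in auto)
  have inj: "inj_on (t \<circ> inv_into U z) (z ` (U \<inter> (W \<inter> N)))"
  proof (rule inj_onI, clarify)
    fix y y' assume "y \<in> U" "y \<in> N" "y' \<in> U" "y' \<in> N" "(t \<circ> inv_into U z) (z y) = (t \<circ> inv_into U z) (z y')"
    then show "z y = z y'" using N(3) c by (auto dest: inj_onD)
  qed
  show "deriv (t \<circ> inv_into U z) (z x) \<noteq> 0"
    by (rule holomorphic_injective_imp_regular[OF hol _ inj])
       (use W N c in \<open>auto intro!: chart_image_open\<close>)
next
  assume "deriv (t \<circ> inv_into U z) (z x) \<noteq> 0"
  from local_inverse[OF W t c this] show "locally_injective_at t x"
    unfolding locally_injective_at_def by metis
qed

end

section \<open>Norms along a proper holomorphic function\<close>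

context riemann_surface begin

lemma preimage_openin:
  assumes "openin X U" "\<And>x. x \<in> U \<Longrightarrow> hol_at A t x" "open S"
  shows "openin X {x \<in> U. t x \<in> S}"
proof -
  have sub: "U \<subseteq> topspace X" using assms(1) openin_subset by blast
  have "openin X {x \<in> topspace X. x \<in> U \<and> t x \<in> S}"
  proof (rule openin_eventually_nhdsin)
    fix x assume x: "x \<in> topspace X" "x \<in> U \<and> t x \<in> S"
    have "eventually (\<lambda>y. y \<in> U) (nhdsin X x)" using assms(1) x by (auto simp: eventually_nhdsin)
    moreover have "eventually (\<lambda>y. t y \<in> S) (nhdsin X x)"
      using topological_tendstoD[OF hol_at_tendsto[OF assms(2) x(1)] assms(3)] x by blast
    ultimately show "eventually (\<lambda>y. y \<in> U \<and> t y \<in> S) (nhdsin X x)" by (rule eventually_conj)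
  qed
  moreover have "{x \<in> topspace X. x \<in> U \<and> t x \<in> S} = {x \<in> U. t x \<in> S}" using sub by blast
  ultimately show ?thesis by simp
qed

text \<open>Separate the finitely many points pairwise and intersect, for each point, the neighbourhoods
  obtained.\<close>

lemma disjoint_neighbourhoods:
  assumes fin: "finite E" and E: "E \<subseteq> topspace X"
  obtains V where "\<And>x. x \<in> E \<Longrightarrow> openin X (V x) \<and> x \<in> V x" "\<And>x y. x \<in> E \<Longrightarrow> y \<in> E \<Longrightarrow> x \<noteq> y \<Longrightarrow> V x \<inter> V y = {}"
proof -
  have "\<exists>P Q. openin X P \<and> openin X Q \<and> x \<in> P \<and> y \<in> Q \<and> P \<inter> Q = {}" if "x \<in> E" "y \<in> E" "x \<noteq> y" for x y
    using Hausdorff_X that E unfolding Hausdorff_space_def disjnt_def by (meson subsetD)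
  then obtain P Q where PQ: "\<And>x y. x \<in> E \<Longrightarrow> y \<in> E \<Longrightarrow> x \<noteq> y \<Longrightarrow>
      openin X (P x y) \<and> openin X (Q x y) \<and> x \<in> P x y \<and> y \<in> Q x y \<and> P x y \<inter> Q x y = {}"
    by metis
  define V where "V x = topspace X \<inter> (\<Inter>y\<in>E - {x}. P x y \<inter> Q y x)" for x
  show ?thesis
  proof
    fix x assume x: "x \<in> E"
    show "openin X (V x) \<and> x \<in> V x"
    proof (cases "E - {x} = {}")
      case True
      show ?thesis unfolding V_def True using x E by auto
    next
      case False
      have "openin X (\<Inter>y\<in>E - {x}. P x y \<inter> Q y x)"
        by (rule openin_Inter) (use fin False x PQ in auto)
      then show ?thesis using x E PQ by (auto simp: V_def)
    qed
  next
    fix x y assume "x \<in> E" "y \<in> E" "x \<noteq> y"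
    then have "V x \<subseteq> P x y" "V y \<subseteq> Q x y" "P x y \<inter> Q x y = {}" using PQ by (auto simp: V_def)
    then show "V x \<inter> V y = {}" by blast
  qed
qed

end

text \<open>
  Compactness of the sublevel sets makes \<open>t\<close> proper as a map from \<open>U\<close> to the complex plane.\<close>

locale proper_function = riemann_surface +
  fixes U :: "'a set" and t :: "'a \<Rightarrow> complex"
  assumes open_U: "openin X U"
    and hol_t: "\<And>x. x \<in> U \<Longrightarrow> hol_at A t x"
    and proper: "\<And>R. closedin X {x \<in> U. norm (t x) \<le> R}"
begin

definition fibre :: "complex \<Rightarrow> 'a set" where
  "fibre \<tau> = {x \<in> U. t x = \<tau>}"

lemma U_subset: "U \<subseteq> topspace X"
  using open_U openin_subset by blast

lemma compact_fibre: "compactin X (fibre \<tau>)"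
proof -
  have "closedin X ({x \<in> U. norm (t x) \<le> norm \<tau>} - {x \<in> U. t x \<in> - {\<tau>}})"
    by (intro closedin_diff proper preimage_openin open_U hol_t) auto
  moreover have "{x \<in> U. norm (t x) \<le> norm \<tau>} - {x \<in> U. t x \<in> - {\<tau>}} = fibre \<tau>"
    by (auto simp: fibre_def)
  ultimately show ?thesis using compact_X closedin_compact_space by metis
qed

lemma compact_image:
  assumes "compactin X K" "K \<subseteq> U"
  shows "compact (t ` K)"
proof -
  have "continuous_map (subtopology X U) euclidean t"
    unfolding continuous_map_def
  proof (intro conjI allI impI)
    fix S :: "complex set" assume "openin euclidean S"
    then have "openin X {x \<in> U. t x \<in> S}" using preimage_openin[OF open_U hol_t] by simp
    then have "openin (subtopology X U) (U \<inter> {x \<in> U. t x \<in> S})" by (auto simp: openin_subtopology)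
    moreover have "{x \<in> topspace (subtopology X U). t x \<in> S} = U \<inter> {x \<in> U. t x \<in> S}"
      using U_subset by auto
    ultimately show "openin (subtopology X U) {x \<in> topspace (subtopology X U). t x \<in> S}" by (simp only:)
  qed auto
  then show ?thesis
    using image_compactin[of "subtopology X U" K euclidean t] assms by (simp add: compactin_subtopology)
qed

text \<open>Over a small disc around a regular value, \<open>U\<close> is a disjoint union of finitely many copies of the
  disc. The points of the fibre are isolated, so the compact fibre is finite, and \<open>t\<close> has local
  inverses \<open>s x\<close> with disjoint images \<open>N x\<close>. Properness excludes further points: a fibre over a value
  near \<open>\<tau>0\<close> lies in a fixed compact set, and the part of this set outside the sets \<open>N x\<close> has a
  compact image that omits \<open>\<tau>0\<close>.\<close>

lemma evenly_covered:
  assumes reg: "\<And>x. x \<in> fibre \<tau>0 \<Longrightarrow> locally_injective_at t x"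
    and B: "closed B" "\<tau>0 \<notin> B"
  obtains r s where "finite (fibre \<tau>0)" "r > 0" "ball \<tau>0 r \<inter> B = {}"
    "\<And>\<tau>. \<tau> \<in> ball \<tau>0 r \<Longrightarrow> bij_betw (\<lambda>x. s x \<tau>) (fibre \<tau>0) (fibre \<tau>)"
    "\<And>x u. x \<in> fibre \<tau>0 \<Longrightarrow> (\<And>y. y \<in> U \<Longrightarrow> hol_at A u y) \<Longrightarrow> (\<lambda>\<tau>. u (s x \<tau>)) holomorphic_on ball \<tau>0 r"
proof -
  let ?E = "fibre \<tau>0"
  have EU: "?E \<subseteq> U" by (auto simp: fibre_def)
  have inv: "\<exists>N. openin X N \<and> x \<in> N \<and> N \<subseteq> W \<and> inj_on t N \<and> open (t ` N) \<and>
      (\<forall>h. \<forall>y\<in>N. hol_at A h y \<longrightarrow> (h \<circ> inv_into N t) field_differentiable (at (t y)))"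
    if x: "x \<in> ?E" and W: "openin X W" "x \<in> W" "W \<subseteq> U" for x W
  proof -
    obtain V z where c: "(V, z) \<in> A" "x \<in> V" using chart_at x EU U_subset by blast
    have hW: "\<And>y. y \<in> W \<Longrightarrow> hol_at A t y" using W(3) hol_t by blast
    have "deriv (t \<circ> inv_into V z) (z x) \<noteq> 0"
      using locally_injective_at_iff[OF W(1,2) hW c] reg[OF x] by blast
    from local_inverse[OF W(1,2) hW c this] show ?thesis by metis
  qed
  have fin: "finite ?E"
  proof -
    have "\<forall>x\<in>?E. \<exists>N. openin X N \<and> x \<in> N \<and> inj_on t N"
      using reg by (auto simp: locally_injective_at_def)
    then obtain N where N: "\<And>x. x \<in> ?E \<Longrightarrow> openin X (N x) \<and> x \<in> N x \<and> inj_on t (N x)" by metis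
    have "\<forall>V\<in>N ` ?E. openin X V" "?E \<subseteq> \<Union>(N ` ?E)" using N by blast+
    then obtain \<F> where \<F>: "finite \<F>" "\<F> \<subseteq> N ` ?E" "?E \<subseteq> \<Union>\<F>"
      using compact_fibre[of \<tau>0] unfolding compactin_def by blast
    then obtain D where D: "D \<subseteq> ?E" "finite D" "\<F> = N ` D" using finite_subset_image by metis
    have "?E \<subseteq> D"
    proof
      fix y assume y: "y \<in> ?E"
      then obtain d where d: "d \<in> D" "y \<in> N d" using \<F> D by blast
      then have "d \<in> ?E" using D by blast
      have "y = d"
        by (rule inj_onD[of t "N d"]) (use N[OF \<open>d \<in> ?E\<close>] d y \<open>d \<in> ?E\<close> in \<open>auto simp: fibre_def\<close>)
      then show "y \<in> D" using d by simp
    qed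
    then show ?thesis using D finite_subset by blast
  qed
  obtain V where V: "\<And>x. x \<in> ?E \<Longrightarrow> openin X (V x) \<and> x \<in> V x"
    and Vd: "\<And>x y. x \<in> ?E \<Longrightarrow> y \<in> ?E \<Longrightarrow> x \<noteq> y \<Longrightarrow> V x \<inter> V y = {}"
    using disjoint_neighbourhoods[OF fin] EU U_subset by (metis subset_trans)
  have "\<forall>x\<in>?E. \<exists>N. openin X N \<and> x \<in> N \<and> N \<subseteq> V x \<inter> U \<and> inj_on t N \<and> open (t ` N) \<and>
      (\<forall>h. \<forall>y\<in>N. hol_at A h y \<longrightarrow> (h \<circ> inv_into N t) field_differentiable (at (t y)))"
  proof
    fix x assume x: "x \<in> ?E"
    show "\<exists>N. openin X N \<and> x \<in> N \<and> N \<subseteq> V x \<inter> U \<and> inj_on t N \<and> open (t ` N) \<and>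
      (\<forall>h. \<forall>y\<in>N. hol_at A h y \<longrightarrow> (h \<circ> inv_into N t) field_differentiable (at (t y)))"
      by (rule inv[OF x]) (use x V EU open_U in auto)
  qed
  from bchoice[OF this] obtain N where N': "\<forall>x\<in>?E. openin X (N x) \<and> x \<in> N x \<and> N x \<subseteq> V x \<inter> U \<and>
      inj_on t (N x) \<and> open (t ` N x) \<and>
      (\<forall>h. \<forall>y\<in>N x. hol_at A h y \<longrightarrow> (h \<circ> inv_into (N x) t) field_differentiable (at (t y)))" ..
  then have N: "\<And>x. x \<in> ?E \<Longrightarrow> openin X (N x)" "\<And>x. x \<in> ?E \<Longrightarrow> x \<in> N x"
    "\<And>x. x \<in> ?E \<Longrightarrow> N x \<subseteq> V x \<inter> U" "\<And>x. x \<in> ?E \<Longrightarrow> inj_on t (N x)" "\<And>x. x \<in> ?E \<Longrightarrow> open (t ` N x)"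
    by blast+
  have Nh: "\<And>x h y. x \<in> ?E \<Longrightarrow> y \<in> N x \<Longrightarrow> hol_at A h y \<Longrightarrow> (h \<circ> inv_into (N x) t) field_differentiable (at (t y))"
    using N' by blast
  (* The bound norm \<tau>0 + 1 holds for all fibres over the unit disc around \<tau>0. *)
  let ?K = "{x \<in> U. norm (t x) \<le> norm \<tau>0 + 1} - (\<Union>x\<in>?E. N x)"
  have "closedin X ?K" using N(1) by (intro closedin_diff proper openin_Union) auto
  then have "compactin X ?K" using compact_X closedin_compact_space by blast
  then have "compact (t ` ?K)" by (rule compact_image) auto
  then have clK: "closed (t ` ?K)" by (rule compact_imp_closed)
  let ?\<Omega> = "(\<Inter>x\<in>?E. t ` N x) \<inter> - B \<inter> ball \<tau>0 1 \<inter> - t ` ?K"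
  have "open ?\<Omega>" using fin N(5) B clK by (intro open_Int open_INT open_Compl) auto
  moreover have "\<tau>0 \<in> ?\<Omega>"
  proof -
    have "\<tau>0 \<in> t ` N x" if "x \<in> ?E" for x using N(2)[OF that] that by (auto simp: fibre_def)
    moreover have "\<tau>0 \<notin> t ` ?K"
    proof
      assume "\<tau>0 \<in> t ` ?K"
      then obtain y where "y \<in> ?K" "t y = \<tau>0" by blast
      then show False using N(2)[of y] by (auto simp: fibre_def)
    qed
    ultimately show ?thesis using B(2) by auto
  qed
  ultimately obtain r where r: "r > 0" "ball \<tau>0 r \<subseteq> ?\<Omega>" by (meson openE)
  define s where "s x \<tau> = inv_into (N x) t \<tau>" for x \<tau>
  have s: "s x \<tau> \<in> N x" "t (s x \<tau>) = \<tau>" if "x \<in> ?E" "\<tau> \<in> ball \<tau>0 r" for x \<tau>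
    using that r(2) by (auto simp: s_def intro!: inv_into_into f_inv_into_f)
  show ?thesis
  proof
    show "finite ?E" "r > 0" by fact+
    show "ball \<tau>0 r \<inter> B = {}" using r(2) by blast
  next
    fix \<tau> assume \<tau>: "\<tau> \<in> ball \<tau>0 r"
    show "bij_betw (\<lambda>x. s x \<tau>) ?E (fibre \<tau>)"
      unfolding bij_betw_def
    proof (intro conjI equalityI subsetI)
      show "inj_on (\<lambda>x. s x \<tau>) ?E"
      proof (rule inj_onI, rule ccontr)
        fix x y assume *: "x \<in> ?E" "y \<in> ?E" "s x \<tau> = s y \<tau>" "x \<noteq> y"
        then have "s x \<tau> \<in> V x \<inter> V y" using s(1)[OF _ \<tau>] N(3) by (metis IntD1 IntI subsetD)
        then show False using Vd * by blast
      qed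
    next
      fix y assume "y \<in> (\<lambda>x. s x \<tau>) ` ?E"
      then show "y \<in> fibre \<tau>" using s[OF _ \<tau>] N(3) by (fastforce simp: fibre_def)
    next
      fix y assume y: "y \<in> fibre \<tau>"
      have "norm \<tau> \<le> norm \<tau>0 + 1"
        using r(2) \<tau> norm_triangle_ineq2[of \<tau> \<tau>0] by (force simp: dist_norm norm_minus_commute)
      moreover have "\<tau> \<notin> t ` ?K" using \<tau> r(2) by blast
      ultimately obtain x where x: "x \<in> ?E" "y \<in> N x" using y by (auto simp: fibre_def)
      have "y = s x \<tau>"
        by (rule inj_onD[OF N(4)[OF x(1)]]) (use y x s[OF x(1) \<tau>] in \<open>auto simp: fibre_def\<close>)
      then show "y \<in> (\<lambda>x. s x \<tau>) ` ?E" using x by blast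
    qed
  next
    fix x u assume x: "x \<in> ?E" and u: "\<And>y. y \<in> U \<Longrightarrow> hol_at A u y"
    show "(\<lambda>\<tau>. u (s x \<tau>)) holomorphic_on ball \<tau>0 r"
      unfolding holomorphic_on_def
    proof
      fix \<tau> assume \<tau>: "\<tau> \<in> ball \<tau>0 r"
      have "s x \<tau> \<in> U" using s(1)[OF x \<tau>] N(3)[OF x] by blast
      from Nh[OF x s(1)[OF x \<tau>] u[OF this]] have "(u \<circ> inv_into (N x) t) field_differentiable (at \<tau>)"
        by (simp add: s(2)[OF x \<tau>])
      then show "(\<lambda>\<tau>. u (s x \<tau>)) field_differentiable (at \<tau> within ball \<tau>0 r)"
        by (simp add: s_def o_def field_differentiable_at_within)
    qed
  qed
qed

text \<open>The norm of \<open>T - u\<close> over \<open>\<tau>\<close> is the product of the factors \<open>T - u y\<close> over the fibre. By the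
  description of nearby fibres its degree \<open>m\<close> is locally constant, hence constant on the connected
  complement of \<open>B\<close>, and its coefficients are holomorphic there. The coefficient of \<open>T ^ k\<close> is bounded by
  a multiple of \<open>(1 + norm \<tau>) ^ (m - k)\<close>, so it is a polynomial in \<open>\<tau>\<close> of degree at most \<open>m - k\<close>.
  Finally \<open>u x\<close> is a root of the norm over \<open>t x\<close>.\<close>

theorem algebraic_relation:
  assumes B: "finite B" and reg: "\<And>x. x \<in> U \<Longrightarrow> t x \<notin> B \<Longrightarrow> locally_injective_at t x"
    and u: "\<And>x. x \<in> U \<Longrightarrow> hol_at A u x"
    and growth: "\<And>x. x \<in> U \<Longrightarrow> norm (u x) \<le> C * (1 + norm (t x))" and C: "0 \<le> C"
  obtains m a where "a m 0 = 1"
    "\<And>x. x \<in> U \<Longrightarrow> t x \<notin> B \<Longrightarrow> (\<Sum>k\<le>m. (\<Sum>j\<le>m-k. a k j * t x ^ j) * u x ^ k) = 0"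
proof -
  have clB: "closed B" using B by (rule finite_imp_closed)
  have cover: "\<exists>r s. finite (fibre \<tau>0) \<and> r > 0 \<and> ball \<tau>0 r \<inter> B = {} \<and>
      (\<forall>\<tau>\<in>ball \<tau>0 r. bij_betw (\<lambda>x. s x \<tau>) (fibre \<tau>0) (fibre \<tau>)) \<and>
      (\<forall>x\<in>fibre \<tau>0. (\<lambda>\<tau>. u (s x \<tau>)) holomorphic_on ball \<tau>0 r)" if \<tau>0: "\<tau>0 \<notin> B" for \<tau>0
  proof -
    have "\<And>x. x \<in> fibre \<tau>0 \<Longrightarrow> locally_injective_at t x" using reg \<tau>0 by (auto simp: fibre_def)
    from evenly_covered[OF this clB \<tau>0] u show ?thesis by metis
  qed
  have fin: "finite (fibre \<tau>)" if "\<tau> \<notin> B" for \<tau> using cover[OF that] by blast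
  have "connected (- B)"
    using path_connected_complement_countable[of B] B by (simp add: countable_finite path_connected_imp_connected)
  then have "(\<lambda>\<tau>. card (fibre \<tau>)) constant_on (- B)"
  proof (rule locally_constant_imp_constant)
    fix \<tau>0 assume "\<tau>0 \<in> - B"
    then obtain r s where rs: "r > 0" "ball \<tau>0 r \<inter> B = {}" "\<forall>\<tau>\<in>ball \<tau>0 r. bij_betw (\<lambda>x. s x \<tau>) (fibre \<tau>0) (fibre \<tau>)"
      using cover by blast
    have "openin (top_of_set (- B)) (ball \<tau>0 r)"
      by (rule open_subset) (use rs in auto)
    moreover have "\<forall>\<tau>\<in>ball \<tau>0 r. card (fibre \<tau>) = card (fibre \<tau>0)"
      using rs(3) bij_betw_same_card by metis
    ultimately show "\<exists>T. openin (top_of_set (- B)) T \<and> \<tau>0 \<in> T \<and> (\<forall>\<tau>\<in>T. card (fibre \<tau>) = card (fibre \<tau>0))"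
      using rs(1) by (metis centre_in_ball)
  qed
  then obtain m where m: "\<And>\<tau>. \<tau> \<notin> B \<Longrightarrow> card (fibre \<tau>) = m" by (auto simp: constant_on_def)
  define q where "q \<tau> = (\<Prod>x\<in>fibre \<tau>. [:- u x, 1:])" for \<tau>
  have hol: "(\<lambda>\<tau>. Polynomial.coeff (q \<tau>) k) holomorphic_on - B" for k
    unfolding holomorphic_on_def
  proof
    fix \<tau>0 assume "\<tau>0 \<in> - B"
    then obtain r s where rs: "finite (fibre \<tau>0)" "r > 0"
      "\<forall>\<tau>\<in>ball \<tau>0 r. bij_betw (\<lambda>x. s x \<tau>) (fibre \<tau>0) (fibre \<tau>)"
      "\<forall>x\<in>fibre \<tau>0. (\<lambda>\<tau>. u (s x \<tau>)) holomorphic_on ball \<tau>0 r"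
      using cover by blast
    have "(\<lambda>\<tau>. Polynomial.coeff (\<Prod>x\<in>fibre \<tau>0. [:- u (s x \<tau>), 1:]) k) holomorphic_on ball \<tau>0 r"
      by (rule holomorphic_on_coeff_prod_linear) (use rs in auto)
    then have "(\<lambda>\<tau>. Polynomial.coeff (q \<tau>) k) holomorphic_on ball \<tau>0 r"
    proof (rule holomorphic_transform)
      fix \<tau> assume "\<tau> \<in> ball \<tau>0 r"
      then have "bij_betw (\<lambda>x. s x \<tau>) (fibre \<tau>0) (fibre \<tau>)" using rs by blast
      then show "Polynomial.coeff (\<Prod>x\<in>fibre \<tau>0. [:- u (s x \<tau>), 1:]) k = Polynomial.coeff (q \<tau>) k"
        unfolding q_def by (subst prod.reindex_bij_betw[symmetric]) auto
    qed
    then have "(\<lambda>\<tau>. Polynomial.coeff (q \<tau>) k) field_differentiable (at \<tau>0)"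
      by (rule holomorphic_on_imp_differentiable_at) (use rs in auto)
    then show "(\<lambda>\<tau>. Polynomial.coeff (q \<tau>) k) field_differentiable (at \<tau>0 within - B)"
      by (rule field_differentiable_at_within)
  qed
  have bound: "norm (Polynomial.coeff (q \<tau>) k) \<le> (2 ^ m * C ^ (m - k)) * (1 + norm \<tau>) ^ (m - k)"
    if "\<tau> \<notin> B" "k \<le> m" for \<tau> k
  proof -
    have "norm (Polynomial.coeff (q \<tau>) k) \<le> 2 ^ card (fibre \<tau>) * (C * (1 + norm \<tau>)) ^ (card (fibre \<tau>) - k)"
      unfolding q_def
      by (rule coeff_prod_linear_bound)
         (use that m fin growth C in \<open>auto simp: fibre_def intro!: mult_nonneg_nonneg add_nonneg_nonneg\<close>)
    then show ?thesis using m[OF that(1)] by (simp add: power_mult_distrib mult.assoc)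
  qed
  have "\<forall>k\<in>{..m}. \<exists>b. \<forall>\<tau>. \<tau> \<notin> B \<longrightarrow> Polynomial.coeff (q \<tau>) k = (\<Sum>j\<le>m-k. b j * \<tau> ^ j)"
  proof
    fix k assume "k \<in> {..m}"
    then have "k \<le> m" by simp
    from holomorphic_poly_growth[OF B hol[of k] bound[OF _ this]]
    show "\<exists>b. \<forall>\<tau>. \<tau> \<notin> B \<longrightarrow> Polynomial.coeff (q \<tau>) k = (\<Sum>j\<le>m-k. b j * \<tau> ^ j)" by blast
  qed
  from bchoice[OF this] obtain a where
    "\<forall>k\<in>{..m}. \<forall>\<tau>. \<tau> \<notin> B \<longrightarrow> Polynomial.coeff (q \<tau>) k = (\<Sum>j\<le>m-k. a k j * \<tau> ^ j)" ..
  then have a: "\<And>k \<tau>. k \<le> m \<Longrightarrow> \<tau> \<notin> B \<Longrightarrow> Polynomial.coeff (q \<tau>) k = (\<Sum>j\<le>m-k. a k j * \<tau> ^ j)"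
    by simp
  show ?thesis
  proof
    obtain \<tau> where \<tau>: "\<tau> \<notin> B" using B ex_new_if_finite infinite_UNIV_char_0 by blast
    have "Polynomial.coeff (q \<tau>) m = 1"
      using prod_linear_monic(2)[OF fin[OF \<tau>], of u] m[OF \<tau>] by (simp add: q_def)
    then show "a m 0 = 1" using a[of m \<tau>] \<tau> by simp
  next
    fix x assume x: "x \<in> U" "t x \<notin> B"
    have "poly (q (t x)) (u x) = 0"
      unfolding q_def poly_prod using fin[OF x(2)] x(1) by (auto simp: fibre_def intro!: prod_zero)
    moreover have "Polynomial.degree (q (t x)) = m"
      using prod_linear_monic(1)[OF fin[OF x(2)], of u] m[OF x(2)] by (simp add: q_def)
    ultimately show "(\<Sum>k\<le>m. (\<Sum>j\<le>m-k. a k j * t x ^ j) * u x ^ k) = 0"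
      using a x(2) by (simp add: poly_altdef)
  qed
qed

end

section \<open>Chow's theorem for maps to projective space\<close>

text \<open>
  A holomorphic map to projective space, given by local lifts to coordinate vectors that depend
  holomorphically on the point.\<close>

locale projective_map = riemann_surface +
  fixes n :: nat and F :: "'a \<Rightarrow> (nat \<Rightarrow> complex) set"
  assumes local_lift: "\<And>x. x \<in> topspace X \<Longrightarrow> \<exists>W v. openin X W \<and> x \<in> W \<and>
      (\<forall>y\<in>W. v y \<in> hom_coords n \<and> F y = proj_point (v y) \<and> (\<forall>j. hol_at A (\<lambda>x. v x j) y))"
begin

text \<open>An arbitrary coordinate vector of \<open>F x\<close>, with no regularity in \<open>x\<close>. It serves only in expressions
  that are invariant under scaling, and these can be computed with a local lift instead.\<close>

definition rep :: "'a \<Rightarrow> nat \<Rightarrow> complex" where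
  "rep x = (SOME v. v \<in> F x)"

lemma F_in_proj_space: "x \<in> topspace X \<Longrightarrow> F x \<in> proj_space n"
  using local_lift proj_point_in_proj_space by metis

lemma rep:
  assumes "x \<in> topspace X"
  shows "rep x \<in> F x" "rep x \<in> hom_coords n" "F x = proj_point (rep x)"
proof -
  obtain w where "F x = proj_point w" using F_in_proj_space[OF assms] by (auto simp: proj_space_def)
  then have "w \<in> F x" by simp
  then have "\<exists>v. v \<in> F x" by blast
  then show "rep x \<in> F x" unfolding rep_def by (rule someI_ex)
  then show "rep x \<in> hom_coords n" "F x = proj_point (rep x)"
    using proj_space_rep F_in_proj_space[OF assms] by blast+
qed

lemma rep_scale:
  assumes "x \<in> topspace X" "v \<in> F x"
  obtains c where "c \<noteq> 0" "rep x = (\<lambda>i. c * v i)"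
proof -
  have "F x = proj_point v" using assms F_in_proj_space proj_space_rep by blast
  then have "rep x \<in> proj_point v" using rep[OF assms(1)] by simp
  then show ?thesis using that by (auto simp: proj_point_def)
qed

lemma form_lift_hol:
  assumes "\<phi> \<in> forms n d" "\<And>j. hol_at A (\<lambda>x. v x j) y"
  shows "hol_at A (\<lambda>x. \<phi> (v x)) y"
  using assms by (auto simp: forms_def poly_value_def intro!: hol_at_intros)

lemma form_rep_zero_iff:
  assumes "\<phi> \<in> forms n d" "x \<in> topspace X" "v \<in> F x"
  shows "\<phi> (rep x) = 0 \<longleftrightarrow> \<phi> v = 0"
  using rep_scale[OF assms(2,3)] forms_scale_arg[OF assms(1)] by (metis mult_eq_0_iff power_not_zero)

lemma form_zeros_finite_or_all:
  assumes \<phi>: "\<phi> \<in> forms n d"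
  shows "finite {x \<in> topspace X. \<phi> (rep x) = 0} \<or> (\<forall>x\<in>topspace X. \<phi> (rep x) = 0)"
proof -
  let ?Z = "{x \<in> topspace X. \<phi> (rep x) = 0}"
  have "finite ?Z \<or> ?Z = topspace X"
  proof (rule analytic_subset_finite_or_all)
    fix x assume "x \<in> topspace X"
    then obtain W v where W: "openin X W" "x \<in> W"
      "\<And>y. y \<in> W \<Longrightarrow> v y \<in> hom_coords n \<and> F y = proj_point (v y) \<and> (\<forall>j. hol_at A (\<lambda>x. v x j) y)"
      using local_lift by metis
    have "y \<in> ?Z \<longleftrightarrow> \<phi> (v y) = 0" if "y \<in> W" for y
      using form_rep_zero_iff[OF \<phi>, of y "v y"] W(3) that openin_subset[OF W(1)] by auto
    moreover have "hol_at A (\<lambda>x. \<phi> (v x)) y" if "y \<in> W" for y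
      using form_lift_hol[OF \<phi>] W(3)[OF that] by blast
    ultimately show "\<exists>W h. openin X W \<and> x \<in> W \<and> (\<forall>y\<in>W. hol_at A h y) \<and> (\<forall>y\<in>W. y \<in> ?Z \<longleftrightarrow> h y = 0)"
      using W(1,2) by (intro exI[of _ W] exI[of _ "\<lambda>x. \<phi> (v x)"]) blast
  qed auto
  then show ?thesis by blast
qed

lemma tendsto_scale_invariant:
  fixes \<Phi> :: "(nat \<Rightarrow> complex) \<Rightarrow> 'b::topological_space"
  assumes inv: "\<And>c v. c \<noteq> 0 \<Longrightarrow> \<Phi> (\<lambda>i. c * v i) = \<Phi> v"
    and x: "x \<in> topspace X"
    and lim: "\<And>v. v x \<in> F x \<Longrightarrow> (\<And>j. hol_at A (\<lambda>x. v x j) x) \<Longrightarrow> ((\<lambda>y. \<Phi> (v y)) \<longlongrightarrow> \<Phi> (v x)) (nhdsin X x)"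
  shows "((\<lambda>y. \<Phi> (rep y)) \<longlongrightarrow> \<Phi> (rep x)) (nhdsin X x)"
proof -
  obtain W v where W: "openin X W" "x \<in> W"
    "\<And>y. y \<in> W \<Longrightarrow> v y \<in> hom_coords n \<and> F y = proj_point (v y) \<and> (\<forall>j. hol_at A (\<lambda>x. v x j) y)"
    using local_lift[OF x] by metis
  have eq: "\<Phi> (v y) = \<Phi> (rep y)" if "y \<in> W" for y
  proof -
    have "y \<in> topspace X" "v y \<in> F y" using that W(3) openin_subset[OF W(1)] by auto
    then show ?thesis using rep_scale inv by metis
  qed
  have "((\<lambda>y. \<Phi> (v y)) \<longlongrightarrow> \<Phi> (v x)) (nhdsin X x)"
    using W by (intro lim) auto
  moreover have "eventually (\<lambda>y. \<Phi> (v y) = \<Phi> (rep y)) (nhdsin X x)"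
    using W eq unfolding eventually_nhdsin by blast
  ultimately show ?thesis
    using eq[OF W(2)] by (simp add: tendsto_cong)
qed

lemma hol_at_ratio:
  assumes \<phi>: "\<phi> \<in> forms n d" and \<psi>: "\<psi> \<in> forms n d" and x: "x \<in> topspace X" "\<psi> (rep x) \<noteq> 0"
  shows "hol_at A (\<lambda>x. \<phi> (rep x) / \<psi> (rep x)) x"
proof -
  obtain W v where W: "openin X W" "x \<in> W"
    "\<And>y. y \<in> W \<Longrightarrow> v y \<in> hom_coords n \<and> F y = proj_point (v y) \<and> (\<forall>j. hol_at A (\<lambda>x. v x j) y)"
    using local_lift[OF x(1)] by metis
  have "\<psi> (v x) \<noteq> 0" using form_rep_zero_iff[OF \<psi> x(1), of "v x"] x(2) W by auto
  then have "hol_at A (\<lambda>x. \<phi> (v x) / \<psi> (v x)) x"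
    using W by (intro hol_at_divide form_lift_hol[OF \<phi>] form_lift_hol[OF \<psi>]) auto
  then show ?thesis
  proof (rule hol_at_transform[OF _ W(1,2)])
    fix y assume y: "y \<in> W"
    then have "y \<in> topspace X" "v y \<in> F y" using W(3) openin_subset[OF W(1)] by auto
    then obtain c where "c \<noteq> 0" "rep y = (\<lambda>i. c * v y i)" by (rule rep_scale)
    then show "\<phi> (v y) / \<psi> (v y) = \<phi> (rep y) / \<psi> (rep y)"
      using forms_scale_arg[OF \<phi>] forms_scale_arg[OF \<psi>] by simp
  qed
qed

text \<open>If a linear form had no zero on the image, the quotients of the coordinates by this form would be
  holomorphic on the whole surface, hence constant, and \<open>F\<close> would be constant.\<close>

lemma linear_form_has_zero:
  assumes inj: "inj_on F (topspace X)" and \<psi>: "\<psi> \<in> forms n 1"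
  shows "\<exists>x\<in>topspace X. \<psi> (rep x) = 0"
proof (rule ccontr)
  assume "\<not> ?thesis"
  then have nz: "\<psi> (rep x) \<noteq> 0" if "x \<in> topspace X" for x
    using that by blast
  have "\<exists>c. \<forall>x\<in>topspace X. rep x j / \<psi> (rep x) = c" if j: "j \<le> n" for j
  proof -
    have "hol_at A (\<lambda>x. rep x j / \<psi> (rep x)) x" if "x \<in> topspace X" for x
      by (rule hol_at_ratio[OF forms_coord[OF j] \<psi> that nz[OF that]])
    then obtain c where "\<And>x. x \<in> topspace X \<Longrightarrow> rep x j / \<psi> (rep x) = c"
      using hol_on_X_constant by blast
    then show ?thesis by blast
  qed
  then obtain k where k: "\<And>j x. j \<le> n \<Longrightarrow> x \<in> topspace X \<Longrightarrow> rep x j / \<psi> (rep x) = k j" by metis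
  have same: "F x = F y" if "x \<in> topspace X" "y \<in> topspace X" for x y
  proof -
    have e: "rep x i = k i * \<psi> (rep x)" if "x \<in> topspace X" "i \<le> n" for i x
      using k[OF that(2,1)] nz[OF that(1)] by (simp add: field_simps)
    have "proj_point (rep x) = proj_point (rep y)"
      unfolding proj_point_eq_iff[OF rep(2)[OF that(1)] rep(2)[OF that(2)]] using that by (simp add: e)
    then show ?thesis using rep(3) that by metis
  qed
  obtain x where "x \<in> topspace X" using nonempty_X by blast
  then have "topspace X \<subseteq> {x}" using same inj_onD[OF inj] by blast
  moreover have "infinite (topspace X)" using infinite_open[OF openin_topspace \<open>x \<in> topspace X\<close>] .
  ultimately show False using finite_subset by blast
qed

end

text \<open>
  The function \<open>\<phi> / \<psi>\<close> is the composition of \<open>F\<close> with the projection to the projective line that the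
  two forms define; it is defined on the whole surface because they have no common zero. Its poles
  are the zeros of \<open>\<psi>\<close>.\<close>

locale regular_pencil = projective_map +
  fixes \<phi> \<psi> :: "(nat \<Rightarrow> complex) \<Rightarrow> complex"
  assumes inj_F: "inj_on F (topspace X)"
    and \<phi>: "\<phi> \<in> forms n 1" and \<psi>: "\<psi> \<in> forms n 1"
    and no_common_zero: "\<And>x. x \<in> topspace X \<Longrightarrow> \<phi> (rep x) \<noteq> 0 \<or> \<psi> (rep x) \<noteq> 0"
    and finite_poles: "finite {x \<in> topspace X. \<psi> (rep x) = 0}"
begin

definition finite_part :: "'a set" where "finite_part = {x \<in> topspace X. \<psi> (rep x) \<noteq> 0}"
definition ratio :: "'a \<Rightarrow> complex" where "ratio x = \<phi> (rep x) / \<psi> (rep x)"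

lemma open_nonzero:
  assumes "finite {x \<in> topspace X. \<xi> (rep x) = 0}"
  shows "openin X {x \<in> topspace X. \<xi> (rep x) \<noteq> 0}"
proof -
  have "closedin X {x \<in> topspace X. \<xi> (rep x) = 0}"
    by (rule closedin_Hausdorff_finite[OF Hausdorff_X]) (use assms in auto)
  moreover have "{x \<in> topspace X. \<xi> (rep x) \<noteq> 0} = topspace X - {x \<in> topspace X. \<xi> (rep x) = 0}" by blast
  ultimately show ?thesis using openin_diff[OF openin_topspace] by metis
qed

text \<open>At a zero of \<open>\<psi>\<close>, which exists, \<open>\<phi>\<close> is nonzero. So \<open>\<phi> - c * \<psi>\<close> does not vanish identically.\<close>

lemma fibre_form_finite: "finite {x \<in> topspace X. \<phi> (rep x) - c * \<psi> (rep x) = 0}"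
proof -
  have f: "(\<lambda>v. \<phi> v + (- c) * \<psi> v) \<in> forms n 1" by (intro forms_add forms_cmult \<phi> \<psi>)
  obtain x where x: "x \<in> topspace X" "\<psi> (rep x) = 0"
    using linear_form_has_zero[OF inj_F \<psi>] by blast
  then have "\<phi> (rep x) + (- c) * \<psi> (rep x) \<noteq> 0" using no_common_zero[OF x(1)] by simp
  then show ?thesis using form_zeros_finite_or_all[OF f] x(1) by auto
qed

text \<open>Near a pole the ratio is unbounded, so its sublevel sets stay away from the poles. To see this on
  the whole surface at once, they are written as sublevel sets of
  \<open>(norm \<phi> - R * norm \<psi>) / (norm \<phi> + norm \<psi>)\<close>, which is continuous at the poles as well.\<close>

lemma ratio_proper: "closedin X {x \<in> finite_part. norm (ratio x) \<le> R}"
proof -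
  let ?\<Phi> = "\<lambda>v. (norm (\<phi> v) - R * norm (\<psi> v)) / (norm (\<phi> v) + norm (\<psi> v))"
  have "continuous_map X euclidean (\<lambda>x. ?\<Phi> (rep x))"
  proof (rule continuous_map_nhdsinI)
    fix x assume x: "x \<in> topspace X"
    show "((\<lambda>y. ?\<Phi> (rep y)) \<longlongrightarrow> ?\<Phi> (rep x)) (nhdsin X x)"
    proof (rule tendsto_scale_invariant[of ?\<Phi>, OF _ x])
      fix c :: complex and v :: "nat \<Rightarrow> complex" assume "c \<noteq> 0"
      moreover have "?\<Phi> (\<lambda>i. c * v i) = (norm c * (norm (\<phi> v) - R * norm (\<psi> v))) / (norm c * (norm (\<phi> v) + norm (\<psi> v)))"
        by (simp add: forms_scale_arg[OF \<phi>] forms_scale_arg[OF \<psi>] norm_mult distrib_left right_diff_distrib mult.left_commute)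
      ultimately show "?\<Phi> (\<lambda>i. c * v i) = ?\<Phi> v"
        by (simp only: mult_divide_mult_cancel_left norm_eq_zero simp_thms)
    next
      fix v assume v: "v x \<in> F x" "\<And>j. hol_at A (\<lambda>x. v x j) x"
      have "norm (\<phi> (v x)) + norm (\<psi> (v x)) \<noteq> 0"
        using no_common_zero[OF x] form_rep_zero_iff[OF \<phi> x v(1)] form_rep_zero_iff[OF \<psi> x v(1)]
        by (auto simp: add_nonneg_eq_0_iff)
      then show "((\<lambda>y. ?\<Phi> (v y)) \<longlongrightarrow> ?\<Phi> (v x)) (nhdsin X x)"
        by (intro tendsto_intros hol_at_tendsto form_lift_hol[OF \<phi>] form_lift_hol[OF \<psi>] v x)
    qed
  qed
  then have "closedin X {x \<in> topspace X. ?\<Phi> (rep x) \<in> {..0}}"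
    by (rule closedin_continuous_map_preimage) simp
  moreover have "{x \<in> topspace X. ?\<Phi> (rep x) \<in> {..0}} = {x \<in> finite_part. norm (ratio x) \<le> R}"
  proof -
    have "?\<Phi> (rep x) \<in> {..0} \<longleftrightarrow> \<psi> (rep x) \<noteq> 0 \<and> norm (ratio x) \<le> R" if x: "x \<in> topspace X" for x
    proof -
      have pos: "0 < norm (\<phi> (rep x)) + norm (\<psi> (rep x))"
        using no_common_zero[OF x] by (auto simp: add_pos_nonneg add_nonneg_pos)
      then have "?\<Phi> (rep x) \<in> {..0} \<longleftrightarrow> norm (\<phi> (rep x)) \<le> R * norm (\<psi> (rep x))"
        by (simp add: divide_le_0_iff)
      also have "\<dots> \<longleftrightarrow> \<psi> (rep x) \<noteq> 0 \<and> norm (ratio x) \<le> R"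
        using pos by (cases "\<psi> (rep x) = 0") (auto simp: ratio_def norm_divide pos_divide_le_eq)
      finally show ?thesis .
    qed
    then show ?thesis by (auto simp: finite_part_def)
  qed
  ultimately show ?thesis by simp
qed

sublocale proper_function X A finite_part ratio
proof
  show "openin X finite_part" unfolding finite_part_def by (rule open_nonzero[OF finite_poles])
  show "hol_at A ratio x" if "x \<in> finite_part" for x
    using hol_at_ratio[OF \<phi> \<psi>, of x] that by (simp add: finite_part_def ratio_def[abs_def])
  show "closedin X {x \<in> finite_part. norm (ratio x) \<le> R}" for R by (rule ratio_proper)
qed

lemma locally_injective_at_inverse:
  assumes W: "openin X W" "x \<in> W" and eq: "\<And>y. y \<in> W \<Longrightarrow> g y = inverse (f y)"
  shows "locally_injective_at f x \<longleftrightarrow> locally_injective_at g x"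
proof -
  have "locally_injective_at g x" if li: "locally_injective_at f x" and eq: "\<And>y. y \<in> W \<Longrightarrow> g y = inverse (f y)" for f g
  proof -
    obtain N where N: "openin X N" "x \<in> N" "inj_on f N" using li by (auto simp: locally_injective_at_def)
    have "inj_on g (N \<inter> W)"
      using N(3) eq by (auto simp: inj_on_def)
    then show ?thesis unfolding locally_injective_at_def using N W by (intro exI[of _ "N \<inter> W"]) auto
  qed
  from this[of f g] this[of g f] eq show ?thesis by auto
qed

lemma derivative_hol_at:
  assumes S: "openin X S" and t: "\<And>y. y \<in> S \<Longrightarrow> hol_at A t y" and c: "(V, z) \<in> A" and x: "x \<in> V \<inter> S"
  shows "\<exists>W h. openin X W \<and> x \<in> W \<and> W \<subseteq> S \<and> (\<forall>y\<in>W. hol_at A h y) \<and> (\<forall>y\<in>W. \<not> locally_injective_at t y \<longleftrightarrow> h y = 0)"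
proof -
  let ?g = "t \<circ> inv_into V z"
  have W: "openin X (V \<inter> S)" using S chart_openin[OF c] by blast
  have hol: "?g holomorphic_on z ` (V \<inter> S)" by (rule hol_on_chart[OF t S c])
  have op: "open (z ` (V \<inter> S))" by (rule chart_image_open[OF c S])
  have "hol_at A (\<lambda>y. deriv ?g (z y)) y" if "y \<in> V \<inter> S" for y
    by (intro hol_at_compose[OF hol_at_chart[OF c]] holomorphic_on_imp_differentiable_at[OF holomorphic_deriv[OF hol op] op])
       (use that in blast)+
  moreover have "\<not> locally_injective_at t y \<longleftrightarrow> deriv ?g (z y) = 0" if "y \<in> V \<inter> S" for y
    using locally_injective_at_iff[OF S _ t c] that by blast
  ultimately show ?thesis
    using W x by (intro exI[of _ "V \<inter> S"] exI[of _ "\<lambda>y. deriv ?g (z y)"]) blast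
qed

text \<open>The ratio is a holomorphic map to the projective line, and its critical points form an analytic
  subset: near a pole they are the critical points of the inverse ratio. If all points
  were critical, the ratio would be constant on an open set, whereas its fibres are finite.\<close>

lemma finite_critical_points: "finite {x \<in> finite_part. \<not> locally_injective_at ratio x}"
proof -
  let ?s = "\<lambda>x. \<psi> (rep x) / \<phi> (rep x)"
  let ?S = "{x \<in> topspace X. \<phi> (rep x) \<noteq> 0}"
  let ?Z = "{x \<in> finite_part. \<not> locally_injective_at ratio x} \<union> {x \<in> topspace X - finite_part. \<not> locally_injective_at ?s x}"
  have openS: "openin X ?S"
    by (rule open_nonzero) (use fibre_form_finite[of 0] in simp)
  have hs: "hol_at A ?s y" if "y \<in> ?S" for y using hol_at_ratio[OF \<psi> \<phi>, of y] that by simp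
  have "finite ?Z \<or> ?Z = topspace X"
  proof (rule analytic_subset_finite_or_all)
    show "?Z \<subseteq> topspace X" by (auto simp: finite_part_def)
    fix x assume x: "x \<in> topspace X"
    then obtain V z where c: "(V, z) \<in> A" "x \<in> V" by (rule chart_at)
    show "\<exists>W h. openin X W \<and> x \<in> W \<and> (\<forall>y\<in>W. hol_at A h y) \<and> (\<forall>y\<in>W. y \<in> ?Z \<longleftrightarrow> h y = 0)"
    proof (cases "x \<in> finite_part")
      case True
      then have "x \<in> V \<inter> finite_part" using c by blast
      from derivative_hol_at[OF open_U hol_t c(1) this] obtain W h where
        W: "openin X W" "x \<in> W" "W \<subseteq> finite_part" "\<forall>y\<in>W. hol_at A h y" "\<forall>y\<in>W. \<not> locally_injective_at ratio y \<longleftrightarrow> h y = 0"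
        by blast
      have "y \<in> ?Z \<longleftrightarrow> h y = 0" if "y \<in> W" for y using W(3,5) that by blast
      then show ?thesis using W by blast
    next
      case False
      then have "x \<in> V \<inter> ?S" using c x no_common_zero[OF x] by (auto simp: finite_part_def)
      from derivative_hol_at[OF openS hs c(1) this] obtain W h where
        W: "openin X W" "x \<in> W" "W \<subseteq> ?S" "\<forall>y\<in>W. hol_at A h y" "\<forall>y\<in>W. \<not> locally_injective_at ?s y \<longleftrightarrow> h y = 0"
        by blast
      have "y \<in> ?Z \<longleftrightarrow> h y = 0" if y: "y \<in> W" for y
      proof (cases "y \<in> finite_part")
        case True
        have "locally_injective_at ?s y \<longleftrightarrow> locally_injective_at ratio y"
          by (rule locally_injective_at_inverse[of "finite_part \<inter> W"]) (use True y W open_U in \<open>auto simp: ratio_def\<close>)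
        then show ?thesis using True W(5) y by blast
      next
        case False
        then show ?thesis using W(3,5) y by blast
      qed
      then show ?thesis using W by blast
    qed
  qed
  moreover have "?Z \<noteq> topspace X"
  proof
    assume all: "?Z = topspace X"
    have "infinite (topspace X)" using infinite_open[OF openin_topspace] nonempty_X by blast
    then have "\<not> topspace X \<subseteq> {x \<in> topspace X. \<psi> (rep x) = 0}" using finite_poles finite_subset by blast
    then obtain x where x: "x \<in> finite_part" by (auto simp: finite_part_def)
    then obtain V z where c: "(V, z) \<in> A" "x \<in> V" using chart_at U_subset by blast
    obtain r where r: "r > 0" "ball (z x) r \<subseteq> z ` (V \<inter> finite_part)" using chart_disc[OF c(1) open_U c(2) x] .
    let ?g = "ratio \<circ> inv_into V z" and ?B = "ball (z x) r"
    have hol: "?g holomorphic_on ?B"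
      using hol_on_chart[OF hol_t open_U c(1)] r(2) holomorphic_on_subset by blast
    have "deriv ?g w = 0" if w: "w \<in> ?B" for w
    proof -
      obtain y where y: "y \<in> V" "y \<in> finite_part" "w = z y" using w r by blast
      then have "\<not> locally_injective_at ratio y" using all U_subset by blast
      then show ?thesis using locally_injective_at_iff[OF open_U y(2) hol_t c(1) y(1)] y(3) by blast
    qed
    then have "\<And>w. w \<in> ?B \<Longrightarrow> (?g has_field_derivative 0) (at w)"
      using holomorphic_derivI[OF hol open_ball] by metis
    then have "?g constant_on ?B"
      using has_field_derivative_0_imp_constant_on open_ball connected_ball by blast
    then obtain k where k: "\<And>w. w \<in> ?B \<Longrightarrow> ?g w = k" by (auto simp: constant_on_def)
    have "k = ratio x" using k[of "z x"] r(1) c by simp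
    then have const: "?g w = ratio x" if "w \<in> ?B" for w using k[OF that] by simp
    have "{y \<in> V. z y \<in> ?B} \<subseteq> {y \<in> topspace X. \<phi> (rep y) - ratio x * \<psi> (rep y) = 0}"
    proof clarify
      fix y assume y: "y \<in> V" "z y \<in> ?B"
      then have "y \<in> finite_part" using disc_preimage_subset[OF c(1) r(2)] by blast
      moreover have "ratio y = ratio x" using const[OF y(2)] c(1) y(1) by simp
      ultimately show "y \<in> topspace X \<and> \<phi> (rep y) - ratio x * \<psi> (rep y) = 0"
        by (auto simp: ratio_def[of y] finite_part_def nonzero_divide_eq_eq)
    qed
    moreover have "infinite {y \<in> V. z y \<in> ?B}"
      by (rule infinite_open[OF chart_preimage_open[OF c(1)], of _ x]) (use c r in auto)
    ultimately show False using fibre_form_finite[of "ratio x"] finite_subset by blast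
  qed
  ultimately show ?thesis by (metis (no_types, lifting) finite_Un)
qed

text \<open>The quotient of the two sides is continuous on a compact space.\<close>

lemma form_bound:
  assumes \<xi>: "\<xi> \<in> forms n 1"
  obtains C where "0 \<le> C" "\<And>x. x \<in> topspace X \<Longrightarrow> norm (\<xi> (rep x)) \<le> C * (norm (\<psi> (rep x)) + norm (\<phi> (rep x)))"
proof -
  let ?\<Phi> = "\<lambda>v. norm (\<xi> v) / (norm (\<psi> v) + norm (\<phi> v))"
  have "continuous_map X euclidean (\<lambda>x. ?\<Phi> (rep x))"
  proof (rule continuous_map_nhdsinI)
    fix x assume x: "x \<in> topspace X"
    show "((\<lambda>y. ?\<Phi> (rep y)) \<longlongrightarrow> ?\<Phi> (rep x)) (nhdsin X x)"
    proof (rule tendsto_scale_invariant[of ?\<Phi>, OF _ x])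
      fix c :: complex and v :: "nat \<Rightarrow> complex" assume "c \<noteq> 0"
      moreover have "?\<Phi> (\<lambda>i. c * v i) = (norm c * norm (\<xi> v)) / (norm c * (norm (\<psi> v) + norm (\<phi> v)))"
        by (simp add: forms_scale_arg[OF \<phi>] forms_scale_arg[OF \<psi>] forms_scale_arg[OF \<xi>] norm_mult distrib_left)
      ultimately show "?\<Phi> (\<lambda>i. c * v i) = ?\<Phi> v"
        by (simp only: mult_divide_mult_cancel_left norm_eq_zero simp_thms)
    next
      fix v assume v: "v x \<in> F x" "\<And>j. hol_at A (\<lambda>x. v x j) x"
      have "norm (\<psi> (v x)) + norm (\<phi> (v x)) \<noteq> 0"
        using no_common_zero[OF x] form_rep_zero_iff[OF \<phi> x v(1)] form_rep_zero_iff[OF \<psi> x v(1)]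
        by (auto simp: add_nonneg_eq_0_iff)
      then show "((\<lambda>y. ?\<Phi> (v y)) \<longlongrightarrow> ?\<Phi> (v x)) (nhdsin X x)"
        by (intro tendsto_intros hol_at_tendsto form_lift_hol[OF \<phi>] form_lift_hol[OF \<psi>] form_lift_hol[OF \<xi>] v x)
    qed
  qed
  then have "compact ((\<lambda>x. ?\<Phi> (rep x)) ` topspace X)"
    using image_compactin[of X "topspace X" euclidean] compact_X by (simp add: compact_space_def)
  then obtain C where C: "\<forall>y\<in>(\<lambda>x. ?\<Phi> (rep x)) ` topspace X. norm y \<le> C"
    using compact_imp_bounded bounded_iff by metis
  show ?thesis
  proof (rule that[of "max 0 C"])
    fix x assume x: "x \<in> topspace X"
    have pos: "0 < norm (\<psi> (rep x)) + norm (\<phi> (rep x))"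
      using no_common_zero[OF x] by (auto simp: add_pos_nonneg add_nonneg_pos)
    have "?\<Phi> (rep x) \<le> max 0 C" using C x by fastforce
    then show "norm (\<xi> (rep x)) \<le> max 0 C * (norm (\<psi> (rep x)) + norm (\<phi> (rep x)))"
      using pos by (simp add: pos_divide_le_eq)
  qed simp
qed

text \<open>This is the algebraic relation between \<open>\<xi> / \<psi>\<close> and \<open>\<phi> / \<psi>\<close>, multiplied by \<open>\<psi> ^ m\<close>. The degree
  bounds on its coefficients make it a form of degree \<open>m\<close>. The relation is known outside a finite set
  of points, and a form with infinitely many zeros on the image vanishes on the image. Where \<open>\<phi>\<close> and
  \<open>\<psi>\<close> vanish only the leading term \<open>\<xi> ^ m\<close> survives.\<close>

lemma monic_homogeneous_relation:
  assumes \<xi>: "\<xi> \<in> forms n 1"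
  obtains m Q where "Q \<in> forms n m" "\<And>x. x \<in> topspace X \<Longrightarrow> Q (rep x) = 0"
    "\<And>v. \<phi> v = 0 \<Longrightarrow> \<psi> v = 0 \<Longrightarrow> Q v = \<xi> v ^ m"
proof -
  let ?u = "\<lambda>x. \<xi> (rep x) / \<psi> (rep x)"
  let ?B = "ratio ` {x \<in> finite_part. \<not> locally_injective_at ratio x}"
  obtain C where C: "0 \<le> C" "\<And>x. x \<in> topspace X \<Longrightarrow> norm (\<xi> (rep x)) \<le> C * (norm (\<psi> (rep x)) + norm (\<phi> (rep x)))"
    using form_bound[OF \<xi>] by blast
  have growth: "norm (?u x) \<le> C * (1 + norm (ratio x))" if "x \<in> finite_part" for x
  proof -
    have x: "x \<in> topspace X" "0 < norm (\<psi> (rep x))" using that by (auto simp: finite_part_def)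
    have "norm (?u x) = norm (\<xi> (rep x)) / norm (\<psi> (rep x))" by (rule norm_divide)
    also have "\<dots> \<le> C * (norm (\<psi> (rep x)) + norm (\<phi> (rep x))) / norm (\<psi> (rep x))"
      using C(2)[OF x(1)] x(2) by (intro divide_right_mono) auto
    also have "\<dots> = C * (1 + norm (ratio x))"
      using x(2) by (simp add: ratio_def norm_divide add_divide_distrib flip: times_divide_eq_right)
    finally show ?thesis .
  qed
  have finB: "finite ?B" using finite_critical_points by blast
  obtain m a where a: "a m 0 = 1"
    and rel: "\<And>x. x \<in> finite_part \<Longrightarrow> ratio x \<notin> ?B \<Longrightarrow> (\<Sum>k\<le>m. (\<Sum>j\<le>m-k. a k j * ratio x ^ j) * ?u x ^ k) = 0"
  proof (rule algebraic_relation[OF finB _ _ growth C(1)])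
    show "hol_at A ?u x" if "x \<in> finite_part" for x using that hol_at_ratio[OF \<xi> \<psi>] by (simp add: finite_part_def)
  qed blast+
  define Q where "Q v = (\<Sum>k\<le>m. \<Sum>j\<le>m-k. a k j * (\<phi> v ^ j * \<psi> v ^ (m - k - j) * \<xi> v ^ k))" for v
  have Qf: "Q \<in> forms n m"
  proof -
    have "(\<lambda>v. \<phi> v ^ j * \<psi> v ^ (m - k - j) * \<xi> v ^ k) \<in> forms n m" if "k \<le> m" "j \<le> m - k" for k j
    proof -
      have "j * 1 + (m - k - j) * 1 + k * 1 = m" using that by simp
      then show ?thesis
        using forms_mult[OF forms_mult[OF forms_power[OF \<phi>] forms_power[OF \<psi>]] forms_power[OF \<xi>], of j "m - k - j" k]
        by (simp only:)
    qed
    then show ?thesis unfolding Q_def[abs_def] by (intro forms_sum forms_cmult) auto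
  qed
  have Q0: "Q (rep x) = 0" if x: "x \<in> finite_part" "ratio x \<notin> ?B" for x
  proof -
    have nz: "\<psi> (rep x) \<noteq> 0" using x by (simp add: finite_part_def)
    have "Q (rep x) = \<psi> (rep x) ^ m * (\<Sum>k\<le>m. (\<Sum>j\<le>m-k. a k j * ratio x ^ j) * ?u x ^ k)"
      unfolding Q_def sum_distrib_left sum_distrib_right
    proof (intro sum.cong refl)
      fix k j assume "k \<in> {..m}" "j \<in> {..m-k}"
      then have "m = j + (m - k - j) + k" by simp
      then have "\<psi> (rep x) ^ m = \<psi> (rep x) ^ j * \<psi> (rep x) ^ (m - k - j) * \<psi> (rep x) ^ k"
        by (metis power_add)
      then show "a k j * (\<phi> (rep x) ^ j * \<psi> (rep x) ^ (m - k - j) * \<xi> (rep x) ^ k)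
          = \<psi> (rep x) ^ m * (a k j * ratio x ^ j * ?u x ^ k)"
        using nz by (simp add: ratio_def power_divide)
    qed
    then show ?thesis using rel[OF x] by simp
  qed
  have "\<forall>x\<in>topspace X. Q (rep x) = 0"
  proof (rule ccontr)
    assume "\<not> ?thesis"
    then have fin: "finite {x \<in> topspace X. Q (rep x) = 0}" using form_zeros_finite_or_all[OF Qf] by blast
    have "topspace X \<subseteq> {x \<in> topspace X. Q (rep x) = 0} \<union> {x \<in> topspace X. \<psi> (rep x) = 0} \<union>
        (\<Union>c\<in>?B. {x \<in> topspace X. \<phi> (rep x) - c * \<psi> (rep x) = 0})"
    proof
      fix x assume x: "x \<in> topspace X"
      show "x \<in> {x \<in> topspace X. Q (rep x) = 0} \<union> {x \<in> topspace X. \<psi> (rep x) = 0} \<union>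
        (\<Union>c\<in>?B. {x \<in> topspace X. \<phi> (rep x) - c * \<psi> (rep x) = 0})"
      proof (cases "x \<in> finite_part \<and> ratio x \<in> ?B")
        case True
        then have "\<phi> (rep x) - ratio x * \<psi> (rep x) = 0" by (simp add: finite_part_def ratio_def)
        then show ?thesis using True x by blast
      next
        case False
        then show ?thesis using Q0[of x] x by (auto simp: finite_part_def)
      qed
    qed
    moreover have "finite \<dots>" using fin finite_poles finB fibre_form_finite by blast
    ultimately have "finite (topspace X)" using finite_subset by blast
    then show False using infinite_open[OF openin_topspace] nonempty_X by blast
  qed
  moreover have "Q v = \<xi> v ^ m" if "\<phi> v = 0" "\<psi> v = 0" for v
  proof -
    have "Q v = (\<Sum>k\<le>m. if k = m then \<xi> v ^ m else 0)"
      unfolding Q_def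
    proof (rule sum.cong[OF refl])
      fix k assume k: "k \<in> {..m}"
      have "(\<Sum>j\<le>m-k. a k j * (\<phi> v ^ j * \<psi> v ^ (m - k - j) * \<xi> v ^ k))
          = (\<Sum>j\<le>m-k. if j = 0 then (if k = m then \<xi> v ^ m else 0) else 0)"
        using that k a by (intro sum.cong refl) (auto simp: power_0_left)
      then show "(\<Sum>j\<le>m-k. a k j * (\<phi> v ^ j * \<psi> v ^ (m - k - j) * \<xi> v ^ k)) = (if k = m then \<xi> v ^ m else 0)"
        by (simp add: sum.delta)
    qed
    then show ?thesis by (simp add: sum.delta)
  qed
  ultimately show ?thesis using that Qf by blast
qed

end

context projective_map begin

text \<open>Chow's theorem for an injectively mapped curve. The forms \<open>l s\<close> below vanish at \<open>P\<close>, and the values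
  \<open>l s v\<close> at another point are a nonzero polynomial in \<open>s\<close>. Thus all but finitely many \<open>s\<close> avoid
  any given finite set of points of the image. This gives first a form that does not vanish on the
  whole image, and then a second one without zeros in common with the first. A coordinate that is
  nonzero at \<open>P\<close> completes the pencil.\<close>

theorem chow_separating_form:
  assumes inj: "inj_on F (topspace X)" and P: "P \<in> proj_space n" "P \<notin> F ` topspace X"
  obtains d Q where "Q \<in> forms n d" "\<And>x. x \<in> topspace X \<Longrightarrow> Q (rep x) = 0" "\<And>v. v \<in> P \<Longrightarrow> Q v \<noteq> 0"
proof -
  obtain p where p: "p \<in> hom_coords n" "P = proj_point p" using P by (auto simp: proj_space_def)
  obtain a where a: "p a \<noteq> 0" "a \<le> n" using p(1) by (auto simp: hom_coords_def) (meson not_le)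
  (* The forms y k span the linear forms vanishing at p. *)
  define y where "y k v = p a * v k + (- p k) * v a" for k and v :: "nat \<Rightarrow> complex"
  define l where "l s v = (\<Sum>k\<le>n. s ^ k * y k v)" for s and v :: "nat \<Rightarrow> complex"
  have lf: "l s \<in> forms n 1" for s
    unfolding l_def[abs_def] y_def by (intro forms_sum forms_cmult forms_add forms_coord a) auto
  have lp: "l s p = 0" for s by (simp add: l_def y_def)
  have roots: "finite {s. l s (rep x) = 0}" if x: "x \<in> topspace X" for x
  proof -
    have "\<exists>k\<le>n. y k (rep x) \<noteq> 0"
    proof (rule ccontr)
      assume "\<not> ?thesis"
      then have e: "rep x k = (rep x a / p a) * p k" if "k \<le> n" for k
        using that a(1) by (auto simp: y_def field_simps)
      have "\<forall>i\<le>n. \<forall>j\<le>n. rep x i * p j = rep x j * p i"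
      proof (intro allI impI)
        fix i j assume "i \<le> n" "j \<le> n"
        show "rep x i * p j = rep x j * p i"
          unfolding e[OF \<open>i \<le> n\<close>] e[OF \<open>j \<le> n\<close>] by simp
      qed
      then have "proj_point (rep x) = proj_point p"
        using proj_point_eq_iff[OF rep(2)[OF x] p(1)] by blast
      then show False using P p rep(3)[OF x] x by blast
    qed
    then have "finite {s. (\<Sum>k\<le>n. y k (rep x) * s ^ k) = 0}"
      using polyfun_finite_roots[of "\<lambda>k. y k (rep x)" n] by blast
    then show ?thesis by (simp add: l_def mult.commute)
  qed
  obtain x0 where x0: "x0 \<in> topspace X" using nonempty_X by blast
  obtain s1 where s1: "l s1 (rep x0) \<noteq> 0"
    using ex_new_if_finite[OF infinite_UNIV_char_0 roots[OF x0]] by blast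
  let ?Z = "{x \<in> topspace X. l s1 (rep x) = 0}"
  have finZ: "finite ?Z" using form_zeros_finite_or_all[OF lf] s1 x0 by blast
  have "finite (\<Union>x\<in>?Z. {s. l s (rep x) = 0})" using finZ roots by blast
  then obtain s2 where s2: "s2 \<notin> (\<Union>x\<in>?Z. {s. l s (rep x) = 0})"
    using ex_new_if_finite[OF infinite_UNIV_char_0] by blast
  interpret regular_pencil X A n F "l s2" "l s1"
    by unfold_locales (use inj lf s2 finZ in auto)
  have "(\<lambda>v. v a) \<in> forms n 1" using a by (intro forms_coord)
  then obtain m Q where Q: "Q \<in> forms n m" "\<And>x. x \<in> topspace X \<Longrightarrow> Q (rep x) = 0"
    "\<And>v. l s2 v = 0 \<Longrightarrow> l s1 v = 0 \<Longrightarrow> Q v = v a ^ m"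
    by (rule monic_homogeneous_relation) blast
  have "Q v \<noteq> 0" if v: "v \<in> P" for v
  proof -
    obtain c where c: "c \<noteq> 0" "v = (\<lambda>i. c * p i)" using v p by (auto simp: proj_point_def)
    have "Q v = c ^ m * Q p" unfolding c(2) by (rule forms_scale_arg[OF Q(1)])
    also have "Q p = p a ^ m" using Q(3)[OF lp lp] .
    finally show ?thesis using c a by simp
  qed
  then show ?thesis using that Q by blast
qed

end

section \<open>Antiholomorphic maps\<close>

context projective_map begin

lemma affine_coord_rep:
  assumes "x \<in> topspace X"
  shows "affine_coord i j (F x) = rep x j / rep x i"
  using rep(3)[OF assms] by simp

lemma affine_part_rep:
  assumes "x \<in> topspace X"
  shows "F x \<in> affine_part n i \<longleftrightarrow> rep x i \<noteq> 0"
  using rep(2,3)[OF assms] proj_point_in_affine_part by metis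

lemma openin_affine_part: "openin X {x \<in> topspace X. F x \<in> affine_part n i}"
proof (rule openin_eventually_nhdsin)
  fix x assume x: "x \<in> topspace X" "F x \<in> affine_part n i"
  obtain W v where W: "openin X W" "x \<in> W"
    "\<And>y. y \<in> W \<Longrightarrow> v y \<in> hom_coords n \<and> F y = proj_point (v y) \<and> (\<forall>j. hol_at A (\<lambda>x. v x j) y)"
    using local_lift[OF x(1)] by metis
  have part: "F y \<in> affine_part n i \<longleftrightarrow> v y i \<noteq> 0" if "y \<in> W" for y
    using W(3)[OF that] proj_point_in_affine_part by metis
  have "((\<lambda>y. v y i) \<longlongrightarrow> v x i) (nhdsin X x)" using W x by (intro hol_at_tendsto) auto
  then have "eventually (\<lambda>y. v y i \<noteq> 0) (nhdsin X x)"
    using part[OF W(2)] x(2) tendsto_imp_eventually_ne by blast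
  moreover have "eventually (\<lambda>y. y \<in> W) (nhdsin X x)" using W by (auto simp: eventually_nhdsin)
  ultimately show "eventually (\<lambda>y. F y \<in> affine_part n i) (nhdsin X x)"
    by eventually_elim (simp add: part)
qed

lemma affine_coord_hol_at:
  assumes x: "x \<in> topspace X" "F x \<in> affine_part n i" and "i \<le> n" "j \<le> n"
  shows "hol_at A (affine_coord i j \<circ> F) x"
proof -
  have "hol_at A (\<lambda>x. rep x j / rep x i) x"
    using assms affine_part_rep by (intro hol_at_ratio[OF forms_coord forms_coord]) auto
  then show ?thesis
    by (rule hol_at_transform[OF _ openin_topspace x(1)]) (simp add: affine_coord_rep)
qed

end

context riemann_surface begin

text \<open>On the part of a chart where the \<open>i\<close>-th coordinate is nonzero, the vector of affine coordinates is a
  holomorphic lift.\<close>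

lemma projective_map_of_embedding:
  assumes f: "projective_embedding X A n f"
  shows "projective_map X A n f"
proof
  fix x assume x: "x \<in> topspace X"
  obtain U z where c: "(U, z) \<in> A" "x \<in> U" by (rule chart_at[OF x])
  have fP: "f y \<in> proj_space n" if "y \<in> topspace X" for y
    using f that by (auto simp: projective_embedding_def)
  obtain w where w: "w \<in> hom_coords n" "f x = proj_point w" using fP[OF x] by (auto simp: proj_space_def)
  obtain i where i: "w i \<noteq> 0" using w by (auto simp: hom_coords_def)
  have "i \<le> n" by (rule ccontr) (use w i in \<open>auto simp: hom_coords_def\<close>)
  let ?T = "{x \<in> U. f x \<in> affine_part n i}"
  have T: "openin X ?T" and hol: "\<And>j. j \<le> n \<Longrightarrow> (affine_coord i j \<circ> f \<circ> inv_into U z) holomorphic_on z ` ?T"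
    using f c(1) \<open>i \<le> n\<close> unfolding projective_embedding_def Let_def by blast+
  define v where "v y j = (if j \<le> n then affine_coord i j (f y) else 0)" for y j
  have "v y \<in> hom_coords n \<and> f y = proj_point (v y) \<and> (\<forall>j. hol_at A (\<lambda>x. v x j) y)" if y: "y \<in> ?T" for y
  proof -
    have "y \<in> topspace X" using y chart_subset[OF c(1)] by blast
    then obtain u where u: "u \<in> hom_coords n" "f y = proj_point u" using fP by (auto simp: proj_space_def)
    have ui: "u i \<noteq> 0" using y u proj_point_in_affine_part by auto
    have vu: "v y = (\<lambda>j. inverse (u i) * u j)"
      using u by (auto simp: v_def hom_coords_def divide_inverse)
    then have vin: "v y \<in> proj_point u" using ui by (auto simp: proj_point_def intro!: exI[of _ "inverse (u i)"])
    have "hol_at A (\<lambda>x. v x j) y" for j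
    proof (cases "j \<le> n")
      case True
      have "U \<inter> ?T = ?T" by blast
      then have op: "open (z ` ?T)" using chart_image_open[OF c(1) T] by simp
      have "hol_at A (affine_coord i j \<circ> f) y"
        by (rule hol_at_of_chart_holomorphic[OF c(1) op hol[OF True]]) (use y in auto)
      then show ?thesis using True by (simp add: v_def o_def)
    qed (simp add: v_def)
    then show ?thesis
      using u vin hom_coords_proj_point proj_point_eqI by metis
  qed
  moreover have "x \<in> ?T" using c w i proj_point_in_affine_part by auto
  ultimately show "\<exists>W v. openin X W \<and> x \<in> W \<and>
      (\<forall>y\<in>W. v y \<in> hom_coords n \<and> f y = proj_point (v y) \<and> (\<forall>j. hol_at A (\<lambda>x. v x j) y))"
    using T by (intro exI[of _ ?T] exI[of _ v]) blast
qed

text \<open>Holomorphic maps are the continuous maps that pull holomorphic functions back to holomorphic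
  functions, antiholomorphic ones pull them back to conjugates of holomorphic functions. In this form
  the rules for compositions are immediate.\<close>

definition hol_map :: "('a \<Rightarrow> 'a) \<Rightarrow> bool" where
  "hol_map s \<longleftrightarrow> continuous_map X X s \<and> (\<forall>x\<in>topspace X. \<forall>h. hol_at A h (s x) \<longrightarrow> hol_at A (\<lambda>y. h (s y)) x)"

definition antihol_map :: "('a \<Rightarrow> 'a) \<Rightarrow> bool" where
  "antihol_map s \<longleftrightarrow> continuous_map X X s \<and> (\<forall>x\<in>topspace X. \<forall>h. hol_at A h (s x) \<longrightarrow> hol_at A (\<lambda>y. cnj (h (s y))) x)"

lemma hol_mapD: "hol_map s \<Longrightarrow> x \<in> topspace X \<Longrightarrow> hol_at A h (s x) \<Longrightarrow> hol_at A (\<lambda>y. h (s y)) x"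
  by (simp add: hol_map_def)

lemma antihol_mapD: "antihol_map s \<Longrightarrow> x \<in> topspace X \<Longrightarrow> hol_at A h (s x) \<Longrightarrow> hol_at A (\<lambda>y. cnj (h (s y))) x"
  by (simp add: antihol_map_def)

lemma continuous_map_in: "continuous_map X X s \<Longrightarrow> x \<in> topspace X \<Longrightarrow> s x \<in> topspace X"
  by (auto simp: continuous_map_def)

lemma hol_map_cong:
  assumes s: "hol_map s" and eq: "\<And>x. x \<in> topspace X \<Longrightarrow> s x = r x"
  shows "hol_map r"
proof -
  have "continuous_map X X s" using s by (simp add: hol_map_def)
  then have "continuous_map X X r" using eq by (rule continuous_map_eq)
  moreover have "hol_at A (\<lambda>y. h (r y)) x" if "x \<in> topspace X" "hol_at A h (r x)" for x h
    by (rule hol_at_transform[of "\<lambda>y. h (s y)", OF _ openin_topspace that(1)]) (use s that eq in \<open>auto simp: hol_map_def\<close>)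
  ultimately show ?thesis by (simp add: hol_map_def)
qed

lemma antihol_map_cong:
  assumes s: "antihol_map s" and eq: "\<And>x. x \<in> topspace X \<Longrightarrow> s x = r x"
  shows "antihol_map r"
proof -
  have "continuous_map X X s" using s by (simp add: antihol_map_def)
  then have "continuous_map X X r" using eq by (rule continuous_map_eq)
  moreover have "hol_at A (\<lambda>y. cnj (h (r y))) x" if "x \<in> topspace X" "hol_at A h (r x)" for x h
    by (rule hol_at_transform[of "\<lambda>y. cnj (h (s y))", OF _ openin_topspace that(1)]) (use s that eq in \<open>auto simp: antihol_map_def\<close>)
  ultimately show ?thesis by (simp add: antihol_map_def)
qed

lemma hol_map_comp:
  assumes "hol_map s" "hol_map r" shows "hol_map (s \<circ> r)"
  using assms continuous_map_compose[of X X r X s] continuous_map_in unfolding hol_map_def o_def by blast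

lemma antihol_hol_comp:
  assumes "antihol_map s" "hol_map r" shows "antihol_map (s \<circ> r)"
proof -
  have "hol_at A (\<lambda>y. cnj (h (s (r y)))) x" if x: "x \<in> topspace X" "hol_at A h (s (r x))" for x h
  proof -
    have "r x \<in> topspace X" using x assms continuous_map_in by (auto simp: hol_map_def)
    then have "hol_at A (\<lambda>y. cnj (h (s y))) (r x)" by (rule antihol_mapD[OF assms(1) _ x(2)])
    then show ?thesis by (rule hol_mapD[OF assms(2) x(1)])
  qed
  then show ?thesis using assms continuous_map_compose[of X X r X s] by (simp add: hol_map_def antihol_map_def o_def)
qed

lemma hol_antihol_comp:
  assumes "hol_map s" "antihol_map r" shows "antihol_map (s \<circ> r)"
proof -
  have "hol_at A (\<lambda>y. cnj (h (s (r y)))) x" if x: "x \<in> topspace X" "hol_at A h (s (r x))" for x h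
  proof -
    have "r x \<in> topspace X" using x assms continuous_map_in by (auto simp: antihol_map_def)
    then have "hol_at A (\<lambda>y. h (s y)) (r x)" by (rule hol_mapD[OF assms(1) _ x(2)])
    then show ?thesis by (rule antihol_mapD[OF assms(2) x(1)])
  qed
  then show ?thesis using assms continuous_map_compose[of X X r X s] by (simp add: hol_map_def antihol_map_def o_def)
qed

lemma antihol_comp:
  assumes "antihol_map s" "antihol_map r" shows "hol_map (s \<circ> r)"
proof -
  have "hol_at A (\<lambda>y. h (s (r y))) x" if x: "x \<in> topspace X" "hol_at A h (s (r x))" for x h
  proof -
    have "r x \<in> topspace X" using x assms continuous_map_in by (auto simp: antihol_map_def)
    then have "hol_at A (\<lambda>y. cnj (h (s y))) (r x)" by (rule antihol_mapD[OF assms(1) _ x(2)])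
    then have "hol_at A (\<lambda>y. cnj (cnj (h (s (r y))))) x" by (rule antihol_mapD[OF assms(2) x(1)])
    then show ?thesis by simp
  qed
  then show ?thesis using assms continuous_map_compose[of X X r X s] by (simp add: hol_map_def antihol_map_def o_def)
qed

lemma holomorphic_self_map_iff_hol_map: "holomorphic_self_map X A s \<longleftrightarrow> hol_map s"
proof
  assume s: "holomorphic_self_map X A s"
  then have cont: "continuous_map X X s" by (simp add: holomorphic_self_map_def)
  have "hol_at A (\<lambda>y. h (s y)) x" if x: "x \<in> topspace X" and h: "hol_at A h (s x)" for x h
  proof -
    obtain U z where c: "(U, z) \<in> A" "x \<in> U" by (rule chart_at[OF x])
    obtain V w where d: "(V, w) \<in> A" "s x \<in> V" by (rule chart_at[OF continuous_map_in[OF cont x]])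
    let ?T = "{x \<in> U. s x \<in> V}"
    have "openin X {x \<in> topspace X. s x \<in> V}"
      by (rule openin_continuous_map_preimage[OF cont chart_openin[OF d(1)]])
    from chart_image_open[OF c(1) this] have op: "open (z ` ?T)"
      using chart_subset[OF c(1)] by (simp add: Int_def set_eq_iff subset_iff) (metis (no_types, lifting) Collect_cong)
    have zx: "z x \<in> z ` ?T" using c d by blast
    have "(w \<circ> s \<circ> inv_into U z) holomorphic_on z ` ?T"
      using s c(1) d(1) unfolding holomorphic_self_map_def by blast
    then have "(w \<circ> s \<circ> inv_into U z) field_differentiable (at (z x))"
      using op zx by (rule holomorphic_on_imp_differentiable_at)
    moreover have "(h \<circ> inv_into V w) field_differentiable (at ((w \<circ> s \<circ> inv_into U z) (z x)))"
      using hol_at_chartD[OF h d] c by simp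
    ultimately have "((h \<circ> inv_into V w) \<circ> (w \<circ> s \<circ> inv_into U z)) field_differentiable (at (z x))"
      by (rule field_differentiable_compose)
    then have "((\<lambda>y. h (s y)) \<circ> inv_into U z) field_differentiable (at (z x))"
      by (rule field_differentiable_transform_open[OF op zx, rotated]) (use c(1) d(1) in auto)
    then show ?thesis by (rule hol_at_chartI[OF c])
  qed
  then show "hol_map s" using cont by (simp add: hol_map_def)
next
  assume s: "hol_map s"
  then have cont: "continuous_map X X s" by (simp add: hol_map_def)
  have "(w \<circ> s \<circ> inv_into U z) holomorphic_on z ` {x \<in> U. s x \<in> V}" if c: "(U, z) \<in> A" and d: "(V, w) \<in> A" for U z V w
  proof -
    let ?W = "{x \<in> topspace X. s x \<in> V}"
    have W: "openin X ?W" by (rule openin_continuous_map_preimage[OF cont chart_openin[OF d]])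
    have "hol_at A (\<lambda>y. w (s y)) y" if "y \<in> ?W" for y
      using that s hol_at_chart[OF d] by (simp add: hol_map_def)
    then have "((\<lambda>y. w (s y)) \<circ> inv_into U z) holomorphic_on z ` (U \<inter> ?W)"
      using hol_on_chart[OF _ W c] by blast
    moreover have "U \<inter> ?W = {x \<in> U. s x \<in> V}" using chart_subset[OF c] by blast
    ultimately show ?thesis by (simp add: o_def)
  qed
  then show "holomorphic_self_map X A s" using cont by (auto simp: holomorphic_self_map_def)
qed

text \<open>Two distinct points of projective space have a nonzero minor of coordinate vectors, and this minor
  stays nonzero when both points move a little.\<close>

lemma separate_conj_points:
  assumes f: "projective_map X A n f" and g: "projective_map X A n g"
    and y: "y \<in> topspace X" and x: "x \<in> topspace X" and ne: "f y \<noteq> conj_point (g x)"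
  shows "\<exists>N M. openin X N \<and> openin X M \<and> y \<in> N \<and> x \<in> M \<and> (\<forall>y\<in>N. \<forall>x\<in>M. f y \<noteq> conj_point (g x))"
proof -
  obtain N v where N: "openin X N" "y \<in> N"
    "\<And>y. y \<in> N \<Longrightarrow> v y \<in> hom_coords n \<and> f y = proj_point (v y) \<and> (\<forall>j. hol_at A (\<lambda>x. v x j) y)"
    using projective_map.local_lift[OF f y] by metis
  obtain M w where M: "openin X M" "x \<in> M"
    "\<And>y. y \<in> M \<Longrightarrow> w y \<in> hom_coords n \<and> g y = proj_point (w y) \<and> (\<forall>j. hol_at A (\<lambda>x. w x j) y)"
    using projective_map.local_lift[OF g x] by metis
  have eq_iff: "f y' = conj_point (g x') \<longleftrightarrow> (\<forall>i\<le>n. \<forall>j\<le>n. v y' i * cnj (w x' j) = v y' j * cnj (w x' i))"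
    if "y' \<in> N" "x' \<in> M" for y' x'
    using N(3)[OF that(1)] M(3)[OF that(2)] proj_point_eq_iff[of "v y'" n "\<lambda>i. cnj (w x' i)"]
    by (simp add: conj_point_proj_point hom_coords_cnj)
  obtain i j where ij: "i \<le> n" "j \<le> n" "v y i * cnj (w x j) \<noteq> v y j * cnj (w x i)"
    using ne eq_iff[OF N(2) M(2)] by blast
  let ?L = "nhdsin X y \<times>\<^sub>F nhdsin X x"
  have lv: "((\<lambda>p. v (fst p) k) \<longlongrightarrow> v y k) ?L" for k
    using N y by (intro filterlim_compose[OF _ filterlim_fst] hol_at_tendsto) auto
  have lw: "((\<lambda>p. w (snd p) k) \<longlongrightarrow> w x k) ?L" for k
    using M x by (intro filterlim_compose[OF _ filterlim_snd] hol_at_tendsto) auto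
  have "((\<lambda>p. v (fst p) i * cnj (w (snd p) j) - v (fst p) j * cnj (w (snd p) i))
      \<longlongrightarrow> v y i * cnj (w x j) - v y j * cnj (w x i)) ?L"
    by (intro tendsto_intros lv lw)
  then have "eventually (\<lambda>p. v (fst p) i * cnj (w (snd p) j) - v (fst p) j * cnj (w (snd p) i) \<noteq> 0) ?L"
    by (rule tendsto_imp_eventually_ne) (use ij in simp)
  then obtain P Q where PQ: "eventually P (nhdsin X y)" "eventually Q (nhdsin X x)"
    "\<And>y x. P y \<Longrightarrow> Q x \<Longrightarrow> v y i * cnj (w x j) - v y j * cnj (w x i) \<noteq> 0"
    unfolding eventually_prod_filter by auto
  obtain N' where N': "openin X N'" "y \<in> N'" "\<And>y. y \<in> N' \<Longrightarrow> P y" using eventually_nhdsinE[OF PQ(1) y] by blast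
  obtain M' where M': "openin X M'" "x \<in> M'" "\<And>y. y \<in> M' \<Longrightarrow> Q y" using eventually_nhdsinE[OF PQ(2) x] by blast
  have "f y' \<noteq> conj_point (g x')" if "y' \<in> N \<inter> N'" "x' \<in> M \<inter> M'" for y' x'
  proof -
    have "v y' i * cnj (w x' j) - v y' j * cnj (w x' i) \<noteq> 0" using that N'(3) M'(3) PQ(3) by blast
    then show ?thesis using eq_iff[of y' x'] that ij by auto
  qed
  then show ?thesis
    using N N' M M' by (intro exI[of _ "N \<inter> N'"] exI[of _ "M \<inter> M'"]) auto
qed

text \<open>The preimage of a closed set \<open>C\<close> is a projection of the closed set of all pairs \<open>(y, x)\<close> with \<open>y\<close> in
  \<open>C\<close> and \<open>f y = conj_point (g x)\<close>, and projections along a compact space are closed maps.\<close>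

lemma continuous_conj_transport:
  assumes f: "projective_map X A n f" and g: "projective_map X A n g" and inj: "inj_on f (topspace X)"
    and s: "\<And>x. x \<in> topspace X \<Longrightarrow> s x \<in> topspace X \<and> f (s x) = conj_point (g x)"
  shows "continuous_map X X s"
  unfolding continuous_map_closedin
proof (intro conjI allI impI)
  show "s \<in> topspace X \<rightarrow> topspace X" using s by blast
  fix C assume C: "closedin X C"
  let ?P = "prod_topology X X"
  let ?R = "{(y, x). y \<in> topspace X \<and> x \<in> topspace X \<and> f y = conj_point (g x)}"
  have "openin ?P (topspace ?P - ?R)"
    unfolding openin_prod_topology_alt
  proof (intro allI impI)
    fix y x assume "(y, x) \<in> topspace ?P - ?R"
    then have yx: "y \<in> topspace X" "x \<in> topspace X" "f y \<noteq> conj_point (g x)" by auto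
    obtain N M where NM: "openin X N" "openin X M" "y \<in> N" "x \<in> M" "\<forall>y\<in>N. \<forall>x\<in>M. f y \<noteq> conj_point (g x)"
      using separate_conj_points[OF f g yx] by blast
    have "N \<times> M \<subseteq> topspace ?P - ?R" using NM openin_subset[OF NM(1)] openin_subset[OF NM(2)] by auto
    then show "\<exists>N M. openin X N \<and> openin X M \<and> y \<in> N \<and> x \<in> M \<and> N \<times> M \<subseteq> topspace ?P - ?R" using NM by blast
  qed
  then have "closedin ?P ?R" by (auto simp: closedin_def)
  moreover have "closedin ?P (C \<times> topspace X)" using C by (simp add: closedin_prod_Times_iff)
  ultimately have "closedin ?P (?R \<inter> C \<times> topspace X)" by (rule closedin_Int)
  then have "closedin X (snd ` (?R \<inter> C \<times> topspace X))"
    using closed_map_snd[OF compact_X, of X] by (simp add: closed_map_def)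
  moreover have "snd ` (?R \<inter> C \<times> topspace X) = {x \<in> topspace X. s x \<in> C}"
  proof (intro equalityI subsetI)
    fix x assume "x \<in> snd ` (?R \<inter> C \<times> topspace X)"
    then obtain y where y: "y \<in> topspace X" "x \<in> topspace X" "f y = conj_point (g x)" "y \<in> C" by auto
    then have "y = s x" using s inj_onD[OF inj] by metis
    then show "x \<in> {x \<in> topspace X. s x \<in> C}" using y by blast
  next
    fix x assume "x \<in> {x \<in> topspace X. s x \<in> C}"
    then show "x \<in> snd ` (?R \<inter> C \<times> topspace X)" using s by (intro image_eqI[of _ _ "(s x, x)"]) auto
  qed
  ultimately show "closedin X {x \<in> topspace X. s x \<in> C}" by simp
qed

text \<open>As \<open>f\<close> is an immersion, some affine coordinate of \<open>f\<close> is a local coordinate at \<open>s x\<close>, so that \<open>h\<close>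
  is a holomorphic function \<open>H\<close> of it. At \<open>s y\<close> this coordinate is the conjugate of the same affine
  coordinate of \<open>g y\<close>, and conjugating both the argument and the value of \<open>H\<close> gives a holomorphic
  function again.\<close>

lemma antihol_conj_transport:
  assumes f: "projective_embedding X A n f" and g: "projective_embedding X A n g"
    and s: "\<And>x. x \<in> topspace X \<Longrightarrow> s x \<in> topspace X \<and> f (s x) = conj_point (g x)"
  shows "antihol_map s"
proof -
  interpret f: projective_map X A n f by (rule projective_map_of_embedding[OF f])
  interpret g: projective_map X A n g by (rule projective_map_of_embedding[OF g])
  have inj: "inj_on f (topspace X)" using f by (simp add: projective_embedding_def)
  have cont: "continuous_map X X s"
    by (rule continuous_conj_transport[OF f.projective_map_axioms g.projective_map_axioms inj s])
  have "hol_at A (\<lambda>y. cnj (h (s y))) x" if x: "x \<in> topspace X" and h: "hol_at A h (s x)" for x h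
  proof -
    have sx: "s x \<in> topspace X" using s x by blast
    obtain V w where c: "(V, w) \<in> A" "s x \<in> V" by (rule chart_at[OF sx])
    obtain i where "f.rep (s x) i \<noteq> 0" using f.rep(2)[OF sx] by (auto simp: hom_coords_def)
    then have part: "f (s x) \<in> affine_part n i" using f.affine_part_rep[OF sx] by blast
    have i: "i \<le> n"
      by (rule ccontr) (use \<open>f.rep (s x) i \<noteq> 0\<close> f.rep(2)[OF sx] in \<open>auto simp: hom_coords_def\<close>)
    let ?T = "{x \<in> V. f x \<in> affine_part n i}"
    have "openin X ?T" "\<forall>x \<in> ?T. \<exists>j \<le> n. deriv (affine_coord i j \<circ> f \<circ> inv_into V w) (w x) \<noteq> 0"
      using f c(1) i unfolding projective_embedding_def Let_def by blast+
    moreover have "s x \<in> ?T" using c part by blast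
    ultimately obtain j where T: "openin X ?T" "s x \<in> ?T" and j: "j \<le> n"
      and dj: "deriv (affine_coord i j \<circ> f \<circ> inv_into V w) (w (s x)) \<noteq> 0" by blast
    let ?t = "affine_coord i j \<circ> f"
    have "hol_at A ?t y" if "y \<in> ?T" for y
      using that chart_subset[OF c(1)] i j by (intro f.affine_coord_hol_at) auto
    from local_inverse[OF T this c dj] obtain N where N: "openin X N" "s x \<in> N" "inj_on ?t N"
      and Nh: "\<And>h y. y \<in> N \<Longrightarrow> hol_at A h y \<Longrightarrow> (h \<circ> inv_into N ?t) field_differentiable (at (?t y))"
      by metis
    let ?H = "h \<circ> inv_into N ?t" and ?u = "affine_coord i j \<circ> g"
    have tu: "?t (s y) = cnj (?u y)" if "y \<in> topspace X" for y
      using s[OF that] g.rep(3)[OF that] by (simp add: conj_point_proj_point)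
    have "f.rep (s x) \<in> proj_point (\<lambda>i. cnj (g.rep x i))"
      using s[OF x] f.rep(1)[OF sx] g.rep(3)[OF x] by (simp add: conj_point_proj_point)
    then have "g.rep x i \<noteq> 0" using \<open>f.rep (s x) i \<noteq> 0\<close> by (auto simp: proj_point_def)
    then have "hol_at A ?u x" using g.affine_coord_hol_at[OF x _ i j] g.affine_part_rep[OF x] by blast
    moreover have "(cnj \<circ> ?H \<circ> cnj) field_differentiable (at (?u x))"
      using Nh[OF N(2) h] tu[OF x] by (intro field_differentiable_cnj_cnj) simp
    ultimately have 1: "hol_at A (\<lambda>y. (cnj \<circ> ?H \<circ> cnj) (?u y)) x" by (rule hol_at_compose)
    have 2: "openin X {x \<in> topspace X. s x \<in> N}"
      by (rule openin_continuous_map_preimage[OF cont N(1)])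
    have 3: "(cnj \<circ> ?H \<circ> cnj) (?u y) = cnj (h (s y))" if "y \<in> {x \<in> topspace X. s x \<in> N}" for y
    proof -
      have "inv_into N ?t (cnj (?u y)) = s y"
        using that tu[of y] inv_into_f_f[OF N(3), of "s y"] by simp
      then show ?thesis by simp
    qed
    show ?thesis by (rule hol_at_transform[OF 1 2 _ 3]) (use x N(2) in simp_all)
  qed
  then show ?thesis using cont by (simp add: antihol_map_def)
qed

text \<open>Inside the group of all bijections of the surface, the conformal automorphisms form a subgroup \<open>C\<close>
  and the antiholomorphic bijections with antiholomorphic inverse a set \<open>D\<close> with \<open>C D\<close> and \<open>D C\<close>
  contained in \<open>D\<close> and \<open>D D\<close> in \<open>C\<close>. The conjugate embeddings provide an element of \<open>D\<close>; exchanging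
  their roles provides its inverse.\<close>

lemma antiholomorphic_involution:
  assumes conj: "isomorphic_to_conjugate X A"
    and G: "G = conformal_aut_group X A"
    and centre: "group_center G = {\<one>\<^bsub>G\<^esub>}"
    and hyp: "(\<nexists>x. is_involution (outer_aut_group G) x) \<or>
         (\<exists>H. group_complement (AutoGroup G) (inner_auts G) H)"
  shows "\<exists>s. antihol_map s \<and> (\<forall>x\<in>topspace X. s (s x) = x)"
proof -
  let ?S = "topspace X"
  let ?P = "BijGroup ?S"
  interpret P: group ?P by (rule group_BijGroup)
  have carP: "carrier ?P = Bij ?S" and oneP: "\<one>\<^bsub>?P\<^esub> = (\<lambda>x\<in>?S. x)" by (simp_all add: BijGroup_def)
  have multP: "a \<otimes>\<^bsub>?P\<^esub> b = compose ?S a b" if "a \<in> Bij ?S" "b \<in> Bij ?S" for a b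
    using that by (simp add: BijGroup_def)
  have mult_eq: "(a \<circ> b) x = (a \<otimes>\<^bsub>?P\<^esub> b) x" if "a \<in> Bij ?S" "b \<in> Bij ?S" "x \<in> ?S" for a b x
    using that by (simp add: multP compose_def)
  have Bij_mult: "a \<otimes>\<^bsub>?P\<^esub> b \<in> Bij ?S" if "a \<in> Bij ?S" "b \<in> Bij ?S" for a b
    using that P.m_closed by (simp add: carP)
  have Bij_inv: "inv\<^bsub>?P\<^esub> a \<in> Bij ?S" if "a \<in> Bij ?S" for a
    using that P.inv_closed by (simp add: carP)
  define C where "C = {a \<in> Bij ?S. hol_map a \<and> hol_map (inv\<^bsub>?P\<^esub> a)}"
  define D where "D = {a \<in> Bij ?S. antihol_map a \<and> antihol_map (inv\<^bsub>?P\<^esub> a)}"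
  have CC: "a \<otimes>\<^bsub>?P\<^esub> b \<in> C" if "a \<in> C" "b \<in> C" for a b
    using that hol_map_cong[OF hol_map_comp mult_eq, of a b] hol_map_cong[OF hol_map_comp mult_eq, of "inv\<^bsub>?P\<^esub> b" "inv\<^bsub>?P\<^esub> a"]
    by (simp add: C_def Bij_mult Bij_inv P.inv_mult_group carP)
  have CD: "a \<otimes>\<^bsub>?P\<^esub> b \<in> D" if "a \<in> C" "b \<in> D" for a b
    using that antihol_map_cong[OF hol_antihol_comp mult_eq, of a b] antihol_map_cong[OF antihol_hol_comp mult_eq, of "inv\<^bsub>?P\<^esub> b" "inv\<^bsub>?P\<^esub> a"]
    by (simp add: C_def D_def Bij_mult Bij_inv P.inv_mult_group carP)
  have DC: "a \<otimes>\<^bsub>?P\<^esub> b \<in> D" if "a \<in> D" "b \<in> C" for a b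
    using that antihol_map_cong[OF antihol_hol_comp mult_eq, of a b] antihol_map_cong[OF hol_antihol_comp mult_eq, of "inv\<^bsub>?P\<^esub> b" "inv\<^bsub>?P\<^esub> a"]
    by (simp add: C_def D_def Bij_mult Bij_inv P.inv_mult_group carP)
  have DD: "a \<otimes>\<^bsub>?P\<^esub> b \<in> C" if "a \<in> D" "b \<in> D" for a b
    using that hol_map_cong[OF antihol_comp mult_eq, of a b] hol_map_cong[OF antihol_comp mult_eq, of "inv\<^bsub>?P\<^esub> b" "inv\<^bsub>?P\<^esub> a"]
    by (simp add: C_def D_def Bij_mult Bij_inv P.inv_mult_group carP)
  have Cinv: "inv\<^bsub>?P\<^esub> a \<in> C" if "a \<in> C" for a using that by (simp add: C_def Bij_inv carP)
  have Dinv: "inv\<^bsub>?P\<^esub> a \<in> D" if "a \<in> D" for a using that by (simp add: D_def Bij_inv carP)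
  have hol_id: "hol_map \<one>\<^bsub>?P\<^esub>"
    by (rule hol_map_cong[of "\<lambda>x. x"]) (auto simp: hol_map_def oneP)
  have oneC: "\<one>\<^bsub>?P\<^esub> \<in> C" using hol_id P.one_closed by (simp add: C_def carP)
  have subC: "subgroup C ?P"
    by (rule P.subgroupI) (use oneC CC Cinv in \<open>auto simp: C_def carP\<close>)
  have hol_inv: "hol_map (inv_into ?S a) \<longleftrightarrow> hol_map (inv\<^bsub>?P\<^esub> a)" if "a \<in> Bij ?S" for a
    using hol_map_cong[of "inv_into ?S a" "inv\<^bsub>?P\<^esub> a"] hol_map_cong[of "inv\<^bsub>?P\<^esub> a" "inv_into ?S a"]
    by (auto simp: inv_BijGroup[OF that])
  have "{f \<in> Bij ?S. holomorphic_self_map X A f \<and> holomorphic_self_map X A (inv_into ?S f)} = C"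
    unfolding C_def holomorphic_self_map_iff_hol_map using hol_inv by blast
  then have GC: "G = ?P\<lparr>carrier := C\<rparr>" by (simp add: G conformal_aut_group_def)
  obtain n T where nT: "isomorphic_to_curve X A n T" "isomorphic_to_curve X A n (conj_poly ` T)"
    using conj unfolding isomorphic_to_conjugate_def by blast
  obtain f where f: "projective_embedding X A n f" "f ` ?S = zero_locus n T"
    using nT(1) unfolding isomorphic_to_curve_def by blast
  obtain g where g: "projective_embedding X A n g" "g ` ?S = zero_locus n (conj_poly ` T)"
    using nT(2) unfolding isomorphic_to_curve_def by blast
  have gf: "g ` ?S = conj_point ` f ` ?S" using f g by (simp add: zero_locus_conj_poly)
  have fg: "f ` ?S = conj_point ` g ` ?S" unfolding gf by (simp add: image_image)
  have inj: "inj_on f ?S" "inj_on g ?S" using f g by (simp_all add: projective_embedding_def)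
  define t where "t = (\<lambda>x\<in>?S. inv_into ?S f (conj_point (g x)))"
  define r where "r = (\<lambda>x\<in>?S. inv_into ?S g (conj_point (f x)))"
  have t: "t x \<in> ?S \<and> f (t x) = conj_point (g x)" if "x \<in> ?S" for x
    using that fg by (auto simp: t_def intro!: inv_into_into f_inv_into_f)
  have r: "r x \<in> ?S \<and> g (r x) = conj_point (f x)" if "x \<in> ?S" for x
    using that gf by (auto simp: r_def intro!: inv_into_into f_inv_into_f)
  have rt: "r (t x) = x" if "x \<in> ?S" for x
    using inj_onD[OF inj(2), of "r (t x)" x] r[of "t x"] t[OF that] that by simp
  have tr: "t (r x) = x" if "x \<in> ?S" for x
    using inj_onD[OF inj(1), of "t (r x)" x] t[of "r x"] r[OF that] that by simp
  have tB: "t \<in> Bij ?S"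
  proof -
    have "bij_betw t ?S ?S"
      by (rule bij_betw_byWitness[where f' = r]) (use t r tr rt in auto)
    then show ?thesis by (simp add: Bij_def t_def)
  qed
  have rB: "r \<in> Bij ?S"
  proof -
    have "bij_betw r ?S ?S"
      by (rule bij_betw_byWitness[where f' = t]) (use t r tr rt in auto)
    then show ?thesis by (simp add: Bij_def r_def)
  qed
  have "r \<otimes>\<^bsub>?P\<^esub> t = \<one>\<^bsub>?P\<^esub>"
    using rt by (auto simp: multP[OF rB tB] oneP compose_def fun_eq_iff)
  then have "inv\<^bsub>?P\<^esub> t = r" using P.inv_equality tB rB by (simp add: carP)
  then have tD: "t \<in> D"
    using tB antihol_conj_transport[OF f(1) g(1) t] antihol_conj_transport[OF g(1) f(1) r] by (simp add: D_def)
  have stab: "t \<in> conj_stabilizer ?P C"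
    using tD tB DC CD DD Dinv[OF tD] by (auto simp: conj_stabilizer_def carP)
  obtain b where b: "b \<in> C" "(t \<otimes>\<^bsub>?P\<^esub> b) \<otimes>\<^bsub>?P\<^esub> (t \<otimes>\<^bsub>?P\<^esub> b) = \<one>\<^bsub>?P\<^esub>"
    using involution_in_coset[OF P.is_group subC GC stab DD[OF tD tD] centre hyp] by blast
  let ?s = "t \<otimes>\<^bsub>?P\<^esub> b"
  have sD: "?s \<in> D" by (rule DC[OF tD b(1)])
  then have "?s \<in> Bij ?S" by (simp add: D_def)
  then have "?s (?s x) = x" if "x \<in> ?S" for x
    using fun_cong[OF b(2), of x] that by (simp add: multP[of ?s ?s] oneP compose_def)
  then show ?thesis using sD unfolding D_def by blast
qed

end

section \<open>The real model defined by an antiholomorphic involution\<close>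

text \<open>These are linear coordinates of the matrix \<open>v\<^sub>i w\<^sub>j\<close>. The coefficients \<open>1 + \<i>\<close> and \<open>1 - \<i>\<close> are conjugate
  to each other, so that the coordinates of the adjoint matrix are the conjugates of those of the matrix,
  and linearly independent of their exchange, so that the matrix can be recovered.\<close>

definition hermitian_coord :: "(nat \<Rightarrow> complex) \<Rightarrow> (nat \<Rightarrow> complex) \<Rightarrow> nat \<Rightarrow> nat \<Rightarrow> complex" where
  "hermitian_coord v w i j = (1 + \<i>) * (v i * w j) + (1 - \<i>) * (v j * w i)"

text \<open>The pair \<open>(i, j)\<close> of indices up to \<open>n\<close> is encoded as \<open>i * Suc n + j\<close>.\<close>

definition hermitian_segre :: "nat \<Rightarrow> (nat \<Rightarrow> complex) \<Rightarrow> (nat \<Rightarrow> complex) \<Rightarrow> nat \<Rightarrow> complex" where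
  "hermitian_segre n v w k =
     (if k < Suc n * Suc n then hermitian_coord v w (k div Suc n) (k mod Suc n) else 0)"

lemma hermitian_segre_index:
  assumes "i \<le> n" "j \<le> n"
  shows "i * Suc n + j < Suc n * Suc n" "hermitian_segre n v w (i * Suc n + j) = hermitian_coord v w i j"
proof -
  have "i * Suc n + j < i * Suc n + Suc n" using assms by simp
  also have "\<dots> = Suc i * Suc n" by simp
  also have "\<dots> \<le> Suc n * Suc n" using assms by (intro mult_le_mono1) simp
  finally show l: "i * Suc n + j < Suc n * Suc n" .
  have "(i * Suc n + j) div Suc n = i" "(i * Suc n + j) mod Suc n = j"
    using assms(2) by (simp_all add: div_mult_self3 del: mult_Suc_right)
  then show "hermitian_segre n v w (i * Suc n + j) = hermitian_coord v w i j"
    using l by (simp add: hermitian_segre_def del: mult_Suc_right mult_Suc)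
qed

lemma hermitian_coord_invert:
  "(1 + \<i>) * hermitian_coord v w i j - (1 - \<i>) * hermitian_coord v w j i = 4 * \<i> * (v i * w j)"
  by (simp add: hermitian_coord_def algebra_simps)

lemma cnj_hermitian_segre:
  "cnj (hermitian_segre n v w k) = hermitian_segre n (\<lambda>i. cnj (w i)) (\<lambda>i. cnj (v i)) k"
  by (simp add: hermitian_segre_def hermitian_coord_def algebra_simps)

lemma hermitian_segre_scale:
  "hermitian_segre n (\<lambda>i. a * v i) (\<lambda>i. b * w i) k = (a * b) * hermitian_segre n v w k"
  by (simp add: hermitian_segre_def hermitian_coord_def algebra_simps)

abbreviation segre_dim :: "nat \<Rightarrow> nat" where "segre_dim n \<equiv> Suc n * Suc n - 1"

lemma hom_coords_nonzero:
  assumes "v \<in> hom_coords n"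
  obtains i where "i \<le> n" "v i \<noteq> 0"
  using assms by (auto simp: hom_coords_def) (meson not_le)

lemma hermitian_segre_hom_coords:
  assumes v: "v \<in> hom_coords n" and w: "w \<in> hom_coords n"
  shows "hermitian_segre n v w \<in> hom_coords (segre_dim n)"
proof -
  obtain i where i: "i \<le> n" "v i \<noteq> 0" by (rule hom_coords_nonzero[OF v])
  obtain j where j: "j \<le> n" "w j \<noteq> 0" by (rule hom_coords_nonzero[OF w])
  have "hermitian_coord v w i j \<noteq> 0 \<or> hermitian_coord v w j i \<noteq> 0"
    using hermitian_coord_invert[of v w i j] i j by auto
  then have "\<exists>k. hermitian_segre n v w k \<noteq> 0"
    using hermitian_segre_index(2)[OF i(1) j(1)] hermitian_segre_index(2)[OF j(1) i(1)] by metis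
  moreover have "hermitian_segre n v w k = 0" if "k > segre_dim n" for k
    using that by (simp add: hermitian_segre_def del: mult_Suc_right mult_Suc)
  ultimately show ?thesis by (simp add: hom_coords_def)
qed

text \<open>The matrix \<open>v\<^sub>i w\<^sub>j\<close> is determined up to a scalar, and each of its nonzero columns is a multiple of \<open>v\<close>.\<close>

lemma hermitian_segre_inj:
  assumes v: "v \<in> hom_coords n" and w: "w \<in> hom_coords n" and v': "v' \<in> hom_coords n"
    and eq: "proj_point (hermitian_segre n v w) = proj_point (hermitian_segre n v' w')"
  shows "proj_point v = proj_point v'"
proof -
  have "hermitian_segre n v w \<in> proj_point (hermitian_segre n v' w')"
    using eq proj_point_refl by blast
  then obtain c where c: "hermitian_segre n v w = (\<lambda>k. c * hermitian_segre n v' w' k)"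
    by (auto simp: proj_point_def)
  have coord: "hermitian_coord v w i j = c * hermitian_coord v' w' i j" if "i \<le> n" "j \<le> n" for i j
    using fun_cong[OF c, of "i * Suc n + j"] hermitian_segre_index(2)[OF that] by simp
  have prod: "v i * w j = c * (v' i * w' j)" if "i \<le> n" "j \<le> n" for i j
  proof -
    have "4 * \<i> * (v i * w j) = c * (4 * \<i> * (v' i * w' j))"
      unfolding hermitian_coord_invert[symmetric] coord[OF that] coord[OF that(2,1)]
      by (simp add: algebra_simps)
    then show ?thesis by (simp add: mult.left_commute)
  qed
  obtain j where j: "j \<le> n" "w j \<noteq> 0" by (rule hom_coords_nonzero[OF w])
  have "v i * v' l = v l * v' i" if "i \<le> n" "l \<le> n" for i l
  proof -
    have "w j * (v i * v' l) = w j * (v l * v' i)"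
      using prod[OF that(1) j(1)] prod[OF that(2) j(1)] by (metis mult.assoc mult.commute)
    then show ?thesis using j(2) by simp
  qed
  then show ?thesis using proj_point_eq_iff[OF v v'] by blast
qed

context riemann_surface begin

lemma projective_embedding_of_map:
  assumes F: "projective_map X A n F" and inj: "inj_on F (topspace X)"
    and imm: "\<And>U z x i. (U, z) \<in> A \<Longrightarrow> x \<in> U \<Longrightarrow> i \<le> n \<Longrightarrow> F x \<in> affine_part n i \<Longrightarrow>
        \<exists>j\<le>n. deriv (affine_coord i j \<circ> F \<circ> inv_into U z) (z x) \<noteq> 0"
  shows "projective_embedding X A n F"
proof -
  interpret projective_map X A n F by fact
  have T: "openin X {x \<in> U. F x \<in> affine_part n i} \<and>
      (\<forall>j\<le>n. (affine_coord i j \<circ> F \<circ> inv_into U z) holomorphic_on z ` {x \<in> U. F x \<in> affine_part n i})"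
    if c: "(U, z) \<in> A" and i: "i \<le> n" for U z i
  proof -
    let ?W = "{x \<in> topspace X. F x \<in> affine_part n i}"
    have eq: "{x \<in> U. F x \<in> affine_part n i} = U \<inter> ?W" using chart_subset[OF c] by blast
    have W: "openin X ?W" by (rule openin_affine_part)
    have "(affine_coord i j \<circ> F \<circ> inv_into U z) holomorphic_on z ` (U \<inter> ?W)" if "j \<le> n" for j
      by (rule hol_on_chart[OF _ W c]) (use affine_coord_hol_at i that in auto)
    then show ?thesis unfolding eq using chart_openin[OF c] W by blast
  qed
  show ?thesis
    unfolding projective_embedding_def Let_def
    using F_in_proj_space inj T imm by (auto simp del: comp_apply)
qed

end

locale conjugated_embedding = riemann_surface +
  fixes n :: nat and f :: "'a \<Rightarrow> (nat \<Rightarrow> complex) set" and s :: "'a \<Rightarrow> 'a"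
  assumes embedding: "projective_embedding X A n f"
    and antihol: "antihol_map s" and involutive: "\<And>x. x \<in> topspace X \<Longrightarrow> s (s x) = x"
begin

sublocale projective_map X A n f
  by (rule projective_map_of_embedding[OF embedding])

abbreviation segre_coords :: "'a \<Rightarrow> nat \<Rightarrow> complex" where
  "segre_coords x \<equiv> hermitian_segre n (rep x) (\<lambda>i. cnj (rep (s x) i))"

definition segre :: "'a \<Rightarrow> (nat \<Rightarrow> complex) set" where
  "segre x = proj_point (segre_coords x)"

lemma s_in: "x \<in> topspace X \<Longrightarrow> s x \<in> topspace X"
  using antihol continuous_map_in by (simp add: antihol_map_def)

lemma segre_coords_hom_coords: "x \<in> topspace X \<Longrightarrow> segre_coords x \<in> hom_coords (segre_dim n)"
  by (intro hermitian_segre_hom_coords hom_coords_cnj rep s_in)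

text \<open>The definition of \<open>segre\<close> uses arbitrary coordinate vectors; others change the image vector by a
  nonzero scalar only.\<close>

lemma segre_of_lifts:
  assumes x: "x \<in> topspace X" and v: "v \<in> f x" and w: "w \<in> f (s x)"
  shows "segre x = proj_point (hermitian_segre n v (\<lambda>i. cnj (w i)))"
proof -
  obtain a where a: "a \<noteq> 0" "rep x = (\<lambda>i. a * v i)" by (rule rep_scale[OF x v])
  obtain b where b: "b \<noteq> 0" "rep (s x) = (\<lambda>i. b * w i)" by (rule rep_scale[OF s_in[OF x] w])
  have "segre_coords x = (\<lambda>k. (a * cnj b) * hermitian_segre n v (\<lambda>i. cnj (w i)) k)"
    by (simp add: a b hermitian_segre_scale fun_eq_iff)
  then have "segre_coords x \<in> proj_point (hermitian_segre n v (\<lambda>i. cnj (w i)))"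
    using a b by (auto simp: proj_point_def intro!: exI[of _ "a * cnj b"])
  then show ?thesis unfolding segre_def by (rule proj_point_eqI)
qed

lemma segre_conj:
  assumes x: "x \<in> topspace X"
  shows "segre (s x) = conj_point (segre x)"
  by (simp add: segre_def conj_point_proj_point cnj_hermitian_segre involutive[OF x])

lemma segre_inj: "inj_on segre (topspace X)"
proof (rule inj_onI)
  fix x y assume xy: "x \<in> topspace X" "y \<in> topspace X" "segre x = segre y"
  have "proj_point (rep x) = proj_point (rep y)"
    by (rule hermitian_segre_inj[OF rep(2)[OF xy(1)] hom_coords_cnj[OF rep(2)[OF s_in[OF xy(1)]]] rep(2)[OF xy(2)]
          xy(3)[unfolded segre_def]])
  then have "f x = f y" using rep(3) xy by metis
  then show "x = y" using embedding xy by (auto simp: projective_embedding_def dest: inj_onD)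
qed

lemma segre_projective_map: "projective_map X A (segre_dim n) segre"
proof
  fix x assume x: "x \<in> topspace X"
  obtain W v where W: "openin X W" "x \<in> W"
    "\<And>y. y \<in> W \<Longrightarrow> v y \<in> hom_coords n \<and> f y = proj_point (v y) \<and> (\<forall>j. hol_at A (\<lambda>x. v x j) y)"
    using local_lift[OF x] by metis
  obtain V w where V: "openin X V" "s x \<in> V"
    "\<And>y. y \<in> V \<Longrightarrow> w y \<in> hom_coords n \<and> f y = proj_point (w y) \<and> (\<forall>j. hol_at A (\<lambda>x. w x j) y)"
    using local_lift[OF s_in[OF x]] by metis
  let ?N = "W \<inter> {y \<in> topspace X. s y \<in> V}"
  let ?u = "\<lambda>y. hermitian_segre n (v y) (\<lambda>i. cnj (w (s y) i))"
  have N: "openin X ?N"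
    using antihol W(1) openin_continuous_map_preimage[OF _ V(1)] by (auto simp: antihol_map_def)
  have "?u y \<in> hom_coords (segre_dim n) \<and> segre y = proj_point (?u y) \<and> (\<forall>k. hol_at A (\<lambda>y. ?u y k) y)"
    if y: "y \<in> ?N" for y
  proof (intro conjI allI)
    have yX: "y \<in> topspace X" using y by blast
    have vy: "v y \<in> hom_coords n" "f y = proj_point (v y)" "\<And>j. hol_at A (\<lambda>x. v x j) y" using W(3) y by auto
    have wy: "w (s y) \<in> hom_coords n" "f (s y) = proj_point (w (s y))" "\<And>j. hol_at A (\<lambda>x. w x j) (s y)"
      using V(3) y by auto
    show "?u y \<in> hom_coords (segre_dim n)" by (intro hermitian_segre_hom_coords hom_coords_cnj vy wy)
    show "segre y = proj_point (?u y)" by (rule segre_of_lifts[OF yX]) (simp_all add: vy wy)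
    have cw: "hol_at A (\<lambda>y. cnj (w (s y) j)) y" for j by (rule antihol_mapD[OF antihol yX wy(3)])
    show "hol_at A (\<lambda>y. ?u y k) y" for k
      unfolding hermitian_segre_def hermitian_coord_def
      by (cases "k < Suc n * Suc n") (auto simp del: mult_Suc mult_Suc_right intro!: hol_at_intros vy(3) cw)
  qed
  then show "\<exists>W v. openin X W \<and> x \<in> W \<and>
      (\<forall>y\<in>W. v y \<in> hom_coords (segre_dim n) \<and> segre y = proj_point (v y) \<and> (\<forall>j. hol_at A (\<lambda>x. v x j) y))"
    using N W V x by (intro exI[of _ ?N] exI[of _ ?u]) blast
qed

text \<open>The affine coordinates of \<open>f\<close> are ratios of two entries in one column of the matrix, hence ratios of
  linear combinations of the affine coordinates of \<open>segre\<close>. If all of the latter had derivative zero, so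
  would the former, and \<open>f\<close> would not be an immersion.\<close>

lemma segre_immersion:
  assumes c: "(U, z) \<in> A" "x \<in> U" and k: "k \<le> segre_dim n" "segre x \<in> affine_part (segre_dim n) k"
  shows "\<exists>l\<le>segre_dim n. deriv (affine_coord k l \<circ> segre \<circ> inv_into U z) (z x) \<noteq> 0"
proof (rule ccontr)
  assume neg: "\<not> ?thesis"
  interpret S: projective_map X A "segre_dim n" segre by (rule segre_projective_map)
  have x: "x \<in> topspace X" using c chart_subset by blast
  define B where "B i j = affine_coord k (i * Suc n + j) \<circ> segre" for i j
  have dB: "(B i j \<circ> inv_into U z has_field_derivative 0) (at (z x))" if ij: "i \<le> n" "j \<le> n" for i j
  proof -
    have l: "i * Suc n + j \<le> segre_dim n" using hermitian_segre_index(1)[OF ij] by linarith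
    have "hol_at A (B i j) x" unfolding B_def by (rule S.affine_coord_hol_at[OF x k(2,1) l])
    from hol_at_chartD[OF this c] have "(B i j \<circ> inv_into U z) field_differentiable (at (z x))" .
    moreover have "deriv (B i j \<circ> inv_into U z) (z x) = 0" using neg l by (auto simp: B_def)
    ultimately show ?thesis using DERIV_deriv_iff_field_differentiable by metis
  qed
  obtain p where p: "p \<le> n" "rep x p \<noteq> 0" by (rule hom_coords_nonzero[OF rep(2)[OF x]])
  obtain l where l: "l \<le> n" "rep (s x) l \<noteq> 0" by (rule hom_coords_nonzero[OF rep(2)[OF s_in[OF x]]])
  have fx: "f x \<in> affine_part n p" using p affine_part_rep[OF x] by blast
  then have "\<exists>q\<le>n. deriv (affine_coord p q \<circ> f \<circ> inv_into U z) (z x) \<noteq> 0"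
    using embedding c p(1) unfolding projective_embedding_def Let_def by blast
  then obtain q where q: "q \<le> n" "deriv (affine_coord p q \<circ> f \<circ> inv_into U z) (z x) \<noteq> 0" by blast
  let ?num = "\<lambda>y. (1 + \<i>) * B q l y - (1 - \<i>) * B l q y"
  let ?den = "\<lambda>y. (1 + \<i>) * B p l y - (1 - \<i>) * B l p y"
  let ?W = "{y \<in> topspace X. f y \<in> affine_part n p} \<inter> {y \<in> topspace X. s y \<in> {y \<in> topspace X. f y \<in> affine_part n l}}
      \<inter> {y \<in> topspace X. segre y \<in> affine_part (segre_dim n) k}"
  have cont: "continuous_map X X s" using antihol by (simp add: antihol_map_def)
  have W: "openin X ?W"
    by (intro openin_Int openin_affine_part S.openin_affine_part openin_continuous_map_preimage[OF cont])
  have xW: "x \<in> ?W" using x fx k l affine_part_rep[OF s_in[OF x]] s_in[OF x] by auto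
  have Bval: "(1 + \<i>) * B a b y - (1 - \<i>) * B b a y = 4 * \<i> * (rep y a * cnj (rep (s y) b)) / segre_coords y k"
    if "a \<le> n" "b \<le> n" for a b y
    unfolding B_def segre_def comp_apply affine_coord_proj_point hermitian_segre_index(2)[OF that]
      hermitian_segre_index(2)[OF that(2,1)]
    by (simp only: times_divide_eq_right diff_divide_distrib[symmetric] hermitian_coord_invert)
  have nz: "rep y p \<noteq> 0" "rep (s y) l \<noteq> 0" "segre_coords y k \<noteq> 0" if y: "y \<in> ?W" for y
    using y affine_part_rep[of y] affine_part_rep[of "s y"]
      proj_point_in_affine_part[OF segre_coords_hom_coords, of y k] by (auto simp: segre_def)
  have quot: "?num y / ?den y = (affine_coord p q \<circ> f) y" if y: "y \<in> ?W" for y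
    unfolding Bval[OF q(1) l(1)] Bval[OF p(1) l(1)]
    using nz[OF y] y affine_coord_rep[of y p q] by simp
  have den: "?den x \<noteq> 0" unfolding Bval[OF p(1) l(1)] using nz[OF xW] by simp
  let ?inv = "inv_into U z"
  have "((\<lambda>w. (1 + \<i>) * (B a b \<circ> ?inv) w - (1 - \<i>) * (B b a \<circ> ?inv) w) has_field_derivative 0) (at (z x))"
    if "a \<le> n" "b \<le> n" for a b
    using DERIV_diff[OF DERIV_cmult[OF dB[OF that], of "1 + \<i>"] DERIV_cmult[OF dB[OF that(2,1)], of "1 - \<i>"]] by simp
  note D = this
  have "((\<lambda>w. ((1 + \<i>) * (B q l \<circ> ?inv) w - (1 - \<i>) * (B l q \<circ> ?inv) w) /
      ((1 + \<i>) * (B p l \<circ> ?inv) w - (1 - \<i>) * (B l p \<circ> ?inv) w)) has_field_derivative 0) (at (z x))"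
    using DERIV_divide[OF D[OF q(1) l(1)] D[OF p(1) l(1)]] den c by simp
  then have "(affine_coord p q \<circ> f \<circ> ?inv has_field_derivative 0) (at (z x))"
    by (rule has_field_derivative_transform_within_open[OF _ chart_image_open[OF c(1) W]])
       (use c xW quot in auto)
  then show False using q(2) DERIV_imp_deriv by blast
qed

lemma segre_embedding: "projective_embedding X A (segre_dim n) segre"
  by (rule projective_embedding_of_map[OF segre_projective_map segre_inj segre_immersion])

text \<open>The image of \<open>segre\<close> is cut out by all real forms that vanish on it. For a point \<open>P\<close> outside,
  let \<open>p = a + \<i> b\<close> be a form that vanishes on the image but not at \<open>P\<close>, with real \<open>a\<close> and \<open>b\<close>. As the
  image is stable under conjugation, \<open>a - \<i> b\<close> vanishes on it too, hence so do \<open>a\<close> and \<open>b\<close>.\<close>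

theorem isomorphic_to_real_curve: "isomorphic_to_real_curve X A"
proof -
  interpret S: projective_map X A "segre_dim n" segre by (rule segre_projective_map)
  let ?N = "segre_dim n"
  define T where "T = {p \<in> homogeneous_polys ?N. real_poly p \<and> (\<forall>x\<in>topspace X. \<forall>v\<in>segre x. poly_value p v = 0)}"
  have "segre ` topspace X = zero_locus ?N T"
  proof (intro equalityI subsetI)
    fix P assume "P \<in> segre ` topspace X"
    then show "P \<in> zero_locus ?N T" using S.F_in_proj_space by (auto simp: zero_locus_def T_def)
  next
    fix P assume P: "P \<in> zero_locus ?N T"
    then have Pp: "P \<in> proj_space ?N" by (simp add: zero_locus_def)
    show "P \<in> segre ` topspace X"
    proof (rule ccontr)
      assume nP: "P \<notin> segre ` topspace X"
      obtain d Q where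
        Q: "Q \<in> forms ?N d" "\<And>x. x \<in> topspace X \<Longrightarrow> Q (S.rep x) = 0" "\<And>v. v \<in> P \<Longrightarrow> Q v \<noteq> 0"
        by (rule S.chow_separating_form[OF segre_inj Pp nP]) blast
      obtain p where p: "homogeneous_of_degree ?N d p" "Q = poly_value p" using Q(1) by (auto simp: forms_def)
      obtain a b where ab: "homogeneous_of_degree ?N d a" "homogeneous_of_degree ?N d b" "real_poly a" "real_poly b"
        and sum: "\<And>v. poly_value p v = poly_value a v + \<i> * poly_value b v"
        using homogeneous_poly_real_decomposition[OF p(1)] by metis
      have van: "poly_value p v = 0" if "x \<in> topspace X" "v \<in> segre x" for x v
        using Q(2)[OF that(1)] S.form_rep_zero_iff[OF Q(1) that] p(2) by simp
      have "poly_value a v = 0 \<and> poly_value b v = 0" if x: "x \<in> topspace X" and v: "v \<in> segre x" for x v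
      proof -
        have "(\<lambda>i. cnj (v i)) \<in> segre (s x)" using v segre_conj[OF x] by (auto simp: conj_point_def)
        then have "poly_value a (\<lambda>i. cnj (v i)) + \<i> * poly_value b (\<lambda>i. cnj (v i)) = 0"
          using van[OF s_in[OF x]] sum by simp
        then have "cnj (poly_value a v) + \<i> * cnj (poly_value b v) = 0"
          by (simp add: poly_value_cnj_of_real_poly ab)
        then have "cnj (cnj (poly_value a v) + \<i> * cnj (poly_value b v)) = 0" by simp
        then have "poly_value a v = \<i> * poly_value b v" by simp
        moreover have "poly_value a v + \<i> * poly_value b v = 0" using van[OF x v] sum by simp
        ultimately have "2 * (\<i> * poly_value b v) = 0" by simp
        then have "poly_value b v = 0" by simp
        then show ?thesis using \<open>poly_value a v = \<i> * poly_value b v\<close> by simp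
      qed
      then have "a \<in> T" "b \<in> T" using ab homogeneous_polys_degree unfolding T_def by blast+
      obtain v where "P = proj_point v" using Pp unfolding proj_space_def by blast
      then have v: "v \<in> P" by simp
      then have "poly_value a v = 0" "poly_value b v = 0"
        using P \<open>a \<in> T\<close> \<open>b \<in> T\<close> by (auto simp: zero_locus_def)
      then show False using Q(3)[OF v] sum p(2) by simp
    qed
  qed
  moreover have "T \<subseteq> homogeneous_polys ?N" "\<forall>p\<in>T. real_poly p" by (auto simp: T_def)
  ultimately show ?thesis
    using segre_embedding unfolding isomorphic_to_real_curve_def isomorphic_to_curve_def by blast
qed

end

section \<open>Surfaces that are not pseudoreal\<close>

theorem theorem2:
  fixes X :: "'a topology" and A :: "'a atlas" and G :: "('a \<Rightarrow> 'a) monoid"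
  assumes "compact_riemann_surface X A"
    and "G = conformal_aut_group X A"
    and "group_center G = {\<one>\<^bsub>G\<^esub>}"
    and "(\<nexists>x. is_involution (outer_aut_group G) x) \<or>
         (\<exists>H. group_complement (AutoGroup G) (inner_auts G) H)"
  shows "\<not> pseudoreal X A"
proof
  assume "pseudoreal X A"
  then have conj: "isomorphic_to_conjugate X A" and not_real: "\<not> isomorphic_to_real_curve X A"
    by (simp_all add: pseudoreal_def)
  interpret riemann_surface X A by (rule riemann_surface.intro) fact
  obtain s where s: "antihol_map s" "\<forall>x\<in>topspace X. s (s x) = x"
    using antiholomorphic_involution[OF conj assms(2-4)] by blast
  obtain n S where "isomorphic_to_curve X A n S"
    using conj unfolding isomorphic_to_conjugate_def by blast
  then obtain f where f: "projective_embedding X A n f"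
    unfolding isomorphic_to_curve_def by blast
  interpret conjugated_embedding X A n f s
    by unfold_locales (use f s in auto)
  show False using not_real isomorphic_to_real_curve by blast
qed

end
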